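(* Let $A$ be a unital associative $\mathbf{k}$-algebra such that $\mathbf{k}\to A$ is a $\mathbf{k}$-split injection, where $\mathbf{k}$ is a unital commutative $\mathbb{Q}$-algebra. For every $q\ge0$, each of the maps $$\mathsf{E}^q:\ H^\bullet(\overline{\Omega},\mathsf{b})\longrightarrow H(\overline{\mathrm{DR}}_t,\mathsf{i}_t)^{\bullet,q},\qquad \mathsf{E}^q:\ H^\bullet(\overline{\Omega}/\mathsf{B}\overline{\Omega},\ \mathsf{b})\longrightarrow H(\overline{\mathrm{DR}}_t/\mathsf{d}\,\overline{\mathrm{DR}}_t,\ \mathsf{i}_t)^{\bullet,q},$$ induced by the component of the Tsygan map of degree $q$ in $t$, is an isomorphism.
   Context: $\mathbf{k}$ is a unital commutative $\mathbb{Q}$-algebra, $\otimes=\otimes_{\mathbf{k}}$, $\overline{A}=A/\mathbf{k}$. Noncommutative differential forms: $\Omega=\Omega A$ is the dg algebra generated by $A$ (degree $0$) and symbols $\mathsf{d}a$ (degree $1$), $\mathbf{k}$-linear in $a\in\overline{A}$, with relations: products of elements of $A$ are as in $A$ (same unit), and $\mathsf{d}(ab)=\mathsf{d}a\,b+a\,\mathsf{d}b$; the differential is $a\mapsto \mathsf{d}a\mapsto 0$. One has $A\otimes\overline{A}^{\otimes n}\cong\Omega^nA$ via $a_0\otimes\cdots\otimes a_n\mapsto a_0\,\mathsf{d}a_1\cdots \mathsf{d}a_n$. Commutators are supercommutators. $\overline{\Omega}=\Omega/\mathbf{k}$. Operators on $\overline{\Omega}$: $\mathsf{b}(\alpha\,\mathsf{d}a)=(-1)^{n-1}[\alpha,a]$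 for $\alpha\in\Omega^{n-1}A$, $a\in A$, $\mathsf{b}|_{\Omega^0}=0$; $\kappa(\alpha\,\mathsf{d}a)=(-1)^{|\alpha|}\mathsf{d}a\,\alpha$ on forms of degree $\ge1$; $\mathsf{B}|_{\overline{\Omega}^n}=(\mathrm{Id}+\kappa+\cdots+\kappa^n)\mathsf{d}$. Extended forms: $\Omega_t=\Omega A*_{\mathbf{k}}\mathbf{k}[t]$ (free product), bigraded as $\Omega_t^{p,q}$ with $p$ the de Rham degree and $q$ the degree in $t$ ($t$ is even of de Rham degree $0$). $\mathrm{DR}_t=\Omega_t/[\Omega_t,\Omega_t]$ (supercommutators), with induced bigrading; $f_\natural$ is the image of $f\in\Omega_t$; $\overline{\mathrm{DR}}_t=\mathrm{DR}_t/\mathbf{k}[t]$. The superderivation $\mathsf{d}$ of $\Omega_t$ extending $\mathsf{d}$ on $\Omega$ with $\mathsf{d}t=0$, and the superderivation $\mathbf{i}_t$ with $t\mapsto0$, $a\mapsto0$, $\mathsf{d}a\mapsto[a,t]$ $(a\in A)$, descend to anticommuting square-zero differentials $\mathsf{d}$, $\mathsf{i}_t$ on $\overline{\mathrm{DR}}_t$, with $\mathsf{i}_t:\overline{\mathrm{DR}}_t^{p,q}\to\overline{\mathrm{DR}}_t^{p-1,q+1}$. Homology groups of $\mathsf{i}_t$ on $\overline{\mathrm{DR}}_t$ and on $\overline{\mathrm{DR}}_t/\mathsf{d}\overline{\mathrm{DR}}_t$ are thus bigraded, $H(-,\mathsf{i}_t)^{p,q}$ being the homology at bidegree $(p,q)$.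 The Tsygan map $\mathsf{E}:\overline{\Omega}\to\prod_{q\ge0}\overline{\mathrm{DR}}_t^{\bullet,q}$ is $$\mathsf{E}(a_0\,\mathsf{d}a_1\cdots\mathsf{d}a_n)=\sum_{k_0,\ldots,k_n\ge0}\frac{1}{(k_0+\cdots+k_n+n)!}\,(a_0t^{k_0}\,\mathsf{d}a_1\,t^{k_1}\cdots\mathsf{d}a_n\,t^{k_n})_\natural .$$ It satisfies $\mathsf{E}\mathsf{B}=\mathsf{d}\mathsf{E}$ and $\mathsf{E}\mathsf{b}=\mathsf{i}_t\mathsf{E}$; hence, taking the component of degree $q$ in $t$, it induces the maps $\mathsf{E}^q$ of the claim. *)

theory Defs
  imports Complex_Main "HOL-Library.Poly_Mapping"
begin

text \<open>Not necessarily commutative unital algebras over a commutative ring. The unit map of the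
  algebra is \<open>\<lambda>c. scale c 1\<close>; its image is central by the two axioms.\<close>

locale unital_algebra = module scale
  for scale :: "'k::comm_ring_1 \<Rightarrow> 'a::ring_1 \<Rightarrow> 'a" +
  assumes scale_mult_left: "scale c (x * y) = scale c x * y"
    and scale_mult_right: "scale c (x * y) = x * scale c y"

definition split_unit :: "('k::comm_ring_1 \<Rightarrow> 'a::ring_1 \<Rightarrow> 'a) \<Rightarrow> bool" where
  "split_unit scale \<longleftrightarrow> (\<exists>r. module_hom scale (*) r \<and> (\<forall>c. r (scale c 1) = c))"


section \<open>Free algebras\<close>

text \<open>The free algebra on \<open>'g\<close> is the monoid algebra of the free monoid; finitely supported
  functions on a (non-commutative) monoid carry the convolution product.\<close>

datatype 'g free_word = Word (letters: "'g list")

instantiation free_word :: (type) monoid_add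
begin

definition zero_free_word :: "'a free_word" where
  "zero_free_word = Word []"

definition plus_free_word :: "'a free_word \<Rightarrow> 'a free_word \<Rightarrow> 'a free_word" where
  "plus_free_word u v = Word (letters u @ letters v)"

instance
  by standard (simp_all add: zero_free_word_def plus_free_word_def)

end

type_synonym ('g, 'k) free_alg = "'g free_word \<Rightarrow>\<^sub>0 'k"

definition fscale :: "'k::comm_ring_1 \<Rightarrow> ('g, 'k) free_alg \<Rightarrow> ('g, 'k) free_alg" where
  "fscale c f = Poly_Mapping.single 0 c * f"

interpretation free: module fscale
proof
  fix a b :: "'k::comm_ring_1" and x y :: "('g, 'k) free_alg"
  show "fscale a (x + y) = fscale a x + fscale a y"
    by (simp add: fscale_def distrib_left)
  show "fscale (a + b) x = fscale a x + fscale b x"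
    by (simp add: fscale_def single_add distrib_right)
  show "fscale a (fscale b x) = fscale (a * b) x"
    by (simp add: fscale_def mult.assoc[symmetric] mult_single)
  show "fscale 1 x = x"
    by (simp add: fscale_def)
qed

definition monomial :: "'g list \<Rightarrow> ('g, 'k::comm_ring_1) free_alg" where
  "monomial xs = Poly_Mapping.single (Word xs) 1"

definition lin_ext ::
  "('g list \<Rightarrow> ('h, 'k::comm_ring_1) free_alg) \<Rightarrow> ('g, 'k) free_alg \<Rightarrow> ('h, 'k) free_alg" where
  "lin_ext \<phi> f = (\<Sum>w\<in>Poly_Mapping.keys f. fscale (Poly_Mapping.lookup f w) (\<phi> (letters w)))"

definition word_deg :: "('g \<Rightarrow> nat) \<Rightarrow> 'g list \<Rightarrow> nat" where
  "word_deg deg xs = sum_list (map deg xs)"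

definition homog :: "('g \<Rightarrow> nat) \<Rightarrow> nat \<Rightarrow> ('g, 'k::comm_ring_1) free_alg set" where
  "homog deg n = {f. \<forall>w\<in>Poly_Mapping.keys f. word_deg deg (letters w) = n}"

definition two_sided_ideal ::
  "('g, 'k::comm_ring_1) free_alg set \<Rightarrow> ('g, 'k) free_alg set" where
  "two_sided_ideal R = free.span {u * r * v | u r v. r \<in> R}"

definition supercommutators :: "('g \<Rightarrow> nat) \<Rightarrow> ('g, 'k::comm_ring_1) free_alg set" where
  "supercommutators deg =
     {f * g - (-1) ^ (m * n) * (g * f) | f g m n. f \<in> homog deg m \<and> g \<in> homog deg n}"

text \<open>The odd superderivation of the free algebra with prescribed values \<open>\<delta>\<close> on the generators:
  \<open>x\<^sub>1\<cdots>x\<^sub>n \<mapsto> \<Sum>\<^sub>i (-1)\<^bsup>|x\<^sub>1|+\<cdots>+|x\<^sub>i\<^sub>-\<^sub>1|\<^esup> x\<^sub>1\<cdots>\<delta>(x\<^sub>i)\<cdots>x\<^sub>n\<close>.\<close>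

fun superder_word ::
  "('g \<Rightarrow> nat) \<Rightarrow> ('g \<Rightarrow> ('g, 'k::comm_ring_1) free_alg) \<Rightarrow> 'g list \<Rightarrow> ('g, 'k) free_alg" where
  "superder_word deg \<delta> [] = 0"
| "superder_word deg \<delta> (x # xs) =
     \<delta> x * monomial xs + (-1) ^ deg x * (monomial [x] * superder_word deg \<delta> xs)"

definition superder ::
  "('g \<Rightarrow> nat) \<Rightarrow> ('g \<Rightarrow> ('g, 'k::comm_ring_1) free_alg) \<Rightarrow> ('g, 'k) free_alg \<Rightarrow> ('g, 'k) free_alg"
  where "superder deg \<delta> = lin_ext (superder_word deg \<delta>)"


section \<open>Quotients and homology\<close>

text \<open>All modules below are quotients \<open>F/N\<close> of a free algebra \<open>F\<close> by a submodule \<open>N\<close>. Since \<open>F\<close> is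
  free as a module, every linear map \<open>F/N \<rightarrow> F'/N'\<close> is induced by a linear \<open>f : F \<rightarrow> F'\<close> with
  \<open>f(N) \<subseteq> N'\<close>, and maps between quotients are represented by such lifts.\<close>

definition quot_linear ::
  "('g, 'k::comm_ring_1) free_alg set \<Rightarrow> ('h, 'k) free_alg set \<Rightarrow>
   (('g, 'k) free_alg \<Rightarrow> ('h, 'k) free_alg) \<Rightarrow> bool" where
  "quot_linear N N' f \<longleftrightarrow> module_hom fscale fscale f \<and> f ` N \<subseteq> N'"

definition residue_class :: "'v::ab_group_add set \<Rightarrow> 'v \<Rightarrow> 'v set" where
  "residue_class N x = {y. y - x \<in> N}"

text \<open>The submodule representing \<open>(F/N) / \<delta>(F/N)\<close>.\<close>

definition add_image ::
  "('g, 'k::comm_ring_1) free_alg set \<Rightarrow> (('g, 'k) free_alg \<Rightarrow> ('g, 'k) free_alg) \<Rightarrow>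
   ('g, 'k) free_alg set" where
  "add_image N \<delta> = free.span (N \<union> range \<delta>)"

text \<open>Cycles and homology of \<open>(F/N, \<delta>)\<close> in the graded piece that is the image of \<open>G \<subseteq> F\<close>. For
  graded \<open>N\<close> and homogeneous \<open>\<delta>\<close>, two cycles in \<open>G\<close> differ by a boundary coming from the
  neighbouring graded piece iff they differ by any boundary, so one may quotient by \<open>N + \<delta>(F)\<close>.\<close>

definition cycles ::
  "('g, 'k::comm_ring_1) free_alg set \<Rightarrow> (('g, 'k) free_alg \<Rightarrow> ('g, 'k) free_alg) \<Rightarrow>
   ('g, 'k) free_alg set \<Rightarrow> ('g, 'k) free_alg set" where
  "cycles N \<delta> G = {x \<in> G. \<delta> x \<in> N}"

definition homology ::
  "('g, 'k::comm_ring_1) free_alg set \<Rightarrow> (('g, 'k) free_alg \<Rightarrow> ('g, 'k) free_alg) \<Rightarrow>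
   ('g, 'k) free_alg set \<Rightarrow> ('g, 'k) free_alg set set" where
  "homology N \<delta> G = residue_class (add_image N \<delta>) ` cycles N \<delta> G"

text \<open>The linear map \<open>f\<close> induces, by \<open>[x] \<mapsto> [f x]\<close>, a well-defined bijection on homology. The
  induced map is automatically linear when \<open>f\<close> is.\<close>

definition homology_iso ::
  "(('g, 'k::comm_ring_1) free_alg \<Rightarrow> ('h, 'k) free_alg) \<Rightarrow>
   ('g, 'k) free_alg set \<Rightarrow> (('g, 'k) free_alg \<Rightarrow> ('g, 'k) free_alg) \<Rightarrow> ('g, 'k) free_alg set \<Rightarrow>
   ('h, 'k) free_alg set \<Rightarrow> (('h, 'k) free_alg \<Rightarrow> ('h, 'k) free_alg) \<Rightarrow> ('h, 'k) free_alg set \<Rightarrow>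
   bool" where
  "homology_iso f N \<delta> G N' \<delta>' G' \<longleftrightarrow>
     module_hom fscale fscale f \<and>
     (\<exists>\<phi>. (\<forall>x\<in>cycles N \<delta> G.
             \<phi> (residue_class (add_image N \<delta>) x) = residue_class (add_image N' \<delta>') (f x)) \<and>
          bij_betw \<phi> (homology N \<delta> G) (homology N' \<delta>' G'))"


section \<open>Noncommutative differential forms\<close>

text \<open>Defining relations between the generators \<open>e a\<close> (standing for \<open>a\<close>) and \<open>\<delta> a\<close> (standing for
  \<open>da\<close>). Together with linearity, \<open>\<delta> (scale c 1) = 0\<close> says that \<open>da\<close> depends linearly on the class
  of \<open>a\<close> modulo the ground ring.\<close>

definition form_rels ::
  "('k::comm_ring_1 \<Rightarrow> 'a::ring_1 \<Rightarrow> 'a) \<Rightarrow> ('a \<Rightarrow> ('g, 'k) free_alg) \<Rightarrow> ('a \<Rightarrow> ('g, 'k) free_alg) \<Rightarrow>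
   ('g, 'k) free_alg set" where
  "form_rels scale e \<delta> =
     {e 1 - 1}
     \<union> {e (a * b) - e a * e b | a b. True}
     \<union> {e (a + b) - (e a + e b) | a b. True}
     \<union> {e (scale c a) - fscale c (e a) | c a. True}
     \<union> {\<delta> (a + b) - (\<delta> a + \<delta> b) | a b. True}
     \<union> {\<delta> (scale c a) - fscale c (\<delta> a) | c a. True}
     \<union> {\<delta> (scale c 1) | c. True}
     \<union> {\<delta> (a * b) - (\<delta> a * e b + e a * \<delta> b) | a b. True}"

datatype 'a form_gen = Elt 'a | Dif 'a

type_synonym ('a, 'k) form_free = "('a form_gen, 'k) free_alg"

fun form_deg :: "'a form_gen \<Rightarrow> nat" where
  "form_deg (Elt a) = 0"
| "form_deg (Dif a) = 1"

definition elt :: "'a \<Rightarrow> ('a, 'k::comm_ring_1) form_free" where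
  "elt a = monomial [Elt a]"

definition dif :: "'a \<Rightarrow> ('a, 'k::comm_ring_1) form_free" where
  "dif a = monomial [Dif a]"

text \<open>\<open>\<Omega>\<close> is the free algebra modulo \<open>form_ideal\<close>, and \<open>\<Omega>/k\<close> is the free algebra modulo
  \<open>reduced_form_sub\<close>.\<close>

definition form_ideal ::
  "('k::comm_ring_1 \<Rightarrow> 'a::ring_1 \<Rightarrow> 'a) \<Rightarrow> ('a, 'k) form_free set" where
  "form_ideal scale = two_sided_ideal (form_rels scale elt dif)"

definition reduced_form_sub ::
  "('k::comm_ring_1 \<Rightarrow> 'a::ring_1 \<Rightarrow> 'a) \<Rightarrow> ('a, 'k) form_free set" where
  "reduced_form_sub scale = free.span (form_ideal scale \<union> {1})"

fun form_d_gen :: "'a form_gen \<Rightarrow> ('a, 'k::comm_ring_1) form_free" where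
  "form_d_gen (Elt a) = dif a"
| "form_d_gen (Dif a) = 0"

definition form_d :: "('a, 'k::comm_ring_1) form_free \<Rightarrow> ('a, 'k) form_free" where
  "form_d = superder form_deg form_d_gen"

text \<open>The next two operators, and the Tsygan map below, are determined on the quotients by their
  values on the indicated elements; \<open>SOME\<close> only picks a lift to the free algebra.\<close>

definition hochschild_b ::
  "('k::comm_ring_1 \<Rightarrow> 'a::ring_1 \<Rightarrow> 'a) \<Rightarrow> ('a, 'k) form_free \<Rightarrow> ('a, 'k) form_free" where
  "hochschild_b scale = (SOME b.
     quot_linear (reduced_form_sub scale) (reduced_form_sub scale) b \<and>
     (\<forall>\<alpha>\<in>homog form_deg 0. b \<alpha> \<in> reduced_form_sub scale) \<and>
     (\<forall>m a. \<forall>\<alpha>\<in>homog form_deg m.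
        b (\<alpha> * dif a) - (-1) ^ m * (\<alpha> * elt a - elt a * \<alpha>) \<in> reduced_form_sub scale))"

text \<open>The values of \<open>\<kappa>\<close> in degree \<open>0\<close> are left open; they do not enter the definition of \<open>B\<close>.\<close>

definition karoubi ::
  "('k::comm_ring_1 \<Rightarrow> 'a::ring_1 \<Rightarrow> 'a) \<Rightarrow> ('a, 'k) form_free \<Rightarrow> ('a, 'k) form_free" where
  "karoubi scale = (SOME \<kappa>.
     quot_linear (form_ideal scale) (form_ideal scale) \<kappa> \<and>
     (\<forall>m a. \<forall>\<alpha>\<in>homog form_deg m.
        \<kappa> (\<alpha> * dif a) - (-1) ^ m * (dif a * \<alpha>) \<in> form_ideal scale))"

definition connes_B ::
  "('k::comm_ring_1 \<Rightarrow> 'a::ring_1 \<Rightarrow> 'a) \<Rightarrow> ('a, 'k) form_free \<Rightarrow> ('a, 'k) form_free" where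
  "connes_B scale =
     lin_ext (\<lambda>w. \<Sum>i\<le>word_deg form_deg w. (karoubi scale ^^ i) (form_d (monomial w)))"


section \<open>Extended forms\<close>

text \<open>The free product of an algebra given by generators and relations with \<open>k[t]\<close> has the same
  relations and one additional free generator.\<close>

datatype 'a ext_gen = Form "'a form_gen" | T

type_synonym ('a, 'k) ext_free = "('a ext_gen, 'k) free_alg"

fun ext_form_deg :: "'a ext_gen \<Rightarrow> nat" where
  "ext_form_deg (Form x) = form_deg x"
| "ext_form_deg T = 0"

fun ext_t_deg :: "'a ext_gen \<Rightarrow> nat" where
  "ext_t_deg (Form x) = 0"
| "ext_t_deg T = 1"

definition ext_homog :: "nat \<Rightarrow> nat \<Rightarrow> ('a, 'k::comm_ring_1) ext_free set" where
  "ext_homog p q = homog ext_form_deg p \<inter> homog ext_t_deg q"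

definition ext_elt :: "'a \<Rightarrow> ('a, 'k::comm_ring_1) ext_free" where
  "ext_elt a = monomial [Form (Elt a)]"

definition ext_dif :: "'a \<Rightarrow> ('a, 'k::comm_ring_1) ext_free" where
  "ext_dif a = monomial [Form (Dif a)]"

definition ext_t :: "('a, 'k::comm_ring_1) ext_free" where
  "ext_t = monomial [T]"

definition ext_ideal ::
  "('k::comm_ring_1 \<Rightarrow> 'a::ring_1 \<Rightarrow> 'a) \<Rightarrow> ('a, 'k) ext_free set" where
  "ext_ideal scale = two_sided_ideal (form_rels scale ext_elt ext_dif)"

text \<open>\<open>(\<Omega>\<^sub>t / [\<Omega>\<^sub>t, \<Omega>\<^sub>t]) / k[t]\<close> is the free algebra modulo the following submodule.\<close>

definition reduced_DR_sub ::
  "('k::comm_ring_1 \<Rightarrow> 'a::ring_1 \<Rightarrow> 'a) \<Rightarrow> ('a, 'k) ext_free set" where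
  "reduced_DR_sub scale =
     free.span (ext_ideal scale \<union> supercommutators ext_form_deg \<union> range (\<lambda>n. ext_t ^ n))"

fun ext_d_gen :: "'a ext_gen \<Rightarrow> ('a, 'k::comm_ring_1) ext_free" where
  "ext_d_gen (Form (Elt a)) = ext_dif a"
| "ext_d_gen (Form (Dif a)) = 0"
| "ext_d_gen T = 0"

definition ext_d :: "('a, 'k::comm_ring_1) ext_free \<Rightarrow> ('a, 'k) ext_free" where
  "ext_d = superder ext_form_deg ext_d_gen"

fun ext_i_gen :: "'a ext_gen \<Rightarrow> ('a, 'k::comm_ring_1) ext_free" where
  "ext_i_gen (Form (Elt a)) = 0"
| "ext_i_gen (Form (Dif a)) = ext_elt a * ext_t - ext_t * ext_elt a"
| "ext_i_gen T = 0"

definition ext_i :: "('a, 'k::comm_ring_1) ext_free \<Rightarrow> ('a, 'k) ext_free" where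
  "ext_i = superder ext_form_deg ext_i_gen"


section \<open>The Tsygan map\<close>

text \<open>The component of degree \<open>q\<close> in \<open>t\<close>: on \<open>a\<^sub>0 da\<^sub>1 \<cdots> da\<^sub>n\<close> it is the sum over all
  \<open>ks = [k\<^sub>0, \<dots>, k\<^sub>n]\<close> with \<open>k\<^sub>0 + \<cdots> + k\<^sub>n = q\<close>. The rational coefficient is taken in the ground
  ring, viewed as a rational algebra through \<open>qscale\<close>.\<close>

definition tsygan_value ::
  "(rat \<Rightarrow> 'k::comm_ring_1 \<Rightarrow> 'k) \<Rightarrow> nat \<Rightarrow> 'a \<Rightarrow> 'a list \<Rightarrow> ('a, 'k) ext_free" where
  "tsygan_value qscale q a as =
     (\<Sum>ks\<in>{ks. length ks = Suc (length as) \<and> sum_list ks = q}.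
        fscale (qscale (1 / fact (q + length as)) 1)
          (prod_list (map2 (\<lambda>x k. x * ext_t ^ k) (ext_elt a # map ext_dif as) ks)))"

definition tsygan ::
  "(rat \<Rightarrow> 'k::comm_ring_1 \<Rightarrow> 'k) \<Rightarrow> ('k \<Rightarrow> 'a::ring_1 \<Rightarrow> 'a) \<Rightarrow> nat \<Rightarrow>
   ('a, 'k) form_free \<Rightarrow> ('a, 'k) ext_free" where
  "tsygan qscale scale q = (SOME E.
     quot_linear (reduced_form_sub scale) (reduced_DR_sub scale) E \<and>
     (\<forall>a as. E (elt a * prod_list (map dif as)) - tsygan_value qscale q a as
               \<in> reduced_DR_sub scale))"

end

theory Submission
  imports Defs
begin

text \<open>
  Extended forms modulo commutators with elements of \<open>A\<close> only, with the differential \<open>i\<^sub>t\<close>, are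
  obtained from powers of the two-term resolution \<open>\<Omega>\<^sup>1A \<rightarrow> A \<otimes> A\<close> of \<open>A\<close>, generated by the \<open>da\<close> and by
  \<open>t\<close>. A contraction of this resolution removes one \<open>t\<close> at a time, so by induction on \<open>q\<close> every cycle of
  degree \<open>q\<close> in \<open>t\<close> comes from a Hochschild cycle under the Tsygan map. Modulo all supercommutators
  one reduces to this case by summing over the rotations of cyclic words. For injectivity one puts
  \<open>t = 1\<close>, which kills \<open>i\<^sub>t\<close> and turns the Tsygan map into a positive integer multiple of the identity;
  supercommutators then only leave terms \<open>b y + d b z\<close>, which are boundaries on cycles because \<open>B\<close> acts
  as a multiple of \<open>d\<close> on Karoubi-invariant forms.

  For the quotients by \<open>B\<close> and \<open>d\<close>, a cycle \<open>f\<close> satisfies \<open>i\<^sub>t f = d g\<close> up to commutators. Forms of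
  positive degree in \<open>t\<close> satisfy a Poincare lemma for \<open>d\<close>, which makes \<open>g\<close> a cycle of lower de Rham
  degree; induction provides \<open>y\<close> with \<open>E B y\<close> homologous to \<open>d g\<close>, and \<open>B y\<close> is a boundary by the first part.
\<close>

section \<open>Linear maps and gradings on free algebras\<close>

text \<open>Modules are quotients of free algebras, and the forms
  \<open>a\<^sub>0 da\<^sub>1 ... da\<^sub>n\<close> serve as a spanning set only. An operator is
  therefore defined by recursion on arbitrary words; many of its identities then hold exactly, and
  its compatibility with the relations between forms is a separate check. The obstacle is that the
  contraction acts at the start of a word, whereas a class modulo supercommutators is a cyclic word,
  which has no start. Commutators with \<open>A\<close> glue the ends of a word without forgetting
  where it starts; summing over all starts costs a factor \<open>p + q\<close>, the number of
  letters \<open>da\<close> and \<open>t\<close>. The Poincare lemma meets the same obstacle: it is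
  proved for linear words, and cutting a cyclic word at each \<open>t\<close> in turn transports it
  at the cost of a factor, the degree in \<open>t\<close>, which must be positive. The factorial
  \<open>(q + n)!\<close> comes from \<open>B\<close>: a cyclic word with \<open>n + 1\<close>
  letters \<open>da\<close> and \<open>q\<close> letters \<open>t\<close> can be cut inside a power
  of \<open>t\<close> in \<open>q + n + 1\<close> ways, while passing from \<open>b\<close> to
  \<open>i\<^sub>t\<close> preserves \<open>q + n\<close>.\<close>

abbreviation lin :: "(('g, 'k::comm_ring_1) free_alg \<Rightarrow> ('h, 'k) free_alg) \<Rightarrow> bool" where
  "lin f \<equiv> module_hom fscale fscale f"

lemma fscale_mult_left: "fscale c f * g = fscale c (f * g)"
  by (simp add: fscale_def mult.assoc)

lemma single_zero_commute:
  "Poly_Mapping.single 0 c * f = f * Poly_Mapping.single 0 (c::'k::comm_ring_1)"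
  for f :: "('g, 'k::comm_ring_1) free_alg"
proof (induction f rule: update_induct)
  case const
  then show ?case by simp
next
  case (update f a b)
  have "Poly_Mapping.update a b f = f + Poly_Mapping.single a b"
    using update.hyps by (intro poly_mapping_eqI)
      (auto simp: lookup_update lookup_add lookup_single not_in_keys_iff_lookup_eq_zero when_def)
  then show ?case
    using update.IH by (simp add: distrib_left distrib_right mult_single mult.commute)
qed

lemma fscale_mult_right: "f * fscale c g = fscale c (f * g)"
  by (metis fscale_def mult.assoc single_zero_commute)

lemma monomial_Nil [simp]: "monomial [] = 1"
  by (simp add: monomial_def flip: zero_free_word_def)

lemma monomial_append: "monomial (u @ v) = monomial u * monomial v"
  by (simp add: monomial_def mult_single plus_free_word_def)

lemma monomial_Cons: "monomial (x # u) = monomial [x] * monomial u"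
  using monomial_append[of "[x]" u] by simp

lemma free_alg_eq_sum:
  fixes f :: "('g, 'k::comm_ring_1) free_alg"
  shows "f = (\<Sum>w\<in>Poly_Mapping.keys f. fscale (Poly_Mapping.lookup f w) (monomial (letters w)))"
proof (rule poly_mapping_eqI)
  fix v
  have *: "fscale c (monomial (letters w)) = Poly_Mapping.single w c" for c :: 'k and w :: "'g free_word"
    by (cases w) (simp add: fscale_def monomial_def mult_single)
  show "Poly_Mapping.lookup f v =
      Poly_Mapping.lookup (\<Sum>w\<in>Poly_Mapping.keys f.
        fscale (Poly_Mapping.lookup f w) (monomial (letters w))) v"
    by (simp add: * lookup_sum lookup_single when_def sum.delta in_keys_iff)
qed

lemma linI:
  assumes "\<And>x y. f (x + y) = f x + f y" "\<And>c x. f (fscale c x) = fscale c (f x)"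
  shows "lin f"
  using assms by unfold_locales auto

lemma free_alg_induct [case_names add scale monomial]:
  assumes "\<And>x y. P x \<Longrightarrow> P y \<Longrightarrow> P (x + y)" "\<And>c x. P x \<Longrightarrow> P (fscale c x)"
    and "\<And>w. P (monomial w)"
  shows "P f"
proof -
  have zero: "P 0" using assms(2)[of "monomial []" 0] assms(3)[of "[]"] by simp
  have "P (\<Sum>w\<in>S. fscale (Poly_Mapping.lookup f w) (monomial (letters w)))"
    if "finite S" for S
    using that by (induction S) (auto intro: zero assms)
  from this[of "Poly_Mapping.keys f"] show ?thesis by (simp flip: free_alg_eq_sum)
qed

lemma lin_eqI:
  assumes "lin f" "lin g" "\<And>w. f (monomial w) = g (monomial w)"
  shows "f x = g x"
  by (induction x rule: free_alg_induct)
    (simp_all add: assms module_hom.add[OF assms(1)] module_hom.add[OF assms(2)]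
      module_hom.scale[OF assms(1)] module_hom.scale[OF assms(2)])

lemma lin_memI:
  assumes "lin f" "free.subspace N" "\<And>w. f (monomial w) \<in> N"
  shows "f x \<in> N"
  by (induction x rule: free_alg_induct)
    (auto simp: module_hom.add[OF assms(1)] module_hom.scale[OF assms(1)]
      intro: free.subspace_add[OF assms(2)] free.subspace_scale[OF assms(2)] assms(3))

lemma lin_ext_eq_sum:
  assumes "finite S" "Poly_Mapping.keys f \<subseteq> S"
  shows "lin_ext \<phi> f = (\<Sum>w\<in>S. fscale (Poly_Mapping.lookup f w) (\<phi> (letters w)))"
  unfolding lin_ext_def using assms
  by (intro sum.mono_neutral_left) (auto simp: in_keys_iff)

named_theorems lin_intros

lemma lin_lin_ext [lin_intros]:
  fixes \<phi> :: "'g list \<Rightarrow> ('h, 'k::comm_ring_1) free_alg"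
  shows "lin (lin_ext \<phi>)"
proof (rule linI)
  fix x y :: "('g, 'k) free_alg" and c :: 'k
  let ?S = "Poly_Mapping.keys x \<union> Poly_Mapping.keys y \<union> Poly_Mapping.keys (x + y)"
  show "lin_ext \<phi> (x + y) = lin_ext \<phi> x + lin_ext \<phi> y"
    by (simp add: lin_ext_eq_sum[of ?S x] lin_ext_eq_sum[of ?S y] lin_ext_eq_sum[of ?S "x + y"]
        le_supI1 le_supI2 lookup_add free.scale_left_distrib sum.distrib)
  have lk: "Poly_Mapping.lookup (fscale c x) w = c * Poly_Mapping.lookup x w" for w
    using mult_map_scale_conv_mult[of c x] 
    by (simp add: fscale_def Poly_Mapping.map.rep_eq when_def flip: mult_map_scale_conv_mult)
  let ?S = "Poly_Mapping.keys x \<union> Poly_Mapping.keys (fscale c x)"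
  show "lin_ext \<phi> (fscale c x) = fscale c (lin_ext \<phi> x)"
    by (simp add: lin_ext_eq_sum[of ?S x] lin_ext_eq_sum[of ?S "fscale c x"] lk free.scale_sum_right)
qed

lemma lin_ext_monomial [simp]: "lin_ext \<phi> (monomial w) = \<phi> w"
  by (simp add: lin_ext_def monomial_def)

lemma lin_id [lin_intros]: "lin (\<lambda>x. x)"
  by (rule linI) auto

lemma lin_zero [lin_intros]: "lin (\<lambda>x. 0)"
  by (rule linI) auto

lemma lin_plus [lin_intros]: "lin f \<Longrightarrow> lin g \<Longrightarrow> lin (\<lambda>x. f x + g x)"
  by (rule linI) (simp_all add: module_hom.add module_hom.scale free.scale_right_distrib)

lemma lin_minus [lin_intros]: "lin f \<Longrightarrow> lin g \<Longrightarrow> lin (\<lambda>x. f x - g x)"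
  by (rule linI) (simp_all add: module_hom.add module_hom.scale free.scale_right_diff_distrib)

lemma lin_uminus [lin_intros]: "lin f \<Longrightarrow> lin (\<lambda>x. - f x)"
  by (rule linI) (simp_all add: module_hom.add module_hom.scale)

lemma lin_mult_left [lin_intros]: "lin f \<Longrightarrow> lin (\<lambda>x. a * f x)"
  by (rule linI) (simp_all add: module_hom.add module_hom.scale distrib_left fscale_mult_right)

lemma lin_mult_right [lin_intros]: "lin f \<Longrightarrow> lin (\<lambda>x. f x * a)"
  by (rule linI) (simp_all add: module_hom.add module_hom.scale distrib_right fscale_mult_left)

lemma lin_fscale [lin_intros]: "lin f \<Longrightarrow> lin (\<lambda>x. fscale c (f x))"
  by (rule linI)
    (simp_all add: module_hom.add module_hom.scale free.scale_right_distrib mult.commute)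

lemma lin_sum [lin_intros]: "(\<And>i. i \<in> S \<Longrightarrow> lin (f i)) \<Longrightarrow> lin (\<lambda>x. \<Sum>i\<in>S. f i x)"
  by (induction S rule: infinite_finite_induct) (auto intro: lin_intros)

lemma lin_compose: "lin f \<Longrightarrow> lin g \<Longrightarrow> lin (\<lambda>x. f (g x))"
  by (rule linI) (simp_all add: module_hom.add module_hom.scale)

lemma lin_funpow [lin_intros]:
  fixes f :: "('g, 'k::comm_ring_1) free_alg \<Rightarrow> ('g, 'k) free_alg"
  shows "lin f \<Longrightarrow> lin (f ^^ n)"
proof (induction n)
  case 0
  show ?case by (rule linI) simp_all
next
  case (Suc n)
  then show ?case using lin_compose[of f "f ^^ n"] by (simp add: comp_def)
qed

text \<open>Composition is added only for the fixed operators, since the general rule would make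
  the search for a linearity proof loop.\<close>

lemmas lin_compose_lin_ext [lin_intros] = lin_compose[OF lin_lin_ext]

text \<open>With this operator the sign rule for superderivations becomes an identity in all
  factors, homogeneous or not.\<close>

definition par :: "('g \<Rightarrow> nat) \<Rightarrow> ('g, 'k::comm_ring_1) free_alg \<Rightarrow> ('g, 'k) free_alg" where
  "par deg = lin_ext (\<lambda>w. (-1) ^ word_deg deg w * monomial w)"

lemma lin_par [lin_intros]: "lin (par deg)"
  unfolding par_def by (rule lin_intros)

lemma lin_superder [lin_intros]: "lin (superder deg \<delta>)"
  unfolding superder_def by (rule lin_intros)

lemmas lin_compose_par [lin_intros] = lin_compose[OF lin_par]
lemmas lin_compose_superder [lin_intros] = lin_compose[OF lin_superder]

lemma word_deg_simps [simp]:
  "word_deg deg [] = 0" "word_deg deg (x # w) = deg x + word_deg deg w"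
  "word_deg deg (u @ w) = word_deg deg u + word_deg deg w"
  by (simp_all add: word_deg_def)

lemma neg_one_power_commute: "(f::'a::ring_1) * (-1) ^ n = (-1) ^ n * f"
  by (cases "even n") auto

lemma monomial_neg_one_power: "monomial w * ((-1) ^ n * g) = (-1) ^ n * (monomial w * g)"
  by (cases "even n") auto

lemma par_monomial [simp]: "par deg (monomial w) = (-1) ^ word_deg deg w * monomial w"
  by (simp add: par_def)

lemma par_mult: "par deg (f * g) = par deg f * par deg g"
proof (rule lin_eqI[where f = "\<lambda>f. par deg (f * g)" and g = "\<lambda>f. par deg f * par deg g"])
  fix u
  show "par deg (monomial u * g) = par deg (monomial u) * par deg g"
    by (rule lin_eqI[where f = "\<lambda>g. par deg (monomial u * g)"])
      (auto intro!: lin_intros simp: power_add mult.assoc monomial_neg_one_power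
        simp flip: monomial_append)
qed (auto intro!: lin_intros)

lemma par_one [simp]: "par deg 1 = 1"
  using par_monomial[of deg "[]"] by simp

lemma par_par [simp]: "par deg (par deg f) = f"
proof (rule lin_eqI[where f = "\<lambda>f. par deg (par deg f)" and g = "\<lambda>f. f"])
  show "par deg (par deg (monomial w)) = monomial w" for w
    by (cases "even (word_deg deg w)") 
     (auto simp: module_hom.neg[OF lin_par])
qed (auto intro!: lin_intros)

lemma superder_step:
  "superder deg \<delta> (monomial [x] * f) = \<delta> x * f + (-1) ^ deg x * (monomial [x] * superder deg \<delta> f)"
  by (rule lin_eqI[where f = "\<lambda>f. superder deg \<delta> (monomial [x] * f)"])
    (auto intro!: lin_intros simp: superder_def simp flip: monomial_Cons)

lemma superder_one [simp]: "superder deg \<delta> 1 = 0"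
  using lin_ext_monomial[of "superder_word deg \<delta>" "[]"] by (simp add: superder_def)

lemma superder_mult: "superder deg \<delta> (f * g) = superder deg \<delta> f * g + par deg f * superder deg \<delta> g"
proof (rule lin_eqI[where f = "\<lambda>f. superder deg \<delta> (f * g)" 
      and g = "\<lambda>f. superder deg \<delta> f * g + par deg f * superder deg \<delta> g"])
  fix u
  show "superder deg \<delta> (monomial u * g) = 
    superder deg \<delta> (monomial u) * g + par deg (monomial u) * superder deg \<delta> g"
  proof (induction u)
    case (Cons x u)
    show ?case
      unfolding monomial_Cons[of x u] mult.assoc superder_step Cons par_mult
      by (cases "even (deg x)"; cases "even (word_deg deg u)") (simp_all add: algebra_simps)
  qed simp
qed (auto intro!: lin_intros)

section \<open>Homogeneous components\<close>

definition hpart :: "('g \<Rightarrow> nat) \<Rightarrow> nat \<Rightarrow> ('g, 'k::comm_ring_1) free_alg \<Rightarrow> ('g, 'k) free_alg" where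
  "hpart deg n = lin_ext (\<lambda>w. if word_deg deg w = n then monomial w else 0)"

lemma lin_hpart [lin_intros]: "lin (hpart deg n)"
  unfolding hpart_def by (rule lin_intros)

lemmas lin_compose_hpart [lin_intros] = lin_compose[OF lin_hpart]

lemma hpart_monomial: "hpart deg n (monomial w) = (if word_deg deg w = n then monomial w else 0)"
  by (simp add: hpart_def)

lemma subspace_homog:
  "free.subspace (homog deg n :: ('g, 'k::comm_ring_1) free_alg set)"
proof (rule free.subspaceI)
  show "0 \<in> homog deg n" by (simp add: homog_def)
next
  fix x y :: "('g, 'k) free_alg"
  assume "x \<in> homog deg n" "y \<in> homog deg n"
  then show "x + y \<in> homog deg n" using keys_add[of x y] by (auto simp: homog_def)
next
  fix c and x :: "('g, 'k) free_alg" assume "x \<in> homog deg n"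
  moreover have "Poly_Mapping.keys (fscale c x) \<subseteq> Poly_Mapping.keys x"
    using keys_mult[of "Poly_Mapping.single 0 c" x] by (auto simp: fscale_def split: if_splits)
  ultimately show "fscale c x \<in> homog deg n" by (auto simp: homog_def)
qed

lemma monomial_in_homog: "word_deg deg w = n \<Longrightarrow> monomial w \<in> homog deg n"
  by (simp add: homog_def monomial_def)

lemma hpart_in_homog: "hpart deg n f \<in> homog deg n"
  by (rule lin_memI[OF lin_hpart subspace_homog])
    (auto simp: hpart_monomial monomial_in_homog free.subspace_0[OF subspace_homog])

lemma hpart_homog: assumes "f \<in> homog deg n" shows "hpart deg n f = f"
proof -
  have "hpart deg n f = (\<Sum>w\<in>Poly_Mapping.keys f. fscale (Poly_Mapping.lookup f w) (monomial (letters w)))"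
    unfolding hpart_def lin_ext_def using assms
    by (intro sum.cong) (auto simp: homog_def)
  then show ?thesis using free_alg_eq_sum[of f] by simp
qed

lemma homog_iff: "f \<in> homog deg n \<longleftrightarrow> hpart deg n f = f"
  using hpart_homog hpart_in_homog by metis

lemma homog_induct [consumes 1, case_names add scale monomial]:
  assumes f: "f \<in> homog deg n"
    and "\<And>x y. P x \<Longrightarrow> P y \<Longrightarrow> P (x + y)" "\<And>c x. P x \<Longrightarrow> P (fscale c x)"
    and "\<And>w. word_deg deg w = n \<Longrightarrow> P (monomial w)" "P 0"
  shows "P f"
proof -
  have "P (hpart deg n f)"
    by (induction f rule: free_alg_induct)
      (auto simp: module_hom.add[OF lin_hpart] module_hom.scale[OF lin_hpart] hpart_monomial
        intro: assms)
  then show ?thesis using f by (simp add: hpart_homog)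
qed

lemma homog_lin_memI:
  assumes "f \<in> homog deg n" "lin \<phi>" "free.subspace N"
    "\<And>w. word_deg deg w = n \<Longrightarrow> \<phi> (monomial w) \<in> N"
  shows "\<phi> f \<in> N"
  using assms(1)
  by (induction rule: homog_induct)
    (auto simp: module_hom.add[OF assms(2)] module_hom.scale[OF assms(2)] module_hom.zero[OF assms(2)]
      intro: free.subspace_add[OF assms(3)] free.subspace_scale[OF assms(3)] assms(4)
       free.subspace_0[OF assms(3)])

lemma homog_lin_eqI:
  assumes "f \<in> homog deg n" "lin \<phi>" "lin \<psi>"
    "\<And>w. word_deg deg w = n \<Longrightarrow> \<phi> (monomial w) = \<psi> (monomial w)"
  shows "\<phi> f = \<psi> f"
  using homog_lin_memI[OF assms(1) lin_minus[OF assms(2,3)] free.subspace_single_0] assms(4) by simp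

lemma homog_mult:
  assumes "f \<in> homog deg m" "g \<in> homog deg n" shows "f * g \<in> homog deg (m + n)"
proof (rule homog_lin_memI[OF assms(1) _ subspace_homog, where \<phi> = "\<lambda>f. f * g"])
  fix u assume u: "word_deg deg u = m"
  show "monomial u * g \<in> homog deg (m + n)"
    by (rule homog_lin_memI[OF assms(2) _ subspace_homog, where \<phi> = "\<lambda>g. monomial u * g"])
      (auto intro!: lin_intros monomial_in_homog simp: u simp flip: monomial_append)
qed (auto intro!: lin_intros)

lemma one_in_homog: "1 \<in> homog deg 0"
  using monomial_in_homog[of deg "[]" 0] by simp

lemma par_homog: "f \<in> homog deg n \<Longrightarrow> par deg f = (-1) ^ n * f"
  by (rule homog_lin_eqI) (auto intro!: lin_intros)

lemma lin_span_memI: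
  assumes "x \<in> free.span S" "lin f" "free.subspace M" "\<And>s. s \<in> S \<Longrightarrow> f s \<in> M"
  shows "f x \<in> M"
  using assms(1)
proof (induction rule: free.span_induct_alt)
  case (step c x y)
  then show ?case 
    by (auto simp: module_hom.add[OF assms(2)] module_hom.scale[OF assms(2)] assms(4)
        intro!: free.subspace_add[OF assms(3)] free.subspace_scale[OF assms(3)])
qed (auto simp: module_hom.zero[OF assms(2)] free.subspace_0[OF assms(3)])

section \<open>The contraction of the two-term resolution\<close>

lemma subspace_ideal: "free.subspace (two_sided_ideal R)"
  by (simp add: two_sided_ideal_def)

lemma ideal_base: "r \<in> R \<Longrightarrow> u * r * v \<in> two_sided_ideal R"
  by (auto simp: two_sided_ideal_def intro!: free.span_base)

lemma ideal_mult_left: "f \<in> two_sided_ideal R \<Longrightarrow> g * f \<in> two_sided_ideal R"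
  unfolding two_sided_ideal_def
  by (erule lin_span_memI[where f = "\<lambda>f. g * f"])
    (auto intro!: lin_intros free.span_base, metis mult.assoc)

lemma ideal_mult_right: "f \<in> two_sided_ideal R \<Longrightarrow> f * g \<in> two_sided_ideal R"
  unfolding two_sided_ideal_def
  by (erule lin_span_memI[where f = "\<lambda>f. f * g"])
    (auto intro!: lin_intros free.span_base, metis mult.assoc)

lemma ideal_gen: "r \<in> R \<Longrightarrow> r \<in> two_sided_ideal R"
  using ideal_base[of r R 1 1] by simp

text \<open>Suited to maps that consume a word from the left. The index \<open>i\<close> is the
  parameter that such a recursion changes, for instance the prefix read so far; this is why the
  induction step may assume all parameters at once.\<close>

lemma ideal_left_recI:
  assumes "f \<in> two_sided_ideal R" "\<And>i. lin (\<phi> i)" "free.subspace N"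
    and base: "\<And>i r v. r \<in> R \<Longrightarrow> \<phi> i (r * v) \<in> N"
    and step: "\<And>i x g. g \<in> two_sided_ideal R \<Longrightarrow> (\<And>j. \<phi> j g \<in> N) \<Longrightarrow> \<phi> i (monomial [x] * g) \<in> N"
  shows "\<phi> i f \<in> N"
proof (rule lin_span_memI[OF assms(1)[unfolded two_sided_ideal_def] assms(2,3)], safe)
  fix u v r assume r: "r \<in> R"
  have *: "\<phi> i (monomial u * r * v) \<in> N" for u i
  proof (induction u arbitrary: i)
    case Nil
    then show ?case using base[OF r, of i v] by simp
  next
    case (Cons x u)
    show ?case using step[OF ideal_base[OF r, of "monomial u" v] Cons]
      by (simp add: monomial_Cons[of x u] mult.assoc)
  qed
  show "\<phi> i (u * r * v) \<in> N"
    by (rule lin_memI[where f = "\<lambda>u. \<phi> i (u * r * v)", OF _ assms(3) *])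
      (auto intro!: lin_intros lin_compose[OF assms(2)])
qed

text \<open>The mirror image, for maps such as \<open>lam\<close> that consume a word from the
  right.\<close>

lemma ideal_right_recI:
  assumes "f \<in> two_sided_ideal R" "\<And>i. lin (\<phi> i)" "free.subspace N"
    and base: "\<And>i r v. r \<in> R \<Longrightarrow> \<phi> i (v * r) \<in> N"
    and step: "\<And>i x g. g \<in> two_sided_ideal R \<Longrightarrow> (\<And>j. \<phi> j g \<in> N) \<Longrightarrow> \<phi> i (g * monomial [x]) \<in> N"
  shows "\<phi> i f \<in> N"
proof (rule lin_span_memI[OF assms(1)[unfolded two_sided_ideal_def] assms(2,3)], safe)
  fix u v r assume r: "r \<in> R"
  have *: "\<phi> i (u * r * monomial v) \<in> N" for v i
  proof (induction v arbitrary: i rule: rev_induct)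
    case Nil
    then show ?case using base[OF r, of i u] by simp
  next
    case (snoc x v)
    show ?case using step[OF ideal_base[OF r, of u "monomial v"] snoc]
      by (simp add: monomial_append mult.assoc)
  qed
  show "\<phi> i (u * r * v) \<in> N"
    by (rule lin_memI[where f = "\<lambda>v. \<phi> i (u * r * v)", OF _ assms(3) *])
      (auto intro!: lin_intros lin_compose[OF assms(2)])
qed

lemma form_rels_cases:
  assumes "r \<in> form_rels scale e \<delta>"
    and "P (e 1 - 1)" "\<And>a b. P (e (a * b) - e a * e b)" "\<And>a b. P (e (a + b) - (e a + e b))"
      "\<And>c a. P (e (scale c a) - fscale c (e a))" "\<And>a b. P (\<delta> (a + b) - (\<delta> a + \<delta> b))"
      "\<And>c a. P (\<delta> (scale c a) - fscale c (\<delta> a))" "\<And>c. P (\<delta> (scale c 1))"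
      "\<And>a b. P (\<delta> (a * b) - (\<delta> a * e b + e a * \<delta> b))"
  shows "P r"
  using assms unfolding form_rels_def by blast

lemma form_rels_in_ideal:
  fixes scale :: "'k::comm_ring_1 \<Rightarrow> 'a::ring_1 \<Rightarrow> 'a"
  defines "I \<equiv> \<lambda>e \<delta>. two_sided_ideal (form_rels scale e \<delta>)"
  shows "e 1 - 1 \<in> I e \<delta>" "e (a * b) - e a * e b \<in> I e \<delta>" "e (a + b) - (e a + e b) \<in> I e \<delta>"
    "e (scale c a) - fscale c (e a) \<in> I e \<delta>" "\<delta> (a + b) - (\<delta> a + \<delta> b) \<in> I e \<delta>"
    "\<delta> (scale c a) - fscale c (\<delta> a) \<in> I e \<delta>" "\<delta> (scale c 1) \<in> I e \<delta>"
    "\<delta> (a * b) - (\<delta> a * e b + e a * \<delta> b) \<in> I e \<delta>"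
  unfolding I_def by (rule ideal_gen; unfold form_rels_def; blast)+

section \<open>Extended forms and their differentials\<close>

abbreviation sg :: "('a, 'k::comm_ring_1) ext_free \<Rightarrow> ('a, 'k) ext_free" where
  "sg \<equiv> par ext_form_deg"

lemma ext_gen_monomial:
  "monomial [Form (Elt a)] = ext_elt a" "monomial [Form (Dif a)] = ext_dif a" "monomial [T] = ext_t"
  by (simp_all add: ext_elt_def ext_dif_def ext_t_def)

lemma ext_monomial_Cons:
  "monomial (Form (Elt a) # w) = ext_elt a * monomial w"
  "monomial (Form (Dif a) # w) = ext_dif a * monomial w"
  "monomial (T # w) = ext_t * monomial w"
  by (simp_all add: ext_elt_def ext_dif_def ext_t_def flip: monomial_Cons)

lemma ext_word_induct [case_names one elt dif t]:
  assumes "P 1" "\<And>a w. P (monomial w) \<Longrightarrow> P (ext_elt a * monomial w)"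
    "\<And>a w. P (monomial w) \<Longrightarrow> P (ext_dif a * monomial w)" "\<And>w. P (monomial w) \<Longrightarrow> P (ext_t * monomial w)"
  shows "P (monomial w)"
proof (induction w)
  case (Cons x w)
  then show ?case using assms
    by (cases x rule: ext_gen.exhaust; cases "case x of Form y \<Rightarrow> y | T \<Rightarrow> undefined")
      (auto simp: ext_monomial_Cons)
qed (simp add: assms)

lemma ext_gen_cases [case_names elt dif t]:
  assumes "\<And>a. x = Form (Elt a) \<Longrightarrow> P" "\<And>a. x = Form (Dif a) \<Longrightarrow> P" "x = T \<Longrightarrow> P"
  shows P
  using assms by (metis ext_gen.exhaust form_gen.exhaust)

lemma ext_eqI [consumes 2, case_names one elt dif t]:
  assumes "lin f" "lin g" "f 1 = g 1"
    "\<And>a w. f (monomial w) = g (monomial w) \<Longrightarrow> f (ext_elt a * monomial w) = g (ext_elt a * monomial w)"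
    "\<And>a w. f (monomial w) = g (monomial w) \<Longrightarrow> f (ext_dif a * monomial w) = g (ext_dif a * monomial w)"
    "\<And>w. f (monomial w) = g (monomial w) \<Longrightarrow> f (ext_t * monomial w) = g (ext_t * monomial w)"
  shows "f x = g x"
proof (rule lin_eqI[OF assms(1,2)])
  show "f (monomial w) = g (monomial w)" for w
    by (rule ext_word_induct) (use assms in auto)
qed

lemma ext_left_recI:
  assumes "f \<in> ext_ideal scale" "\<And>i. lin (\<phi> i)" "free.subspace N"
    and "\<And>i v. \<phi> i ((ext_elt 1 - 1) * v) \<in> N"
    "\<And>i a b v. \<phi> i ((ext_elt (a * b) - ext_elt a * ext_elt b) * v) \<in> N"
    "\<And>i a b v. \<phi> i ((ext_elt (a + b) - (ext_elt a + ext_elt b)) * v) \<in> N"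
    "\<And>i c a v. \<phi> i ((ext_elt (scale c a) - fscale c (ext_elt a)) * v) \<in> N"
    "\<And>i a b v. \<phi> i ((ext_dif (a + b) - (ext_dif a + ext_dif b)) * v) \<in> N"
    "\<And>i c a v. \<phi> i ((ext_dif (scale c a) - fscale c (ext_dif a)) * v) \<in> N"
    "\<And>i c v. \<phi> i (ext_dif (scale c 1) * v) \<in> N"
    "\<And>i a b v. \<phi> i ((ext_dif (a * b) - (ext_dif a * ext_elt b + ext_elt a * ext_dif b)) * v) \<in> N"
    and "\<And>i a g. g \<in> ext_ideal scale \<Longrightarrow> (\<And>j. \<phi> j g \<in> N) \<Longrightarrow> \<phi> i (ext_elt a * g) \<in> N"
    "\<And>i a g. g \<in> ext_ideal scale \<Longrightarrow> (\<And>j. \<phi> j g \<in> N) \<Longrightarrow> \<phi> i (ext_dif a * g) \<in> N"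
    "\<And>i g. g \<in> ext_ideal scale \<Longrightarrow> (\<And>j. \<phi> j g \<in> N) \<Longrightarrow> \<phi> i (ext_t * g) \<in> N"
  shows "\<phi> i f \<in> N"
proof (rule ideal_left_recI[OF assms(1)[unfolded ext_ideal_def] assms(2,3)])
  fix i r v assume "r \<in> form_rels scale ext_elt ext_dif"
  then show "\<phi> i (r * v) \<in> N"
    by (rule form_rels_cases) (use assms(4-11) in auto)
next
  fix i x g assume "g \<in> two_sided_ideal (form_rels scale ext_elt ext_dif)" "\<And>j. \<phi> j g \<in> N"
  then show "\<phi> i (monomial [x] * g) \<in> N"
    using assms(12-14) by (cases x rule: ext_gen_cases) (auto simp: ext_gen_monomial ext_ideal_def)
qed

lemma par_gen [simp]:
  "sg (ext_elt a) = ext_elt a" "sg (ext_dif a) = - ext_dif a" "sg ext_t = ext_t"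
  using par_monomial[of ext_form_deg "[Form (Elt a)]"] par_monomial[of ext_form_deg "[Form (Dif a)]"]
    par_monomial[of ext_form_deg "[T]"] by (simp_all add: ext_gen_monomial)

lemma lin_ext_i [lin_intros]: "lin ext_i" and lin_ext_d [lin_intros]: "lin ext_d"
  unfolding ext_i_def ext_d_def by (rule lin_intros)+

lemmas lin_compose_ext_i [lin_intros] = lin_compose[OF lin_ext_i]
lemmas lin_compose_ext_d [lin_intros] = lin_compose[OF lin_ext_d]

lemma ext_i_one [simp]: "ext_i 1 = 0" and ext_d_one [simp]: "ext_d 1 = 0"
  by (simp_all add: ext_i_def ext_d_def)

lemma ext_i_step [simp]:
  "ext_i (ext_elt a * f) = ext_elt a * ext_i f"
  "ext_i (ext_dif a * f) = ext_elt a * (ext_t * f) - ext_t * (ext_elt a * f) - ext_dif a * ext_i f"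
  "ext_i (ext_t * f) = ext_t * ext_i f"
  using superder_step[of ext_form_deg ext_i_gen "Form (Elt a)" f]
    superder_step[of ext_form_deg ext_i_gen "Form (Dif a)" f]
    superder_step[of ext_form_deg ext_i_gen "T" f]
  by (simp_all add: ext_gen_monomial ext_i_def left_diff_distrib mult.assoc)

lemma ext_d_step [simp]:
  "ext_d (ext_elt a * f) = ext_dif a * f + ext_elt a * ext_d f"
  "ext_d (ext_dif a * f) = - (ext_dif a * ext_d f)"
  "ext_d (ext_t * f) = ext_t * ext_d f"
  using superder_step[of ext_form_deg ext_d_gen "Form (Elt a)" f]
    superder_step[of ext_form_deg ext_d_gen "Form (Dif a)" f]
    superder_step[of ext_form_deg ext_d_gen "T" f]
  by (simp_all add: ext_gen_monomial ext_d_def)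

lemma ext_gen_images [simp]:
  "ext_i (ext_elt a) = 0" "ext_i (ext_dif a) = ext_elt a * ext_t - ext_t * ext_elt a" "ext_i ext_t = 0"
  "ext_d (ext_elt a) = ext_dif a" "ext_d (ext_dif a) = 0" "ext_d ext_t = 0"
  using ext_i_step[where f = 1] ext_d_step[where f = 1] by simp_all

lemma ext_i_mult: "ext_i (f * g) = ext_i f * g + sg f * ext_i g"
  and ext_d_mult: "ext_d (f * g) = ext_d f * g + sg f * ext_d g"
  by (simp_all add: ext_i_def ext_d_def superder_mult)

fun d0_word :: "'a ext_gen list \<Rightarrow> ('a, 'k::comm_ring_1) ext_free" where
  "d0_word [] = 0"
| "d0_word (Form (Elt a) # v) = ext_dif a * monomial v + ext_elt a * d0_word v"
| "d0_word (Form (Dif a) # v) = - (ext_dif a * d0_word v)"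
| "d0_word (T # v) = 0"

text \<open>\<open>d\<close> acting on the part of a form in front of the first \<open>t\<close> only.\<close>

definition d0 :: "('a, 'k::comm_ring_1) ext_free \<Rightarrow> ('a, 'k) ext_free" where
  "d0 = lin_ext d0_word"

fun eps_word :: "'a ext_gen list \<Rightarrow> ('a, 'k::comm_ring_1) ext_free" where
  "eps_word [] = 0"
| "eps_word (Form (Elt a) # v) = ext_elt a * eps_word v"
| "eps_word (Form (Dif a) # v) = 0"
| "eps_word (T # v) = monomial v"

text \<open>The augmentation \<open>A t A \<rightarrow> A\<close>,
  \<open>a t b \<mapsto> ab\<close>, of the two-term resolution, applied at the start of a word;
  words in which some \<open>db\<close> comes before the first \<open>t\<close> are killed.\<close>

definition eps :: "('a, 'k::comm_ring_1) ext_free \<Rightarrow> ('a, 'k) ext_free" where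
  "eps = lin_ext eps_word"

fun hty_word :: "'a ext_gen list \<Rightarrow> ('a, 'k::comm_ring_1) ext_free" where
  "hty_word [] = 0"
| "hty_word (Form (Elt a) # v) = ext_dif a * eps_word v + ext_elt a * hty_word v"
| "hty_word (Form (Dif a) # v) = 0"
| "hty_word (T # v) = 0"

text \<open>The splitting \<open>a t v \<mapsto> da v\<close>. Applying \<open>ext_i\<close> to
  \<open>da v\<close> returns \<open>a t v\<close> up to \<open>t a v\<close>, the part that
  \<open>eps\<close> remembers, and a term with \<open>ext_i v\<close>.\<close>

definition hty :: "('a, 'k::comm_ring_1) ext_free \<Rightarrow> ('a, 'k) ext_free" where
  "hty = lin_ext hty_word"

lemma lin_ops [lin_intros]: "lin d0" "lin eps" "lin hty"
  unfolding d0_def eps_def hty_def by (rule lin_intros)+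

lemmas lin_compose_ops [lin_intros] = lin_ops[THEN lin_compose]

lemma d0_monomial: "d0 (monomial w) = d0_word w"
  and eps_monomial: "eps (monomial w) = eps_word w"
  and hty_monomial: "hty (monomial w) = hty_word w"
  by (simp_all add: d0_def eps_def hty_def)

lemma lin_ext_Cons:
  assumes "lin g" "\<And>w. \<phi> (x # w) = g (monomial w)"
  shows "lin_ext \<phi> (monomial [x] * f) = g f"
proof (rule lin_eqI[where f = "\<lambda>f. lin_ext \<phi> (monomial [x] * f)" and g = g])
  show "lin_ext \<phi> (monomial [x] * monomial w) = g (monomial w)" for w
    by (simp add: assms(2) flip: monomial_Cons)
qed (auto intro!: lin_intros assms)

lemma lin_ext_one: "lin_ext \<phi> 1 = \<phi> []"
  using lin_ext_monomial[of \<phi> "[]"] by simp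

lemma d0_step [simp]:
  "d0 (ext_elt a * f) = ext_dif a * f + ext_elt a * d0 f"
  "d0 (ext_dif a * f) = - (ext_dif a * d0 f)" "d0 (ext_t * f) = 0" "d0 1 = 0"
  using lin_ext_Cons[of "\<lambda>f. ext_dif a * f + ext_elt a * d0 f" d0_word "Form (Elt a)" f]
    lin_ext_Cons[of "\<lambda>f. - (ext_dif a * d0 f)" d0_word "Form (Dif a)" f]
    lin_ext_Cons[of "\<lambda>f. 0" d0_word T f] lin_ext_one[of d0_word]
  by (simp_all add: lin_intros d0_monomial ext_gen_monomial flip: d0_def)

lemma eps_step [simp]:
  "eps (ext_elt a * f) = ext_elt a * eps f" "eps (ext_dif a * f) = 0" "eps (ext_t * f) = f" "eps 1 = 0"
  using lin_ext_Cons[of "\<lambda>f. ext_elt a * eps f" eps_word "Form (Elt a)" f]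
    lin_ext_Cons[of "\<lambda>f. 0" eps_word "Form (Dif a)" f]
    lin_ext_Cons[of "\<lambda>f. f" eps_word T f] lin_ext_one[of eps_word]
  by (simp_all add: lin_intros eps_monomial ext_gen_monomial flip: eps_def)

lemma hty_step [simp]:
  "hty (ext_elt a * f) = ext_dif a * eps f + ext_elt a * hty f"
  "hty (ext_dif a * f) = 0" "hty (ext_t * f) = 0" "hty 1 = 0"
  using lin_ext_Cons[of "\<lambda>f. ext_dif a * eps f + ext_elt a * hty f" hty_word "Form (Elt a)" f]
    lin_ext_Cons[of "\<lambda>f. 0" hty_word "Form (Dif a)" f]
    lin_ext_Cons[of "\<lambda>f. 0" hty_word T f] lin_ext_one[of hty_word]
  by (simp_all add: lin_intros hty_monomial eps_monomial ext_gen_monomial flip: hty_def)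

lemma ops_gen [simp]:
  "d0 (ext_elt a) = ext_dif a" "d0 (ext_dif a) = 0" "d0 ext_t = 0"
  "eps (ext_elt a) = 0" "eps (ext_dif a) = 0" "eps ext_t = 1"
  "hty (ext_elt a) = 0" "hty (ext_dif a) = 0" "hty ext_t = 0"
  using d0_step(1-3)[where f = 1] eps_step(1-3)[where f = 1] hty_step(1-3)[where f = 1] by simp_all

lemmas lin_simps = module_hom.add[OF lin_ops(1)] module_hom.add[OF lin_ops(2)]
  module_hom.add[OF lin_ops(3)] module_hom.add[OF lin_ext_i] module_hom.add[OF lin_ext_d]
  module_hom.add[OF lin_par]
  module_hom.diff[OF lin_ops(1)] module_hom.diff[OF lin_ops(2)]
  module_hom.diff[OF lin_ops(3)] module_hom.diff[OF lin_ext_i] module_hom.diff[OF lin_ext_d]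
  module_hom.diff[OF lin_par]
  module_hom.neg[OF lin_ops(1)] module_hom.neg[OF lin_ops(2)]
  module_hom.neg[OF lin_ops(3)] module_hom.neg[OF lin_ext_i] module_hom.neg[OF lin_ext_d]
  module_hom.neg[OF lin_par]
  module_hom.zero[OF lin_ops(1)] module_hom.zero[OF lin_ops(2)]
  module_hom.zero[OF lin_ops(3)] module_hom.zero[OF lin_ext_i] module_hom.zero[OF lin_ext_d]
  module_hom.zero[OF lin_par]
  module_hom.scale[OF lin_ops(1)] module_hom.scale[OF lin_ops(2)]
  module_hom.scale[OF lin_ops(3)] module_hom.scale[OF lin_ext_i] module_hom.scale[OF lin_ext_d]
  module_hom.scale[OF lin_par]

declare lin_simps [simp]

lemma ext_i_ext_i [simp]: "ext_i (ext_i f) = 0"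
  by (rule ext_eqI[where g = "\<lambda>_. 0"]) (auto intro!: lin_intros simp: algebra_simps)

lemma ext_d_ext_d [simp]: "ext_d (ext_d f) = 0"
  by (rule ext_eqI[where g = "\<lambda>_. 0"]) (auto intro!: lin_intros simp: algebra_simps)

lemma ext_i_d: "ext_i (ext_d f) = f * ext_t - ext_t * f - ext_d (ext_i f)"
  by (rule ext_eqI[where f = "\<lambda>f. ext_i (ext_d f)" and x = f])
    (auto intro!: lin_intros simp: ring_distribs mult.assoc)

lemma d0_d0 [simp]: "d0 (d0 f) = 0"
  by (rule ext_eqI[where g = "\<lambda>_. 0"]) (auto intro!: lin_intros simp: algebra_simps)

lemma ext_d_d0: "ext_d (d0 f) = - d0 (ext_d f)"
  by (rule ext_eqI) (auto intro!: lin_intros simp: algebra_simps)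

lemma sg_ext_i: "sg (ext_i f) = - ext_i (sg f)"
  by (rule ext_eqI) (auto intro!: lin_intros simp: algebra_simps par_mult)

lemma sg_ext_d: "sg (ext_d f) = - ext_d (sg f)"
  by (rule ext_eqI) (auto intro!: lin_intros simp: algebra_simps par_mult)

lemma eps_ext_i: "eps (ext_i f) = ext_i (eps f)"
  by (rule ext_eqI) (auto intro!: lin_intros simp: algebra_simps)

lemma eps_mult_elt: "eps (f * ext_elt a) = eps f * ext_elt a"
  by (rule ext_eqI) (auto intro!: lin_intros simp: algebra_simps)

lemma hty_mult_elt: "hty (f * ext_elt a) = hty f * ext_elt a"
  by (rule ext_eqI) (auto intro!: lin_intros simp: algebra_simps eps_mult_elt)

lemma ext_i_mult_elt: "ext_i (f * ext_elt a) = ext_i f * ext_elt a"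
  by (simp add: ext_i_mult)

text \<open>Every word of \<open>ext_i f\<close> contains a \<open>t\<close>, and \<open>d0\<close>
  stops there before it reaches the last factor.\<close>

lemma d0_ext_i_mult_elt: "d0 (ext_i f * ext_elt a) = d0 (ext_i f) * ext_elt a"
  by (rule ext_eqI) (auto intro!: lin_intros simp: algebra_simps)

lemma d0_mult_T:
  assumes "f \<in> homog ext_t_deg (Suc n)" shows "d0 (f * g) = d0 f * g"
proof (rule homog_lin_eqI[OF assms, where \<phi> = "\<lambda>f. d0 (f * g)"])
  show "d0 (monomial w * g) = d0 (monomial w) * g" if "word_deg ext_t_deg w = Suc n" for w
    using that
  proof (induction w)
    case (Cons x w)
    then show ?case by (cases x rule: ext_gen_cases) (auto simp: ext_monomial_Cons algebra_simps)
  qed simp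
qed (auto intro!: lin_intros)

text \<open>\<open>hty\<close> contracts the resolution of \<open>A\<close> by the bimodules generated by the forms \<open>da\<close> and by \<open>t\<close>.\<close>

lemma hty_homotopy:
  assumes "f \<in> homog ext_t_deg (Suc n)"
  shows "f = ext_t * eps f + ext_i (hty f) + hty (ext_i f)"
proof (rule homog_lin_eqI[OF assms, where \<psi> = "\<lambda>f. ext_t * eps f + ext_i (hty f) + hty (ext_i f)"])
  show "monomial w = ext_t * eps (monomial w) + ext_i (hty (monomial w)) + hty (ext_i (monomial w))" 
    if "word_deg ext_t_deg w = Suc n" for w
    using that
  proof (induction w)
    case (Cons x w)
    show ?case
    proof (cases x rule: ext_gen_cases)
      case (elt a)
      with Cons.prems have "word_deg ext_t_deg w = Suc n" by simp
      \<comment> \<open>Besides \<open>a\<close> times the identity for \<open>w\<close>, two terms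
        with \<open>da\<close> appear, which cancel because \<open>eps\<close> commutes with
        \<open>ext_i\<close>, and two terms with \<open>t a\<close>, which cancel as well.\<close>
      from arg_cong[OF Cons.IH[OF this], of "\<lambda>f. ext_elt a * f"]
      show ?thesis unfolding elt ext_monomial_Cons
        by (rule trans) (simp add: algebra_simps eps_ext_i)
    qed (auto simp: ext_monomial_Cons algebra_simps)
  qed simp
qed (auto intro!: lin_intros)

lemma memI: "y \<in> N \<Longrightarrow> x = y \<Longrightarrow> x \<in> N"
  by simp

lemma hpart_ideal:
  assumes "f \<in> two_sided_ideal R" "\<And>r. r \<in> R \<Longrightarrow> \<exists>m. r \<in> homog deg m"
  shows "hpart deg n f \<in> two_sided_ideal R"
proof (rule lin_span_memI[OF assms(1)[unfolded two_sided_ideal_def] lin_hpart subspace_ideal], safe)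
  fix u v r assume r: "r \<in> R"
  then obtain m where m: "r \<in> homog deg m" using assms(2) by blast
  have *: "hpart deg n (monomial u * r * monomial v) \<in> two_sided_ideal R" for u v
  proof -
    have h: "monomial u * r * monomial v \<in> homog deg (word_deg deg u + m + word_deg deg v)"
      by (intro homog_mult m monomial_in_homog refl)
    show ?thesis
    proof (cases "word_deg deg u + m + word_deg deg v = n")
      case True
      then show ?thesis using hpart_homog h ideal_base[OF r] by metis
    next
      case False
      have "hpart deg n (monomial u * r * monomial v) = 0"
        by (rule homog_lin_eqI[OF h lin_hpart lin_zero]) (use False in \<open>simp add: hpart_monomial\<close>)
      then show ?thesis by (simp add: free.subspace_0 subspace_ideal)
    qed
  qed
  have "hpart deg n (monomial u * r * v) \<in> two_sided_ideal R" for u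
    by (rule lin_memI[where f = "\<lambda>v. hpart deg n (monomial u * r * v)", OF _ subspace_ideal *])
      (auto intro!: lin_intros)
  then show "hpart deg n (u * r * v) \<in> two_sided_ideal R"
    by (rule lin_memI[where f = "\<lambda>u. hpart deg n (u * r * v)", OF _ subspace_ideal, rotated])
      (auto intro!: lin_intros)
qed

section \<open>Commutators with elements of the algebra and rotations of words\<close>

text \<open>Counts the letters \<open>da\<close> and \<open>t\<close>, the ones that
  \<open>rot\<close> looks for. As \<open>ext_i\<close> trades a \<open>da\<close> for a
  \<open>t\<close>, it preserves this weight.\<close>

abbreviation ext_wt :: "'a ext_gen \<Rightarrow> nat" where
  "ext_wt x \<equiv> ext_form_deg x + ext_t_deg x"

text \<open>Only elements of \<open>A\<close> may pass from one end of a word to the other, so the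
  letters \<open>da\<close> and \<open>t\<close> keep a first one among them. The powers of
  \<open>t\<close> are the images of the constants of \<open>\<Omega>\<close> under the Tsygan
  map.\<close>

definition comm_sub :: "('k::comm_ring_1 \<Rightarrow> 'a::ring_1 \<Rightarrow> 'a) \<Rightarrow> ('a, 'k) ext_free set" where
  "comm_sub scale = free.span (ext_ideal scale \<union>
     {ext_elt a * f - f * ext_elt a | a f. True} \<union> range (\<lambda>n. ext_t ^ n))"

fun rot_word :: "('a, 'k::comm_ring_1) ext_free \<Rightarrow> 'a ext_gen list \<Rightarrow> ('a, 'k) ext_free" where
  "rot_word u [] = 0"
| "rot_word u (Form (Elt a) # v) = rot_word (u * ext_elt a) v"
| "rot_word u (Form (Dif a) # v) = sg (monomial v) * u * ext_dif a"
| "rot_word u (T # v) = monomial v * u * ext_t"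

text \<open>\<open>rot u f\<close> moves the first generator \<open>da\<close> or \<open>t\<close> of \<open>u f\<close>, together with everything in front
  of it, to the end.\<close>

definition rot :: "('a, 'k::comm_ring_1) ext_free \<Rightarrow> ('a, 'k) ext_free \<Rightarrow> ('a, 'k) ext_free" where
  "rot u = lin_ext (rot_word u)"

lemma lin_rot [lin_intros]: "lin (rot u)"
  unfolding rot_def by (rule lin_intros)

lemmas lin_compose_rot [lin_intros] = lin_compose[OF lin_rot]

lemma rot_monomial: "rot u (monomial w) = rot_word u w"
  by (simp add: rot_def)

lemma rot_step [simp]:
  "rot u (ext_elt a * f) = rot (u * ext_elt a) f" "rot u (ext_dif a * f) = sg f * u * ext_dif a"
  "rot u (ext_t * f) = f * u * ext_t" "rot u 1 = 0"
  using lin_ext_Cons[of "rot (u * ext_elt a)" "rot_word u" "Form (Elt a)" f]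
    lin_ext_Cons[of "\<lambda>f. sg f * u * ext_dif a" "rot_word u" "Form (Dif a)" f]
    lin_ext_Cons[of "\<lambda>f. f * u * ext_t" "rot_word u" T f] lin_ext_one[of "rot_word u"]
  by (simp_all add: lin_intros rot_monomial ext_gen_monomial flip: rot_def)

lemmas rot_lin_simps [simp] = module_hom.add[OF lin_rot] module_hom.diff[OF lin_rot]
  module_hom.neg[OF lin_rot] module_hom.zero[OF lin_rot] module_hom.scale[OF lin_rot]

lemma lin_rot_left:
  fixes f :: "('a, 'k::comm_ring_1) ext_free"
  shows "lin (\<lambda>u. rot u f)"
proof (rule linI)
  fix u v :: "('a, 'k) ext_free" and c
  show "rot (u + v) f = rot u f + rot v f"
  proof (rule lin_eqI[of "rot (u + v)"])
    show "rot (u + v) (monomial w) = rot u (monomial w) + rot v (monomial w)" for w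
    proof (induction w arbitrary: u v)
      case (Cons x w)
      then show ?case by (cases x rule: ext_gen_cases) (auto simp: ext_monomial_Cons distrib_left distrib_right)
    qed simp
  qed (auto intro!: lin_intros)
  show "rot (fscale c u) f = fscale c (rot u f)"
  proof (rule lin_eqI[of "rot (fscale c u)"])
    show "rot (fscale c u) (monomial w) = fscale c (rot u (monomial w))" for w
    proof (induction w arbitrary: u)
      case (Cons x w)
      then show ?case
        by (cases x rule: ext_gen_cases) (auto simp: ext_monomial_Cons fscale_mult_left fscale_mult_right)
    qed simp
  qed (auto intro!: lin_intros)
qed

lemmas rot_left_simps = module_hom.add[OF lin_rot_left] module_hom.diff[OF lin_rot_left]
  module_hom.neg[OF lin_rot_left] module_hom.zero[OF lin_rot_left] module_hom.scale[OF lin_rot_left]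

text \<open>Positive weight ensures that \<open>f\<close> contains a letter \<open>da\<close> or
  \<open>t\<close>. What follows this letter, including the final \<open>a\<close>, is moved in
  front of \<open>u\<close>, so that \<open>a\<close> ends up next to \<open>u\<close>.\<close>

lemma rot_mult_elt:
  assumes "f \<in> homog ext_wt (Suc n)" shows "rot u (f * ext_elt a) = rot (ext_elt a * u) f"
proof (rule homog_lin_eqI[OF assms, where \<phi> = "\<lambda>f. rot u (f * ext_elt a)"])
  show "rot u (monomial w * ext_elt a) = rot (ext_elt a * u) (monomial w)"
    if "word_deg ext_wt w = Suc n" for w
    using that
  proof (induction w arbitrary: u)
    case (Cons x w)
    then show ?case
      by (cases x rule: ext_gen_cases) (auto simp: ext_monomial_Cons mult.assoc par_mult)
  qed simp
qed (auto intro!: lin_intros)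

lemma homog_gen:
  assumes "deg (Form (Elt a)) = 0"
  shows "ext_elt a \<in> homog deg 0" "ext_dif a \<in> homog deg (deg (Form (Dif a)))"
    "ext_t \<in> homog deg (deg T)"
  using assms by (auto simp: ext_elt_def ext_dif_def ext_t_def intro!: monomial_in_homog)

lemma word_deg_ext_wt: "word_deg ext_wt w = word_deg ext_form_deg w + word_deg ext_t_deg w"
  by (induction w) auto

lemma sg_in_homog: assumes "f \<in> homog deg n" shows "sg f \<in> homog deg n"
proof (rule homog_lin_memI[OF assms lin_par subspace_homog])
  fix w assume "word_deg deg w = n"
  then show "sg (monomial w) \<in> homog deg n"
    by (cases "even (word_deg ext_form_deg w)")
      (auto intro!: monomial_in_homog free.subspace_neg[OF subspace_homog])
qed

lemma rot_homog:
  assumes "f \<in> homog deg n" "u \<in> homog deg 0" "\<And>a. deg (Form (Elt a)) = 0"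
  shows "rot u f \<in> homog deg n"
proof (rule homog_lin_memI[OF assms(1) lin_rot subspace_homog])
  show "rot u (monomial w) \<in> homog deg n" if "word_deg deg w = n" for w
    using that assms(2)
  proof (induction w arbitrary: u n)
    case Nil
    then show ?case by (simp add: free.subspace_0[OF subspace_homog])
  next
    case (Cons x w)
    have gen: "ext_elt a \<in> homog deg 0" for a by (rule homog_gen) (rule assms)
    have w: "monomial w \<in> homog deg (word_deg deg w)" by (rule monomial_in_homog) simp
    show ?case
    proof (cases x rule: ext_gen_cases)
      case (elt a)
      then show ?thesis using Cons homog_mult[OF Cons.prems(2) gen[of a]] assms(3)
        by (auto simp: ext_monomial_Cons)
    next
      case (dif a)
      have "sg (monomial w) * u * ext_dif a \<in> homog deg (word_deg deg w + 0 + deg (Form (Dif a)))"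
        by (intro homog_mult homog_gen sg_in_homog w assms Cons)
      then show ?thesis using Cons.prems by (simp add: dif ext_monomial_Cons add.commute)
    next
      case t
      have "monomial w * u * ext_t \<in> homog deg (word_deg deg w + 0 + deg T)"
        by (intro homog_mult homog_gen sg_in_homog w assms Cons)
      then show ?thesis using Cons.prems by (simp add: t ext_monomial_Cons add.commute)
    qed
  qed
qed

text \<open>Moving all the letters of \<open>u\<close> past \<open>v\<close> takes as many rotations as \<open>u\<close> has weight; the letters of
  weight \<open>0\<close> at the end of \<open>u\<close> are only moved modulo commutators.\<close>

lemma rot_power_word:
  fixes u v :: "'a ext_gen list"
  assumes "word_deg ext_wt u = Suc j"
  shows "\<exists>u1 u2. u = u1 @ u2 \<and> word_deg ext_wt u2 = 0 \<and>
    (rot 1 ^^ Suc j) (monomial (u @ v) :: ('a, 'k::comm_ring_1) ext_free) =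
      (-1) ^ (word_deg ext_form_deg u * word_deg ext_form_deg v) * monomial (u2 @ v @ u1)"
  using assms
proof (induction "length u" arbitrary: u v j rule: less_induct)
  case less
  then obtain x u' where u: "u = x # u'" by (cases u) auto
  show ?case
  proof (cases x rule: ext_gen_cases)
    case (elt a)
    have wt: "word_deg ext_wt u' = Suc j" using less.prems u elt by simp
    have "length u' < length u" using u by simp
    from less.hyps[OF this wt, of "v @ [Form (Elt a)]"] obtain u1 u2 where *: "u' = u1 @ u2"
      "word_deg ext_wt u2 = 0" "(rot 1 ^^ Suc j) (monomial (u' @ v @ [Form (Elt a)]) :: ('a, 'k) ext_free) =
        (-1) ^ (word_deg ext_form_deg u' * word_deg ext_form_deg (v @ [Form (Elt a)])) *
          monomial (u2 @ (v @ [Form (Elt a)]) @ u1)"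
      by blast
    have "(monomial (u' @ v) :: ('a, 'k) ext_free) \<in> homog ext_wt (Suc (j + word_deg ext_wt v))"
      by (rule monomial_in_homog) (simp add: wt)
    \<comment> \<open>A leading \<open>a\<close> travels along with the next letter
      \<open>da\<close> or \<open>t\<close>; writing it at the end of the word beforehand gives the
      same rotation.\<close>
    from rot_mult_elt[OF this, of 1 a]
    have "rot 1 (monomial (u @ v) :: ('a, 'k) ext_free) = rot 1 (monomial (u' @ v @ [Form (Elt a)]))"
      by (simp add: u elt ext_monomial_Cons monomial_append ext_gen_monomial mult.assoc)
    then have "(rot 1 ^^ Suc j) (monomial (u @ v) :: ('a, 'k) ext_free) = (rot 1 ^^ Suc j) (monomial (u' @ v @ [Form (Elt a)]))"
      by (simp only: funpow_Suc_right o_apply)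
    with * show ?thesis
      by (intro exI[of _ "Form (Elt a) # u1"] exI[of _ u2]) (simp add: u elt)
  next
    case (dif a)
    have wt: "word_deg ext_wt u' = j" using less.prems u dif by simp
    let ?s = "word_deg ext_form_deg u' + word_deg ext_form_deg v"
    have 1: "rot 1 (monomial (u @ v) :: ('a, 'k) ext_free) = (-1) ^ ?s * monomial (u' @ v @ [Form (Dif a)])"
      by (simp add: u dif ext_monomial_Cons monomial_append ext_gen_monomial mult.assoc par_mult
          power_add monomial_neg_one_power)
    have lin: "(rot 1 ^^ j) ((-1) ^ n * f) = (-1) ^ n * (rot 1 ^^ j) f" for n and f :: "('a, 'k) ext_free"
      using module_hom.neg[OF lin_funpow[OF lin_rot], of j 1 f]
      by (cases "even n") auto
    show ?thesis
    proof (cases j)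
      case 0
      \<comment> \<open>No weight is left in \<open>u'\<close>: its letters are elements of
        \<open>A\<close> that have not been moved, and they form \<open>u2\<close>.\<close>
      with wt 1 show ?thesis
        by (intro exI[of _ "[Form (Dif a)]"] exI[of _ u'])
          (auto simp: u dif word_deg_ext_wt)
    next
      case (Suc j')
      have "length u' < length u" "word_deg ext_wt u' = Suc j'" using u wt Suc by simp_all
      from less.hyps[OF this, of "v @ [Form (Dif a)]"] obtain u1 u2 where *: "u' = u1 @ u2"
        "word_deg ext_wt u2 = 0" "(rot 1 ^^ Suc j') (monomial (u' @ v @ [Form (Dif a)]) :: ('a, 'k) ext_free) =
        (-1) ^ (word_deg ext_form_deg u' * word_deg ext_form_deg (v @ [Form (Dif a)])) *
          monomial (u2 @ (v @ [Form (Dif a)]) @ u1)"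
        by blast
      have "(rot 1 ^^ Suc j) (monomial (u @ v) :: ('a, 'k) ext_free) = (-1) ^ ?s * (rot 1 ^^ Suc j') (monomial (u' @ v @ [Form (Dif a)]))"
        unfolding funpow_Suc_right[of j] o_apply 1 lin by (simp only: Suc)
      then show ?thesis using *
        by (intro exI[of _ "Form (Dif a) # u1"] exI[of _ u2])
         (cases "even (word_deg ext_form_deg u')"; cases "even (word_deg ext_form_deg v)"; simp add: u dif)
    qed
  next
    case t
    have wt: "word_deg ext_wt u' = j" using less.prems u t by simp
    have 1: "rot 1 (monomial (u @ v) :: ('a, 'k) ext_free) = monomial (u' @ v @ [T])"
      by (simp add: u t ext_monomial_Cons monomial_append ext_gen_monomial mult.assoc)
    show ?thesis
    proof (cases j)
      case 0
      with wt 1 show ?thesis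
        by (intro exI[of _ "[T]"] exI[of _ u']) (auto simp: u t word_deg_ext_wt)
    next
      case (Suc j')
      have "length u' < length u" "word_deg ext_wt u' = Suc j'" using u wt Suc by simp_all
      from less.hyps[OF this, of "v @ [T]"] obtain u1 u2 where *: "u' = u1 @ u2"
        "word_deg ext_wt u2 = 0" "(rot 1 ^^ Suc j') (monomial (u' @ v @ [T]) :: ('a, 'k) ext_free) =
        (-1) ^ (word_deg ext_form_deg u' * word_deg ext_form_deg (v @ [T])) *
          monomial (u2 @ (v @ [T]) @ u1)"
        by blast
      have "(rot 1 ^^ Suc j) (monomial (u @ v) :: ('a, 'k) ext_free) = (rot 1 ^^ Suc j') (monomial (u' @ v @ [T]))"
        unfolding funpow_Suc_right[of j] o_apply 1 by (simp only: Suc)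
      then show ?thesis using *
        by (intro exI[of _ "T # u1"] exI[of _ u2]) (simp add: u t)
    qed
  qed
qed

section \<open>Compatibility of the operators with the relations\<close>

locale form_algebra = unital_algebra scale for scale :: "'k::comm_ring_1 \<Rightarrow> 'a::ring_1 \<Rightarrow> 'a"
begin

abbreviation "I \<equiv> ext_ideal scale"
abbreviation "CA \<equiv> comm_sub scale"
abbreviation "DR \<equiv> reduced_DR_sub scale"

lemma subspaces [simp]: "free.subspace I" "free.subspace CA" "free.subspace DR"
  by (simp_all add: ext_ideal_def subspace_ideal comm_sub_def reduced_DR_sub_def)

lemmas I_add = free.subspace_add[OF subspaces(1)]
lemmas I_diff = free.subspace_diff[OF subspaces(1)]
lemmas I_neg = free.subspace_neg[OF subspaces(1)]
lemmas I_zero = free.subspace_0[OF subspaces(1)]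
lemmas I_scale = free.subspace_scale[OF subspaces(1)]

lemma I_mult_left: "f \<in> I \<Longrightarrow> g * f \<in> I" and I_mult_right: "f \<in> I \<Longrightarrow> f * g \<in> I"
  by (simp_all add: ext_ideal_def ideal_mult_left ideal_mult_right)

lemma I_rels:
  "ext_elt 1 - 1 \<in> I" "ext_elt (a * b) - ext_elt a * ext_elt b \<in> I"
  "ext_elt (a + b) - (ext_elt a + ext_elt b) \<in> I"
  "ext_elt (scale c a) - fscale c (ext_elt a) \<in> I"
  "ext_dif (a + b) - (ext_dif a + ext_dif b) \<in> I" "ext_dif (scale c a) - fscale c (ext_dif a) \<in> I"
  "ext_dif (scale c 1) \<in> I" "ext_dif (a * b) - (ext_dif a * ext_elt b + ext_elt a * ext_dif b) \<in> I"
  unfolding ext_ideal_def by (rule form_rels_in_ideal)+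

lemma I_dif_one: "ext_dif 1 \<in> I"
  using I_rels(7)[of 1] by simp

lemmas I_intros = I_add I_neg I_zero I_mult_left I_mult_right I_rels I_dif_one

text \<open>The relations are homogeneous for every grading with \<open>A\<close> in degree
  \<open>0\<close> and all \<open>da\<close> in one common degree \<open>m\<close>. This covers the
  de Rham degree, the degree in \<open>t\<close> and the weight at once.\<close>

lemma I_graded:
  assumes "f \<in> I" "\<And>a. deg (Form (Elt a)) = 0" "\<And>a. deg (Form (Dif a)) = m"
  shows "hpart deg n f \<in> I"
  using assms(1) unfolding ext_ideal_def
proof (rule hpart_ideal)
  have e: "ext_elt a \<in> homog deg 0" and d: "ext_dif a \<in> homog deg m" for a
    using homog_gen[of deg a] assms(2,3) by auto
  have de: "ext_dif a * ext_elt b \<in> homog deg m" "ext_elt b * ext_dif a \<in> homog deg m"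
    "ext_elt a * ext_elt b \<in> homog deg 0" for a b
    using homog_mult[OF d[of a] e[of b]] homog_mult[OF e[of b] d[of a]] homog_mult[OF e[of a] e[of b]]
    by auto
  note homs = free.subspace_diff[OF subspace_homog] free.subspace_add[OF subspace_homog]
    free.subspace_scale[OF subspace_homog] e d one_in_homog de
  fix r assume "r \<in> form_rels scale ext_elt ext_dif"
  then show "\<exists>m. r \<in> homog deg m"
    by (rule form_rels_cases) (rule exI, (rule homs)+)+
qed

lemma sg_I: assumes "f \<in> I" shows "sg f \<in> I"
proof (rule ext_left_recI[where \<phi> = "\<lambda>_::unit. sg", OF assms])
  fix a b c and v :: "('a, 'k) ext_free"
  show "sg ((ext_elt 1 - 1) * v) \<in> I"
    by (rule memI[of "(ext_elt 1 - 1) * sg v"]) (blast intro: I_intros, simp add: par_mult)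
  show "sg ((ext_elt (a * b) - ext_elt a * ext_elt b) * v) \<in> I"
    by (rule memI[of "(ext_elt (a * b) - ext_elt a * ext_elt b) * sg v"])
      (blast intro: I_intros, simp add: par_mult)
  show "sg ((ext_elt (a + b) - (ext_elt a + ext_elt b)) * v) \<in> I"
    by (rule memI[of "(ext_elt (a + b) - (ext_elt a + ext_elt b)) * sg v"])
      (blast intro: I_intros, simp add: par_mult)
  show "sg ((ext_elt (scale c a) - fscale c (ext_elt a)) * v) \<in> I"
    by (rule memI[of "(ext_elt (scale c a) - fscale c (ext_elt a)) * sg v"])
      (blast intro: I_intros, simp add: par_mult)
  show "sg ((ext_dif (a + b) - (ext_dif a + ext_dif b)) * v) \<in> I"
    by (rule memI[of "- ((ext_dif (a + b) - (ext_dif a + ext_dif b)) * sg v)"])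
      (blast intro: I_intros, simp add: par_mult algebra_simps)
  show "sg ((ext_dif (scale c a) - fscale c (ext_dif a)) * v) \<in> I"
    by (rule memI[of "- ((ext_dif (scale c a) - fscale c (ext_dif a)) * sg v)"])
      (blast intro: I_intros, simp add: par_mult algebra_simps)
  show "sg (ext_dif (scale c 1) * v) \<in> I"
    by (rule memI[of "- (ext_dif (scale c 1) * sg v)"])
      (blast intro: I_intros, simp add: par_mult)
  show "sg ((ext_dif (a * b) - (ext_dif a * ext_elt b + ext_elt a * ext_dif b)) * v) \<in> I"
    by (rule memI[of "- ((ext_dif (a * b) - (ext_dif a * ext_elt b + ext_elt a * ext_dif b)) * sg v)"])
      (blast intro: I_intros, simp add: par_mult algebra_simps)
qed (auto intro!: lin_intros intro: I_mult_left I_add I_neg simp: par_mult)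

lemma ext_i_I: assumes "f \<in> I" shows "ext_i f \<in> I"
proof (rule ext_left_recI[where \<phi> = "\<lambda>_::unit. ext_i", OF assms])
  fix a b c and v :: "('a, 'k) ext_free"
  show "ext_i ((ext_elt 1 - 1) * v) \<in> I"
    by (rule memI[of "(ext_elt 1 - 1) * ext_i v"]) (blast intro: I_intros, simp add: algebra_simps)
  show "ext_i ((ext_elt (a * b) - ext_elt a * ext_elt b) * v) \<in> I"
    by (rule memI[of "(ext_elt (a * b) - ext_elt a * ext_elt b) * ext_i v"])
      (blast intro: I_intros, simp add: algebra_simps)
  show "ext_i ((ext_elt (a + b) - (ext_elt a + ext_elt b)) * v) \<in> I"
    by (rule memI[of "(ext_elt (a + b) - (ext_elt a + ext_elt b)) * ext_i v"])
      (blast intro: I_intros, simp add: algebra_simps)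
  show "ext_i ((ext_elt (scale c a) - fscale c (ext_elt a)) * v) \<in> I"
    by (rule memI[of "(ext_elt (scale c a) - fscale c (ext_elt a)) * ext_i v"])
      (blast intro: I_intros, simp add: algebra_simps fscale_mult_left)
  show "ext_i ((ext_dif (a + b) - (ext_dif a + ext_dif b)) * v) \<in> I"
    by (rule memI[of "(ext_elt (a + b) - (ext_elt a + ext_elt b)) * (ext_t * v) +
         - (ext_t * ((ext_elt (a + b) - (ext_elt a + ext_elt b)) * v)) +
         - ((ext_dif (a + b) - (ext_dif a + ext_dif b)) * ext_i v)"])
      (blast intro: I_intros, simp add: algebra_simps)
  show "ext_i ((ext_dif (scale c a) - fscale c (ext_dif a)) * v) \<in> I"
    by (rule memI[of "(ext_elt (scale c a) - fscale c (ext_elt a)) * (ext_t * v) +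
         - (ext_t * ((ext_elt (scale c a) - fscale c (ext_elt a)) * v)) +
         - ((ext_dif (scale c a) - fscale c (ext_dif a)) * ext_i v)"])
      (blast intro: I_intros, simp add: algebra_simps fscale_mult_left fscale_mult_right
         free.scale_right_distrib free.scale_right_diff_distrib)
  \<comment> \<open>The image is the commutator of \<open>c 1\<close> with \<open>t\<close>. It
    vanishes only after \<open>c 1\<close> has been rewritten as \<open>c\<close> times the unit of
    the free algebra, whence the extra corrections.\<close>
  show "ext_i (ext_dif (scale c 1) * v) \<in> I"
    by (rule memI[of "(ext_elt (scale c 1) - fscale c (ext_elt 1)) * (ext_t * v) +
         - (ext_t * ((ext_elt (scale c 1) - fscale c (ext_elt 1)) * v)) + fscale c ((ext_elt 1 - 1) * (ext_t * v))
         + fscale (-c) (ext_t * ((ext_elt 1 - 1) * v)) + - (ext_dif (scale c 1) * ext_i v)"])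
      (blast intro: I_intros I_scale, simp add: algebra_simps fscale_mult_left fscale_mult_right
         free.scale_right_distrib free.scale_right_diff_distrib)
  show "ext_i ((ext_dif (a * b) - (ext_dif a * ext_elt b + ext_elt a * ext_dif b)) * v) \<in> I"
    by (rule memI[of "(ext_elt (a * b) - ext_elt a * ext_elt b) * (ext_t * v) +
         - (ext_t * ((ext_elt (a * b) - ext_elt a * ext_elt b) * v)) +
         - ((ext_dif (a * b) - (ext_dif a * ext_elt b + ext_elt a * ext_dif b)) * ext_i v)"])
      (blast intro: I_intros, simp add: algebra_simps)
qed (auto intro!: lin_intros intro: I_mult_left I_mult_right I_diff)

lemma ext_d_I: assumes "f \<in> I" shows "ext_d f \<in> I"
proof (rule ext_left_recI[where \<phi> = "\<lambda>_::unit. ext_d", OF assms])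
  fix a b c and v :: "('a, 'k) ext_free"
  show "ext_d ((ext_elt 1 - 1) * v) \<in> I"
    by (rule memI[of "ext_dif 1 * v + (ext_elt 1 - 1) * ext_d v"])
      (blast intro: I_intros, simp add: algebra_simps)
  show "ext_d ((ext_elt (a * b) - ext_elt a * ext_elt b) * v) \<in> I"
    by (rule memI[of "(ext_dif (a * b) - (ext_dif a * ext_elt b + ext_elt a * ext_dif b)) * v +
         (ext_elt (a * b) - ext_elt a * ext_elt b) * ext_d v"])
      (blast intro: I_intros, simp add: algebra_simps)
  show "ext_d ((ext_elt (a + b) - (ext_elt a + ext_elt b)) * v) \<in> I"
    by (rule memI[of "(ext_dif (a + b) - (ext_dif a + ext_dif b)) * v +
         (ext_elt (a + b) - (ext_elt a + ext_elt b)) * ext_d v"])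
      (blast intro: I_intros, simp add: algebra_simps)
  show "ext_d ((ext_elt (scale c a) - fscale c (ext_elt a)) * v) \<in> I"
    by (rule memI[of "(ext_dif (scale c a) - fscale c (ext_dif a)) * v +
        (ext_elt (scale c a) - fscale c (ext_elt a)) * ext_d v"])
      (blast intro: I_intros, simp add: algebra_simps fscale_mult_left free.scale_right_distrib)
  show "ext_d ((ext_dif (a + b) - (ext_dif a + ext_dif b)) * v) \<in> I"
    by (rule memI[of "- ((ext_dif (a + b) - (ext_dif a + ext_dif b)) * ext_d v)"])
      (blast intro: I_intros, simp add: algebra_simps)
  show "ext_d ((ext_dif (scale c a) - fscale c (ext_dif a)) * v) \<in> I"
    by (rule memI[of "- ((ext_dif (scale c a) - fscale c (ext_dif a)) * ext_d v)"])
      (blast intro: I_intros, simp add: algebra_simps fscale_mult_left)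
  show "ext_d (ext_dif (scale c 1) * v) \<in> I"
    by (rule memI[of "- (ext_dif (scale c 1) * ext_d v)"])
      (blast intro: I_intros, simp add: algebra_simps)
  show "ext_d ((ext_dif (a * b) - (ext_dif a * ext_elt b + ext_elt a * ext_dif b)) * v) \<in> I"
    by (rule memI[of "- ((ext_dif (a * b) - (ext_dif a * ext_elt b + ext_elt a * ext_dif b)) * ext_d v)"])
      (blast intro: I_intros, simp add: algebra_simps)
qed (auto intro!: lin_intros intro: I_mult_left I_mult_right I_add I_neg)

lemma d0_I: assumes "f \<in> I" shows "d0 f \<in> I"
proof (rule ext_left_recI[where \<phi> = "\<lambda>_::unit. d0", OF assms])
  fix a b c and v :: "('a, 'k) ext_free"
  show "d0 ((ext_elt 1 - 1) * v) \<in> I"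
    by (rule memI[of "ext_dif 1 * v + (ext_elt 1 - 1) * d0 v"])
      (blast intro: I_intros, simp add: algebra_simps)
  show "d0 ((ext_elt (a * b) - ext_elt a * ext_elt b) * v) \<in> I"
    by (rule memI[of "(ext_dif (a * b) - (ext_dif a * ext_elt b + ext_elt a * ext_dif b)) * v +
         (ext_elt (a * b) - ext_elt a * ext_elt b) * d0 v"])
      (blast intro: I_intros, simp add: algebra_simps)
  show "d0 ((ext_elt (a + b) - (ext_elt a + ext_elt b)) * v) \<in> I"
    by (rule memI[of "(ext_dif (a + b) - (ext_dif a + ext_dif b)) * v +
         (ext_elt (a + b) - (ext_elt a + ext_elt b)) * d0 v"])
      (blast intro: I_intros, simp add: algebra_simps)
  show "d0 ((ext_elt (scale c a) - fscale c (ext_elt a)) * v) \<in> I"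
    by (rule memI[of "(ext_dif (scale c a) - fscale c (ext_dif a)) * v +
        (ext_elt (scale c a) - fscale c (ext_elt a)) * d0 v"])
      (blast intro: I_intros, simp add: algebra_simps fscale_mult_left free.scale_right_distrib)
  show "d0 ((ext_dif (a + b) - (ext_dif a + ext_dif b)) * v) \<in> I"
    by (rule memI[of "- ((ext_dif (a + b) - (ext_dif a + ext_dif b)) * d0 v)"])
      (blast intro: I_intros, simp add: algebra_simps)
  show "d0 ((ext_dif (scale c a) - fscale c (ext_dif a)) * v) \<in> I"
    by (rule memI[of "- ((ext_dif (scale c a) - fscale c (ext_dif a)) * d0 v)"])
      (blast intro: I_intros, simp add: algebra_simps fscale_mult_left)
  show "d0 (ext_dif (scale c 1) * v) \<in> I"
    by (rule memI[of "- (ext_dif (scale c 1) * d0 v)"])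
      (blast intro: I_intros, simp add: algebra_simps)
  show "d0 ((ext_dif (a * b) - (ext_dif a * ext_elt b + ext_elt a * ext_dif b)) * v) \<in> I"
    by (rule memI[of "- ((ext_dif (a * b) - (ext_dif a * ext_elt b + ext_elt a * ext_dif b)) * d0 v)"])
      (blast intro: I_intros, simp add: algebra_simps)
qed (auto intro!: lin_intros intro: I_mult_left I_mult_right I_add I_neg I_zero)

lemma eps_I: assumes "f \<in> I" shows "eps f \<in> I"
proof (rule ext_left_recI[where \<phi> = "\<lambda>_::unit. eps", OF assms])
  fix a b c and v :: "('a, 'k) ext_free"
  show "eps ((ext_elt 1 - 1) * v) \<in> I"
    by (rule memI[of "(ext_elt 1 - 1) * eps v"]) (blast intro: I_intros, simp add: algebra_simps)
  show "eps ((ext_elt (a * b) - ext_elt a * ext_elt b) * v) \<in> I"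
    by (rule memI[of "(ext_elt (a * b) - ext_elt a * ext_elt b) * eps v"])
      (blast intro: I_intros, simp add: algebra_simps)
  show "eps ((ext_elt (a + b) - (ext_elt a + ext_elt b)) * v) \<in> I"
    by (rule memI[of "(ext_elt (a + b) - (ext_elt a + ext_elt b)) * eps v"])
      (blast intro: I_intros, simp add: algebra_simps)
  show "eps ((ext_elt (scale c a) - fscale c (ext_elt a)) * v) \<in> I"
    by (rule memI[of "(ext_elt (scale c a) - fscale c (ext_elt a)) * eps v"])
      (blast intro: I_intros, simp add: algebra_simps fscale_mult_left)
qed (auto intro!: lin_intros intro: I_mult_left I_mult_right I_zero simp: algebra_simps fscale_mult_left)

lemma hty_I: assumes "f \<in> I" shows "hty f \<in> I"
proof (rule ext_left_recI[where \<phi> = "\<lambda>_::unit. hty", OF assms])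
  fix a b c and v :: "('a, 'k) ext_free"
  show "hty ((ext_elt 1 - 1) * v) \<in> I"
    by (rule memI[of "ext_dif 1 * eps v + (ext_elt 1 - 1) * hty v"])
      (blast intro: I_intros, simp add: algebra_simps)
  show "hty ((ext_elt (a * b) - ext_elt a * ext_elt b) * v) \<in> I"
    by (rule memI[of "(ext_dif (a * b) - (ext_dif a * ext_elt b + ext_elt a * ext_dif b)) * eps v +
         (ext_elt (a * b) - ext_elt a * ext_elt b) * hty v"])
      (blast intro: I_intros, simp add: algebra_simps)
  show "hty ((ext_elt (a + b) - (ext_elt a + ext_elt b)) * v) \<in> I"
    by (rule memI[of "(ext_dif (a + b) - (ext_dif a + ext_dif b)) * eps v +
         (ext_elt (a + b) - (ext_elt a + ext_elt b)) * hty v"])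
      (blast intro: I_intros, simp add: algebra_simps)
  show "hty ((ext_elt (scale c a) - fscale c (ext_elt a)) * v) \<in> I"
    by (rule memI[of "(ext_dif (scale c a) - fscale c (ext_dif a)) * eps v +
        (ext_elt (scale c a) - fscale c (ext_elt a)) * hty v"])
      (blast intro: I_intros, simp add: algebra_simps fscale_mult_left free.scale_right_distrib)
qed (auto intro!: lin_intros intro: I_mult_left I_mult_right I_add I_zero eps_I simp: algebra_simps fscale_mult_left)

end

section \<open>The Hochschild operator\<close>

definition alg_hom :: "('g \<Rightarrow> ('h, 'k::comm_ring_1) free_alg) \<Rightarrow> ('g, 'k) free_alg \<Rightarrow> ('h, 'k) free_alg" where
  "alg_hom h = lin_ext (\<lambda>w. prod_list (map h w))"

lemma lin_alg_hom [lin_intros]: "lin (alg_hom h)"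
  unfolding alg_hom_def by (rule lin_intros)

lemmas lin_compose_alg_hom [lin_intros] = lin_compose[OF lin_alg_hom]
lemmas alg_hom_lin_simps [simp] = module_hom.add[OF lin_alg_hom] module_hom.diff[OF lin_alg_hom]
  module_hom.neg[OF lin_alg_hom] module_hom.zero[OF lin_alg_hom] module_hom.scale[OF lin_alg_hom]

lemma alg_hom_monomial: "alg_hom h (monomial w) = prod_list (map h w)"
  by (simp add: alg_hom_def)

lemma alg_hom_one [simp]: "alg_hom h 1 = 1"
  using alg_hom_monomial[of h "[]"] by simp

lemma alg_hom_mult [simp]: "alg_hom h (f * g) = alg_hom h f * alg_hom h g"
proof (rule lin_eqI[where f = "\<lambda>f. alg_hom h (f * g)" and g = "\<lambda>f. alg_hom h f * alg_hom h g"])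
  fix u
  show "alg_hom h (monomial u * g) = alg_hom h (monomial u) * alg_hom h g"
    by (rule lin_eqI[where f = "\<lambda>g. alg_hom h (monomial u * g)"])
      (auto intro!: lin_intros simp: alg_hom_monomial simp flip: monomial_append)
qed (auto intro!: lin_intros)

lemma alg_hom_power [simp]: "alg_hom h (f ^ n) = alg_hom h f ^ n"
  by (induction n) auto

lemma alg_hom_gen: "alg_hom h (monomial [x]) = h x"
  by (simp add: alg_hom_monomial)

lemma alg_hom_ideal:
  assumes "f \<in> two_sided_ideal (form_rels scale e \<delta>)"
    "\<And>a. alg_hom h (e a) = e' a" "\<And>a. alg_hom h (\<delta> a) = \<delta>' a"
  shows "alg_hom h f \<in> two_sided_ideal (form_rels scale e' \<delta>')"
proof (rule lin_span_memI[OF assms(1)[unfolded two_sided_ideal_def] lin_alg_hom subspace_ideal], safe)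
  fix u r v assume "r \<in> form_rels scale e \<delta>"
  then have "alg_hom h r \<in> two_sided_ideal (form_rels scale e' \<delta>')"
    by (rule form_rels_cases) (simp_all add: assms form_rels_in_ideal)
  then show "alg_hom h (u * r * v) \<in> two_sided_ideal (form_rels scale e' \<delta>')"
    by (simp add: ideal_mult_left ideal_mult_right)
qed

section \<open>Ordinary forms and their relation to extended forms\<close>

abbreviation sg0 :: "('a, 'k::comm_ring_1) form_free \<Rightarrow> ('a, 'k) form_free" where
  "sg0 \<equiv> par form_deg"

lemma form_gen_monomial: "monomial [Elt a] = elt a" "monomial [Dif a] = dif a"
  by (simp_all add: elt_def dif_def)

lemma form_monomial_Cons:
  "monomial (Elt a # w) = elt a * monomial w" "monomial (Dif a # w) = dif a * monomial w"
  by (simp_all add: elt_def dif_def flip: monomial_Cons)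

lemma form_eqI [consumes 2, case_names one elt dif]:
  assumes "lin f" "lin g" "f 1 = g 1"
    "\<And>a w. f (monomial w) = g (monomial w) \<Longrightarrow> f (elt a * monomial w) = g (elt a * monomial w)"
    "\<And>a w. f (monomial w) = g (monomial w) \<Longrightarrow> f (dif a * monomial w) = g (dif a * monomial w)"
  shows "f x = g x"
proof (rule lin_eqI[OF assms(1,2)])
  show "f (monomial w) = g (monomial w)" for w
  proof (induction w)
    case (Cons x w)
    then show ?case using assms by (cases x) (auto simp: form_monomial_Cons)
  qed (simp add: assms)
qed

lemma par0_gen [simp]: "sg0 (elt a) = elt a" "sg0 (dif a) = - dif a"
  using par_monomial[of form_deg "[Elt a]"] par_monomial[of form_deg "[Dif a]"]
  by (simp_all add: form_gen_monomial)

lemma lin_form_d [lin_intros]: "lin form_d"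
  unfolding form_d_def by (rule lin_intros)

lemmas lin_compose_form_d [lin_intros] = lin_compose[OF lin_form_d]
lemmas form_lin_simps [simp] = module_hom.add[OF lin_form_d] module_hom.diff[OF lin_form_d]
  module_hom.neg[OF lin_form_d] module_hom.zero[OF lin_form_d] module_hom.scale[OF lin_form_d]

lemma form_d_one [simp]: "form_d 1 = 0"
  by (simp add: form_d_def)

lemma form_d_step [simp]:
  "form_d (elt a * f) = dif a * f + elt a * form_d f" "form_d (dif a * f) = - (dif a * form_d f)"
  using superder_step[of form_deg form_d_gen "Elt a" f] superder_step[of form_deg form_d_gen "Dif a" f]
  by (simp_all add: form_gen_monomial form_d_def)

lemma form_d_gen [simp]: "form_d (elt a) = dif a" "form_d (dif a) = 0"
  using form_d_step[where f = 1] by simp_all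

lemma form_d_mult: "form_d (f * g) = form_d f * g + sg0 f * form_d g"
  by (simp add: form_d_def superder_mult)

lemma form_d_form_d [simp]: "form_d (form_d f) = 0"
  by (rule form_eqI[where g = "\<lambda>_. 0"]) (auto intro!: lin_intros simp: algebra_simps)

lemma sg0_form_d: "sg0 (form_d f) = - form_d (sg0 f)"
  by (rule form_eqI) (auto intro!: lin_intros simp: algebra_simps par_mult)

definition incl :: "('a, 'k::comm_ring_1) form_free \<Rightarrow> ('a, 'k) ext_free" where
  "incl = alg_hom (\<lambda>x. monomial [Form x])"

text \<open>Used with two values: \<open>c = 0\<close> forgets the words that contain
  \<open>t\<close>, and \<open>c = 1\<close> annihilates the image of \<open>ext_i\<close>, because
  every element commutes with \<open>1\<close>.\<close>

definition t_to :: "('a, 'k::comm_ring_1) form_free \<Rightarrow> ('a, 'k) ext_free \<Rightarrow> ('a, 'k) form_free" where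
  "t_to c = alg_hom (\<lambda>x. case x of Form y \<Rightarrow> monomial [y] | T \<Rightarrow> c)"

lemma lin_homs [lin_intros]: "lin incl" "lin (t_to c)"
  unfolding incl_def t_to_def by (rule lin_intros)+

lemmas lin_compose_homs [lin_intros] = lin_homs[THEN lin_compose]

lemma incl_simps [simp]:
  "incl 1 = 1" "incl (x * y) = incl x * incl y" "incl (elt a) = ext_elt a" "incl (dif a) = ext_dif a"
  "incl (x + y) = incl x + incl y" "incl (x - y) = incl x - incl y" "incl (- x) = - incl x"
  "incl 0 = 0" "incl (fscale r x) = fscale r (incl x)"
  by (simp_all add: incl_def elt_def dif_def ext_elt_def ext_dif_def alg_hom_gen)

lemma t_to_simps [simp]:
  "t_to c 1 = 1" "t_to c (x * y) = t_to c x * t_to c y" "t_to c (x ^ n) = t_to c x ^ n"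
  "t_to c (ext_elt a) = elt a" "t_to c (ext_dif a) = dif a" "t_to c ext_t = c"
  "t_to c (x + y) = t_to c x + t_to c y" "t_to c (x - y) = t_to c x - t_to c y"
  "t_to c (- x) = - t_to c x" "t_to c 0 = 0" "t_to c (fscale r x) = fscale r (t_to c x)"
  by (simp_all add: t_to_def elt_def dif_def ext_elt_def ext_dif_def ext_t_def alg_hom_gen)

lemma t_to_incl [simp]: "t_to c (incl x) = x"
  by (rule form_eqI[where g = "\<lambda>x. x"]) (auto intro!: lin_intros)

lemma sg_incl: "sg (incl x) = incl (sg0 x)"
  by (rule form_eqI) (auto intro!: lin_intros simp: par_mult)

lemma t_to_one_sg: "t_to 1 (sg x) = sg0 (t_to 1 x)"
  by (rule ext_eqI) (auto intro!: lin_intros simp: par_mult)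

lemma t_to_one_ext_i [simp]: "t_to 1 (ext_i x) = 0"
  by (rule ext_eqI[where g = "\<lambda>_. 0"]) (auto intro!: lin_intros)

lemma t_to_one_ext_d: "t_to 1 (ext_d x) = form_d (t_to 1 x)"
  by (rule ext_eqI) (auto intro!: lin_intros)

lemma incl_t_to_zero:
  assumes "f \<in> homog ext_t_deg 0" shows "incl (t_to 0 f) = f"
proof (rule homog_lin_eqI[OF assms, where \<psi> = "\<lambda>f. f"])
  show "incl (t_to 0 (monomial w)) = monomial w" if "word_deg ext_t_deg w = 0" for w
    using that
  proof (induction w)
    case (Cons x w)
    then show ?case by (cases x rule: ext_gen_cases) (auto simp: ext_monomial_Cons)
  qed simp
qed (auto intro!: lin_intros)

lemma t_to_homog:
  assumes "f \<in> homog ext_form_deg n" "c \<in> homog form_deg 0" shows "t_to c f \<in> homog form_deg n"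
proof (rule homog_lin_memI[OF assms(1) _ subspace_homog])
  show "t_to c (monomial w) \<in> homog form_deg n" if "word_deg ext_form_deg w = n" for w
    using that
  proof (induction w arbitrary: n)
    case (Cons x w)
    have "elt a \<in> homog form_deg 0" "dif a \<in> homog form_deg 1" for a
      by (auto simp: elt_def dif_def intro: monomial_in_homog)
    note * = homog_mult[OF this(1) Cons.IH[OF refl]] homog_mult[OF this(2) Cons.IH[OF refl]]
      homog_mult[OF assms(2) Cons.IH[OF refl]]
    show ?case using * Cons.prems by (cases x rule: ext_gen_cases) (auto simp: ext_monomial_Cons)
  qed (simp add: one_in_homog)
qed (auto intro!: lin_intros)

lemma incl_homog:
  fixes f :: "('a, 'k::comm_ring_1) form_free"
  assumes "f \<in> homog form_deg n" shows "incl f \<in> ext_homog n 0"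
  unfolding ext_homog_def
proof (rule homog_lin_memI[OF assms(1) _ free.subspace_inter[OF subspace_homog subspace_homog]])
  show "(incl (monomial w) :: ('a, 'k) ext_free) \<in> homog ext_form_deg n \<inter> homog ext_t_deg 0" if "word_deg form_deg w = n"
    for w :: "'a form_gen list"
  proof -
    have "(incl (monomial w) :: ('a, 'k) ext_free) = monomial (map Form w)"
    proof (induction w)
      case (Cons x w)
      then show ?case by (cases x) (auto simp: form_monomial_Cons ext_monomial_Cons)
    qed simp
    moreover have "word_deg ext_form_deg (map Form w) = n" "word_deg ext_t_deg (map Form w) = 0"
      using that by (auto simp: word_deg_def o_def)
    ultimately show ?thesis by (simp add: monomial_in_homog)
  qed
qed (auto intro!: lin_intros)

fun lam_word :: "('a, 'k::comm_ring_1) form_free \<Rightarrow> 'a ext_gen list \<Rightarrow> ('a, 'k) form_free" where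
  "lam_word u [] = 0"
| "lam_word u (Form (Elt a) # w) = lam_word (elt a * u) w"
| "lam_word u (Form (Dif a) # w) = 0"
| "lam_word u (T # w) = u * t_to 0 (monomial (rev w))"

text \<open>\<open>lam u\<close> sends \<open>f t a\<close>, with \<open>f\<close> free of \<open>t\<close> and \<open>a\<close> a product of elements of \<open>A\<close>, to \<open>a u f\<close>,
  and kills the other words.\<close>

definition lam :: "('a, 'k::comm_ring_1) form_free \<Rightarrow> ('a, 'k) ext_free \<Rightarrow> ('a, 'k) form_free" where
  "lam u = lin_ext (\<lambda>w. lam_word u (rev w))"

lemma lin_lam [lin_intros]: "lin (lam u)"
  unfolding lam_def by (rule lin_intros)

lemmas lin_compose_lam [lin_intros] = lin_compose[OF lin_lam]
lemmas lam_lin_simps [simp] = module_hom.add[OF lin_lam] module_hom.diff[OF lin_lam]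
  module_hom.neg[OF lin_lam] module_hom.zero[OF lin_lam] module_hom.scale[OF lin_lam]

lemma lam_monomial: "lam u (monomial w) = lam_word u (rev w)"
  by (simp add: lam_def)

lemma lin_ext_snoc:
  assumes "lin g" "\<And>w. \<phi> (w @ [x]) = g (monomial w)"
  shows "lin_ext \<phi> (f * monomial [x]) = g f"
proof (rule lin_eqI[where f = "\<lambda>f. lin_ext \<phi> (f * monomial [x])" and g = g])
  show "lin_ext \<phi> (monomial w * monomial [x]) = g (monomial w)" for w
    by (simp add: assms(2) flip: monomial_append)
qed (auto intro!: lin_intros assms)

lemma lam_step [simp]:
  "lam u (f * ext_elt a) = lam (elt a * u) f" "lam u (f * ext_dif a) = 0"
  "lam u (f * ext_t) = u * t_to 0 f" "lam u 1 = 0"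
  using lin_ext_snoc[of "lam (elt a * u)" "\<lambda>w. lam_word u (rev w)" "Form (Elt a)" f]
    lin_ext_snoc[of "\<lambda>f. 0" "\<lambda>w. lam_word u (rev w)" "Form (Dif a)" f]
    lin_ext_snoc[of "\<lambda>f. u * t_to 0 f" "\<lambda>w. lam_word u (rev w)" T f] 
    lin_ext_one[of "\<lambda>w. lam_word u (rev w)"]
  by (simp_all add: lin_intros lam_monomial ext_gen_monomial flip: lam_def)

lemma ext_word_rev_induct [case_names one elt dif t]:
  assumes "P 1" "\<And>a w. P (monomial w) \<Longrightarrow> P (monomial w * ext_elt a)"
    "\<And>a w. P (monomial w) \<Longrightarrow> P (monomial w * ext_dif a)" "\<And>w. P (monomial w) \<Longrightarrow> P (monomial w * ext_t)"
  shows "P (monomial w)"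
proof (induction w rule: rev_induct)
  case (snoc x w)
  then show ?case using assms
    by (cases x rule: ext_gen_cases) (auto simp: monomial_append ext_gen_monomial)
qed (simp add: assms)

lemma lin_lam_left:
  fixes f :: "('a, 'k::comm_ring_1) ext_free"
  shows "lin (\<lambda>u. lam u f)"
proof (rule linI)
  fix u v :: "('a, 'k) form_free" and c
  show "lam (u + v) f = lam u f + lam v f"
  proof (rule lin_eqI[of "lam (u + v)"])
    have "\<forall>u v. lam (u + v) (monomial w) = lam u (monomial w) + lam v (monomial w)" for w
      by (rule ext_word_rev_induct) (auto simp: distrib_left distrib_right)
    then show "lam (u + v) (monomial w) = lam u (monomial w) + lam v (monomial w)" for w
      by blast
  qed (auto intro!: lin_intros)
  show "lam (fscale c u) f = fscale c (lam u f)"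
  proof (rule lin_eqI[of "lam (fscale c u)"])
    have "\<forall>u. lam (fscale c u) (monomial w) = fscale c (lam u (monomial w))" for w
      by (rule ext_word_rev_induct) (auto simp: fscale_mult_left fscale_mult_right)
    then show "lam (fscale c u) (monomial w) = fscale c (lam u (monomial w))" for w
      by blast
  qed (auto intro!: lin_intros)
qed

lemmas lam_left_simps = module_hom.add[OF lin_lam_left] module_hom.diff[OF lin_lam_left]
  module_hom.neg[OF lin_lam_left] module_hom.zero[OF lin_lam_left] module_hom.scale[OF lin_lam_left]

lemma lam_elt_mult: "lam u (ext_elt a * f) = lam (u * elt a) f"
proof (rule lin_eqI[where f = "\<lambda>f. lam u (ext_elt a * f)"])
  have "\<forall>u. lam u (ext_elt a * monomial w) = lam (u * elt a) (monomial w)" for w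
  proof (rule ext_word_rev_induct[where P = "\<lambda>f. \<forall>u. lam u (ext_elt a * f) = lam (u * elt a) f"])
    show "\<forall>u. lam u (ext_elt a * 1) = lam (u * elt a) 1"
      by (metis lam_step(1,4) mult_1_left mult_1_right)
  qed (auto simp flip: mult.assoc)
  then show "lam u (ext_elt a * monomial w) = lam (u * elt a) (monomial w)" for w by blast
qed (auto intro!: lin_intros)

text \<open>Among the terms of \<open>ext_i\<close>, only those from the last \<open>da\<close> of a
  word end in a \<open>t\<close> followed by elements of \<open>A\<close>; they are the ones that
  \<open>lam\<close> keeps. So \<open>b\<close> is read off from \<open>ext_i\<close>, and it
  respects the relations because \<open>ext_i\<close> and \<open>lam\<close> do.\<close>

definition form_b :: "('a, 'k::comm_ring_1) form_free \<Rightarrow> ('a, 'k) form_free" where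
  "form_b x = lam 1 (ext_i (incl x))"

lemma lin_form_b [lin_intros]: "lin form_b"
  unfolding form_b_def[abs_def] by (intro lin_intros)

lemmas lin_compose_form_b [lin_intros] = lin_compose[OF lin_form_b]
lemmas form_b_lin_simps [simp] = module_hom.add[OF lin_form_b] module_hom.diff[OF lin_form_b]
  module_hom.neg[OF lin_form_b] module_hom.zero[OF lin_form_b] module_hom.scale[OF lin_form_b]

lemma form_b_mult_dif: "form_b (f * dif a) = sg0 f * elt a - elt a * sg0 f"
proof -
  have "form_b (f * dif a) = lam 1 (incl (sg0 f) * ext_elt a * ext_t) - lam 1 (incl (sg0 f) * ext_t * ext_elt a)"
    by (simp add: form_b_def ext_i_mult sg_incl right_diff_distrib flip: mult.assoc)
  then show ?thesis by simp
qed

lemma subspace_ext_homog: "free.subspace (ext_homog m n)"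
  by (simp add: ext_homog_def free.subspace_inter subspace_homog)

lemma ext_homog_lin_memI:
  assumes "f \<in> ext_homog p q" "lin \<phi>" "free.subspace N"
    "\<And>w. word_deg ext_form_deg w = p \<Longrightarrow> word_deg ext_t_deg w = q \<Longrightarrow> \<phi> (monomial w) \<in> N"
  shows "\<phi> f \<in> N"
proof -
  have "\<phi> (hpart ext_t_deg q (hpart ext_form_deg p f)) \<in> N"
    by (rule lin_memI[where f = "\<lambda>f. \<phi> (hpart ext_t_deg q (hpart ext_form_deg p f))", OF _ assms(3)])
      (auto intro!: lin_intros lin_compose[OF assms(2)] assms(4)
        simp: hpart_monomial module_hom.zero[OF lin_hpart] module_hom.zero[OF assms(2)]
          free.subspace_0[OF assms(3)])
  then show ?thesis using assms(1) by (simp add: ext_homog_def hpart_homog)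
qed

lemma ext_i_homog_0:
  assumes "f \<in> homog ext_form_deg 0" shows "ext_i f = 0"
proof (rule homog_lin_eqI[OF assms, where \<psi> = "\<lambda>_. 0"])
  show "ext_i (monomial w) = 0" if "word_deg ext_form_deg w = 0" for w
    using that
  proof (induction w)
    case (Cons x w)
    then show ?case by (cases x rule: ext_gen_cases) (auto simp: ext_monomial_Cons)
  qed simp
qed (auto intro!: lin_intros)

lemma form_b_homog_0:
  assumes "f \<in> homog form_deg 0" shows "form_b f = 0"
  using incl_homog[OF assms] by (simp add: form_b_def ext_homog_def ext_i_homog_0)

lemma ext_i_homog:
  fixes f :: "('a, 'k::comm_ring_1) ext_free"
  assumes "f \<in> ext_homog (Suc p) q" shows "ext_i f \<in> ext_homog p (Suc q)"
proof -
  have e: "(ext_elt a :: ('a, 'k) ext_free) \<in> ext_homog 0 0"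
    "(ext_dif a :: ('a, 'k) ext_free) \<in> ext_homog 1 0" "(ext_t :: ('a, 'k) ext_free) \<in> ext_homog 0 1" for a
    by (auto simp: ext_homog_def ext_elt_def ext_dif_def ext_t_def intro!: monomial_in_homog)
  have m: "x * y \<in> ext_homog (m + k) (n + l)" if "x \<in> ext_homog m n" "y \<in> ext_homog k l" for x y :: "('a, 'k) ext_free" and m n k l
    using that by (auto simp: ext_homog_def homog_mult)
  have s: "free.subspace (ext_homog m n :: ('a, 'k) ext_free set)" for m n
    by (simp add: ext_homog_def free.subspace_inter subspace_homog)
  have *: "(ext_i (monomial w) :: ('a, 'k) ext_free) \<in> ext_homog n (Suc (word_deg ext_t_deg w))"
    if "word_deg ext_form_deg w = Suc n" for w :: "'a ext_gen list" and n
    using that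
  proof (induction w arbitrary: n)
    case (Cons x w)
    have w: "(monomial w :: ('a, 'k) ext_free) \<in> ext_homog (word_deg ext_form_deg w) (word_deg ext_t_deg w)"
      by (simp add: ext_homog_def monomial_in_homog)
    show ?case
    proof (cases x rule: ext_gen_cases)
      case (elt a)
      then show ?thesis using Cons m[OF e(1)[of a] Cons.IH[of n]] by (simp add: ext_monomial_Cons)
    next
      case t
      then show ?thesis using Cons m[OF e(3) Cons.IH[of n]] by (simp add: ext_monomial_Cons)
    next
      case (dif a)
      have "(ext_dif a :: ('a, 'k) ext_free) * ext_i (monomial w) \<in> ext_homog n (Suc (word_deg ext_t_deg w))"
      proof (cases n)
        case 0
        then have "(ext_i (monomial w) :: ('a, 'k) ext_free) = 0"
          using Cons.prems dif by (intro ext_i_homog_0 monomial_in_homog) simp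
        then show ?thesis by (simp add: free.subspace_0[OF s])
      next
        case (Suc n')
        then show ?thesis using m[OF e(2)[of a] Cons.IH[of n']] Cons.prems dif by simp
      qed
      moreover have "(ext_elt a :: ('a, 'k) ext_free) * (ext_t * monomial w) \<in> ext_homog n (Suc (word_deg ext_t_deg w))"
        "ext_t * ((ext_elt a :: ('a, 'k) ext_free) * monomial w) \<in> ext_homog n (Suc (word_deg ext_t_deg w))"
        using m[OF e(1)[of a] m[OF e(3) w]] m[OF e(3) m[OF e(1)[of a] w]] Cons.prems dif by simp_all
      ultimately show ?thesis using dif by (simp add: ext_monomial_Cons free.subspace_diff[OF s])
    qed
  qed simp
  show ?thesis
    by (rule ext_homog_lin_memI[OF assms lin_ext_i s]) (use * in auto)
qed

lemma lam_homog:
  fixes f :: "('a, 'k::comm_ring_1) ext_free"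
  assumes "f \<in> homog ext_form_deg n" "u \<in> homog form_deg 0" shows "lam u f \<in> homog form_deg n"
proof (rule homog_lin_memI[OF assms(1) lin_lam subspace_homog])
  have "\<forall>u::('a, 'k) form_free\<in>homog form_deg 0. lam u (monomial w) \<in> homog form_deg (word_deg ext_form_deg w)" for w
  proof (induction w rule: rev_induct)
    case (snoc x w)
    have e: "(elt a :: ('a, 'k) form_free) \<in> homog form_deg 0" for a
      by (auto simp: elt_def intro: monomial_in_homog)
    have w: "(t_to 0 (monomial w) :: ('a, 'k) form_free) \<in> homog form_deg (word_deg ext_form_deg w)"
      by (intro t_to_homog monomial_in_homog) (auto simp: free.subspace_0[OF subspace_homog])
    show ?case
    proof
      fix u :: "('a, 'k) form_free" assume u: "u \<in> homog form_deg 0"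
      show "lam u (monomial (w @ [x])) \<in> homog form_deg (word_deg ext_form_deg (w @ [x]))"
        using snoc homog_mult[OF e u] homog_mult[OF u w]
        by (cases x rule: ext_gen_cases)
          (auto simp: monomial_append ext_gen_monomial free.subspace_0[OF subspace_homog])
    qed
  qed (simp add: free.subspace_0[OF subspace_homog])
  then show "lam u (monomial w) \<in> homog form_deg n" if "word_deg ext_form_deg w = n" for w
    using that assms(2) by blast
qed

lemma form_b_homog:
  assumes "f \<in> homog form_deg (Suc n)" shows "form_b f \<in> homog form_deg n"
  using ext_i_homog[OF incl_homog[OF assms]]
  by (auto simp: form_b_def ext_homog_def intro!: lam_homog one_in_homog)

lemma form_d_homog:
  assumes "f \<in> homog form_deg n" shows "form_d f \<in> homog form_deg (Suc n)"
proof (rule homog_lin_memI[OF assms(1) lin_form_d subspace_homog])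
  show "form_d (monomial w) \<in> homog form_deg (Suc n)" if "word_deg form_deg w = n" for w
    using that
  proof (induction w arbitrary: n)
    case (Cons x w)
    have e: "elt a \<in> homog form_deg 0" "dif a \<in> homog form_deg 1" for a
      by (auto simp: elt_def dif_def intro: monomial_in_homog)
    show ?case
      using Cons.prems homog_mult[OF e(1) Cons.IH[OF refl]] homog_mult[OF e(2) Cons.IH[OF refl]]
        homog_mult[OF e(2) monomial_in_homog[where deg = form_deg and w = w, OF refl]]
      by (cases x) (auto simp: form_monomial_Cons intro!: free.subspace_add[OF subspace_homog] free.subspace_neg[OF subspace_homog])
  qed (simp add: free.subspace_0[OF subspace_homog])
qed

abbreviation pd :: "'a list \<Rightarrow> ('a, 'k::comm_ring_1) form_free" where
  "pd as \<equiv> prod_list (map dif as)"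

lemma form_d_pd [simp]: "form_d (pd as) = 0"
  by (induction as) auto

lemma sg0_pd [simp]: "sg0 (pd as) = (-1) ^ length as * pd as"
  by (induction as) (simp_all add: par_mult mult.assoc, metis neg_one_power_commute mult.assoc)

lemma pd_homog: "pd as \<in> homog form_deg (length as)"
proof (induction as)
  case (Cons a as)
  have "dif a \<in> homog form_deg 1" by (auto simp: dif_def intro: monomial_in_homog)
  from homog_mult[OF this Cons] show ?case by simp
qed (simp add: one_in_homog)

lemma elt_homog: "elt a \<in> homog form_deg 0" and dif_homog: "dif a \<in> homog form_deg 1"
  by (auto simp: elt_def dif_def intro: monomial_in_homog)

context form_algebra
begin

abbreviation "I0 \<equiv> form_ideal scale"
abbreviation "N0 \<equiv> reduced_form_sub scale"

lemma subspaces0 [simp]: "free.subspace I0" "free.subspace N0"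
  by (simp_all add: form_ideal_def subspace_ideal reduced_form_sub_def)

lemmas I0_add = free.subspace_add[OF subspaces0(1)]
lemmas I0_diff = free.subspace_diff[OF subspaces0(1)]
lemmas I0_neg = free.subspace_neg[OF subspaces0(1)]
lemmas I0_zero = free.subspace_0[OF subspaces0(1)]

lemma I0_mult_left: "f \<in> I0 \<Longrightarrow> g * f \<in> I0" and I0_mult_right: "f \<in> I0 \<Longrightarrow> f * g \<in> I0"
  by (simp_all add: form_ideal_def ideal_mult_left ideal_mult_right)

lemma I0_rels:
  "elt 1 - 1 \<in> I0" "elt (a * b) - elt a * elt b \<in> I0" "elt (a + b) - (elt a + elt b) \<in> I0"
  "elt (scale c a) - fscale c (elt a) \<in> I0"
  "dif (a + b) - (dif a + dif b) \<in> I0" "dif (scale c a) - fscale c (dif a) \<in> I0"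
  "dif (scale c 1) \<in> I0" "dif (a * b) - (dif a * elt b + elt a * dif b) \<in> I0"
  unfolding form_ideal_def by (rule form_rels_in_ideal)+


lemma I0_sub_N0: "x \<in> I0 \<Longrightarrow> x \<in> N0" and one_in_N0: "1 \<in> N0"
  by (auto simp: reduced_form_sub_def intro: free.span_base)

lemma incl_I: "x \<in> I0 \<Longrightarrow> incl x \<in> I"
  unfolding form_ideal_def ext_ideal_def incl_def
  by (erule alg_hom_ideal) (simp_all flip: incl_def)

lemma t_to_I: "x \<in> I \<Longrightarrow> t_to c x \<in> I0"
  unfolding form_ideal_def ext_ideal_def t_to_def
  by (erule alg_hom_ideal) (simp_all flip: t_to_def)

lemma form_d_I0: assumes "x \<in> I0" shows "form_d x \<in> I0"
  using t_to_I[OF ext_d_I[OF incl_I[OF assms]], of 1] by (simp add: t_to_one_ext_d)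

lemma lam_I0_left: assumes "u \<in> I0" shows "lam u f \<in> I0"
proof (rule lin_memI[OF lin_lam subspaces0(1)])
  have "\<forall>u\<in>I0. lam u (monomial w) \<in> I0" for w
    by (rule ext_word_rev_induct) (auto simp: I0_zero I0_mult_left I0_mult_right)
  then show "lam u (monomial w) \<in> I0" for w using assms by blast
qed

lemma lam_I: assumes "f \<in> I" shows "lam u f \<in> I0"
  using assms unfolding ext_ideal_def
proof (rule ideal_right_recI[where \<phi> = lam, OF _ lin_lam subspaces0(1)])
  fix u r and v :: "('a, 'k) ext_free" 
  assume "r \<in> form_rels scale ext_elt ext_dif"
  then show "lam u (v * r) \<in> I0"
  proof (rule form_rels_cases)
    have "lam u (v * (ext_elt 1 - 1)) = lam ((elt 1 - 1) * u) v"
      by (simp add: right_diff_distrib left_diff_distrib lam_left_simps)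
    then show "lam u (v * (ext_elt 1 - 1)) \<in> I0"
      by (simp only: I0_rels(1) I0_mult_right lam_I0_left)
    fix a b c
    have "lam u (v * (ext_elt (a * b) - ext_elt a * ext_elt b)) = lam ((elt (a * b) - elt a * elt b) * u) v"
      by (simp add: right_diff_distrib left_diff_distrib lam_left_simps flip: mult.assoc)
    then show "lam u (v * (ext_elt (a * b) - ext_elt a * ext_elt b)) \<in> I0"
      by (simp only: I0_rels(2) I0_mult_right lam_I0_left)
    have "lam u (v * (ext_elt (a + b) - (ext_elt a + ext_elt b))) = lam ((elt (a + b) - (elt a + elt b)) * u) v"
      by (simp add: ring_distribs lam_left_simps)
    then show "lam u (v * (ext_elt (a + b) - (ext_elt a + ext_elt b))) \<in> I0"
      by (simp only: I0_rels(3) I0_mult_right lam_I0_left)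
    have "lam u (v * (ext_elt (scale c a) - fscale c (ext_elt a))) = lam ((elt (scale c a) - fscale c (elt a)) * u) v"
      by (simp add: ring_distribs lam_left_simps fscale_mult_left fscale_mult_right)
    then show "lam u (v * (ext_elt (scale c a) - fscale c (ext_elt a))) \<in> I0"
      by (simp only: I0_rels(4) I0_mult_right lam_I0_left)
    show "lam u (v * (ext_dif (a * b) - (ext_dif a * ext_elt b + ext_elt a * ext_dif b))) \<in> I0"
      by (simp add: ring_distribs I0_zero flip: mult.assoc)
  qed (simp_all add: ring_distribs I0_zero fscale_mult_right)
next
  fix u x and g :: "('a, 'k) ext_free"
  assume "g \<in> two_sided_ideal (form_rels scale ext_elt ext_dif)" "\<And>j. lam j g \<in> I0"
  then show "lam u (g * monomial [x]) \<in> I0"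
    by (cases x rule: ext_gen_cases)
      (auto simp: ext_gen_monomial I0_zero intro!: I0_mult_left t_to_I simp flip: ext_ideal_def)
qed

lemma lam_comm_sub: assumes "f \<in> CA" shows "lam 1 f \<in> N0"
proof (rule lin_span_memI[OF assms[unfolded comm_sub_def] lin_lam subspaces0(2)])
  fix s assume "s \<in> I \<union> {ext_elt a * f - f * ext_elt a |a f. True} \<union> range ((^) ext_t)"
  then consider "s \<in> I" | a f where "s = ext_elt a * f - f * ext_elt a" | n where "s = ext_t ^ n"
    by blast
  then show "lam 1 s \<in> N0"
  proof cases
    case 3
    show ?thesis
    proof (cases n)
      case (Suc m)
      \<comment> \<open>The last \<open>t\<close> is consumed and the others are set to
        \<open>0\<close>. Thus \<open>t\<close> itself goes to \<open>1\<close>, and the target has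
        to be \<open>N0\<close>, where constants are divided out.\<close>
      have "lam 1 s = lam 1 (ext_t ^ m * ext_t)" by (simp only: 3 Suc power_Suc2)
      then have "lam 1 s = 0 ^ m" by simp
      then show ?thesis by (cases m) (auto simp: free.subspace_0 one_in_N0)
    qed (simp add: 3 free.subspace_0)
  qed (auto simp: lam_I I0_sub_N0 lam_elt_mult free.subspace_0)
qed

lemma form_b_I0: "x \<in> I0 \<Longrightarrow> form_b x \<in> I0"
  by (simp add: form_b_def lam_I ext_i_I incl_I)

lemma form_b_N0: assumes "x \<in> N0" shows "form_b x \<in> N0"
  by (rule lin_span_memI[OF assms[unfolded reduced_form_sub_def] lin_form_b subspaces0(2)])
    (auto simp: form_b_I0 I0_sub_N0 form_b_homog_0[OF one_in_homog] free.subspace_0)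

lemma form_d_N0: assumes "x \<in> N0" shows "form_d x \<in> I0"
  by (rule lin_span_memI[OF assms[unfolded reduced_form_sub_def] lin_form_d subspaces0(1)])
    (auto simp: form_d_I0 I0_zero)

text \<open>Every form is congruent to a combination of forms \<open>a\<^sub>0 da\<^sub>1 \<cdots> da\<^sub>n\<close>.\<close>

lemma form_normal_memI:
  assumes "x \<in> homog form_deg n" "lin f" "free.subspace N" "\<And>y. y \<in> I0 \<Longrightarrow> f y \<in> N"
    "\<And>a as. length as = n \<Longrightarrow> f (elt a * pd as) \<in> N"
  shows "f x \<in> N"
proof (rule homog_lin_memI[OF assms(1-3)])
  let ?S = "\<lambda>n. free.span (I0 \<union> {elt a * pd as | a as. length as = n})"
  have I0S: "y \<in> ?S n" if "y \<in> I0" for y n using that by (auto intro: free.span_base)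
  have S: "monomial w \<in> ?S (word_deg form_deg w)" for w
  proof (induction w)
    case Nil
    have "elt 1 * pd [] \<in> ?S 0" by (rule free.span_base) auto
    from free.span_add[OF this I0S[OF I0_neg[OF I0_rels(1)]]] show ?case
      by simp
  next
    case (Cons x w)
    show ?case
    proof (cases x)
      case (Elt b)
      have "elt b * monomial w \<in> ?S (word_deg form_deg w)"
      proof (rule lin_span_memI[OF Cons, where f = "\<lambda>x. elt b * x"])
        fix s assume "s \<in> I0 \<union> {elt a * pd as | a as. length as = word_deg form_deg w}"
        then consider "s \<in> I0" | a as where "s = elt a * pd as" "length as = word_deg form_deg w" by blast
        then show "elt b * s \<in> ?S (word_deg form_deg w)"
        proof cases
          case 1
          then show ?thesis by (intro I0S I0_mult_left)
        next
          case 2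
          have 1: "elt (b * a) * pd as \<in> ?S (word_deg form_deg w)"
            using 2 by (intro free.span_base) auto
          have 2: "elt b * s = elt (b * a) * pd as + - ((elt (b * a) - elt b * elt a) * pd as)"
            by (simp add: 2 algebra_simps)
          show ?thesis
            by (rule memI[OF free.span_add[OF 1 I0S[OF I0_neg[OF I0_mult_right[OF I0_rels(2)]]]] 2])
        qed
      qed (auto intro!: lin_intros)
      then show ?thesis by (simp add: Elt form_monomial_Cons)
    next
      case (Dif b)
      have "dif b * monomial w \<in> ?S (Suc (word_deg form_deg w))"
      proof (rule lin_span_memI[OF Cons, where f = "\<lambda>x. dif b * x"])
        fix s assume "s \<in> I0 \<union> {elt a * pd as | a as. length as = word_deg form_deg w}"
        then consider "s \<in> I0" | a as where "s = elt a * pd as" "length as = word_deg form_deg w" by blast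
        then show "dif b * s \<in> ?S (Suc (word_deg form_deg w))"
        proof cases
          case 1
          then show ?thesis by (intro I0S I0_mult_left)
        next
          case 2
          \<comment> \<open>The product \<open>db a\<close> is \<open>d(ba) - b da\<close>; the term
            with \<open>d(ba)\<close> also needs the unit as its coefficient to have the required
            shape. These are the two corrections.\<close>
          let ?y = "- ((dif (b * a) - (dif b * elt a + elt b * dif a)) * pd as) +
              - ((elt 1 - 1) * (dif (b * a) * pd as))"
          have "length (b * a # as) = Suc (word_deg form_deg w)" "length (a # as) = Suc (word_deg form_deg w)"
            using 2 by simp_all
          then have 3: "elt 1 * pd (b * a # as) - elt b * pd (a # as) \<in> ?S (Suc (word_deg form_deg w))"
            by (intro free.span_diff free.span_base) blast+
          have 4: "?y \<in> ?S (Suc (word_deg form_deg w))"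
            by (intro I0S I0_add I0_neg I0_mult_right I0_rels)
          show ?thesis
            by (rule memI[OF free.span_add[OF 3 4]]) (simp add: 2 algebra_simps)
        qed
      qed (auto intro!: lin_intros)
      then show ?thesis by (simp add: Dif form_monomial_Cons)
    qed
  qed
  fix w :: "'a form_gen list" assume w: "word_deg form_deg w = n"
  show "f (monomial w) \<in> N"
    by (rule lin_span_memI[OF S assms(2,3)]) (use assms(4,5) w in auto)
qed

lemma form_normal_cong:
  assumes "x \<in> homog form_deg n" "lin f" "lin g" "free.subspace N"
    "\<And>y. y \<in> I0 \<Longrightarrow> f y \<in> N" "\<And>y. y \<in> I0 \<Longrightarrow> g y \<in> N"
    "\<And>a as. length as = n \<Longrightarrow> f (elt a * pd as) - g (elt a * pd as) \<in> N"
  shows "f x - g x \<in> N"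
  by (rule form_normal_memI[OF assms(1) lin_minus[OF assms(2,3)] assms(4)])
    (auto intro: assms free.subspace_diff[OF assms(4)])

end

section \<open>The Tsygan map modulo commutators with the algebra\<close>

text \<open>On generating series, with the index of \<open>X\<close> as exponent of a variable
  \<open>z\<close>, this is left multiplication by the geometric series of \<open>t z\<close>: it
  inserts an arbitrary power of \<open>t\<close> in front and records it in the degree.\<close>

primrec geo :: "(nat \<Rightarrow> ('a, 'k::comm_ring_1) ext_free) \<Rightarrow> nat \<Rightarrow> ('a, 'k) ext_free" where
  "geo X 0 = X 0"
| "geo X (Suc q) = X (Suc q) + ext_t * geo X q"

lemma lin_geo [lin_intros]: "(\<And>k. lin (\<lambda>x. X x k)) \<Longrightarrow> lin (\<lambda>x. geo (X x) q)"
  by (induction q) (auto intro!: lin_intros)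

lemma geo_add: "geo (\<lambda>k. X k + Y k) q = geo X q + geo Y q"
  by (induction q) (simp_all add: algebra_simps)

lemma geo_diff: "geo (\<lambda>k. X k - Y k) q = geo X q - geo Y q"
  by (induction q) (simp_all add: ring_distribs)

lemma geo_uminus: "geo (\<lambda>k. - X k) q = - geo X q"
  by (induction q) (simp_all add: algebra_simps)

lemma geo_mult_right: "geo (\<lambda>k. X k * a) q = geo X q * a"
  by (induction q) (simp_all add: algebra_simps)

lemma geo_fscale: "geo (\<lambda>k. fscale c (X k)) q = fscale c (geo X q)"
  by (induction q) (simp_all add: free.scale_right_distrib fscale_mult_right)

lemma d0_geo: "d0 (geo X q) = d0 (X q)"
  by (cases q) simp_all

lemma ext_i_geo: "ext_i (geo X q) = geo (\<lambda>k. ext_i (X k)) q"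
  by (induction q) simp_all

lemma ext_d_geo: "ext_d (geo X q) = geo (\<lambda>k. ext_d (X k)) q"
  by (induction q) simp_all

lemma geo_zero [simp]: "geo (\<lambda>k. 0) q = 0"
  by (induction q) auto

lemma t_power_ops [simp]: "d0 (ext_t ^ k) = 0" "ext_i (ext_t ^ k) = 0" "ext_d (ext_t ^ k) = 0"
  by (cases k; simp) (induction k; simp)+

lemma geo_cong: "(\<And>k. X k = Y k) \<Longrightarrow> geo X q = geo Y q"
  by (induction q) simp_all

primrec tsy_word :: "'a form_gen list \<Rightarrow> nat \<Rightarrow> ('a, 'k::comm_ring_1) ext_free" where
  "tsy_word [] = (\<lambda>q. ext_t ^ q)"
| "tsy_word (x # w) = (case x of
     Elt a \<Rightarrow> (\<lambda>q. ext_elt a * tsy_word w q)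
   | Dif a \<Rightarrow> (\<lambda>q. geo (\<lambda>k. ext_dif a * tsy_word w k + ext_elt a * d0 (tsy_word w k)) q
                - ext_elt a * geo (\<lambda>k. d0 (tsy_word w k)) q))"

text \<open>The component of the Tsygan map of degree \<open>q\<close> in \<open>t\<close>, without the factorials and before passing
  to cyclic words. The recursion over arbitrary words comes from writing
  \<open>da b\<^sub>0 \<beta> = d(a b\<^sub>0) \<beta> - a db\<^sub>0 \<beta>\<close>.\<close>

definition tsy :: "nat \<Rightarrow> ('a, 'k::comm_ring_1) form_free \<Rightarrow> ('a, 'k) ext_free" where
  "tsy q = lin_ext (\<lambda>w. tsy_word w q)"

lemma lin_tsy [lin_intros]: "lin (tsy q)"
  unfolding tsy_def by (rule lin_intros)

lemmas lin_compose_tsy [lin_intros] = lin_compose[OF lin_tsy]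
lemmas tsy_lin_simps [simp] = module_hom.add[OF lin_tsy] module_hom.diff[OF lin_tsy]
  module_hom.neg[OF lin_tsy] module_hom.zero[OF lin_tsy] module_hom.scale[OF lin_tsy]

lemma tsy_monomial: "tsy q (monomial w) = tsy_word w q"
  by (simp add: tsy_def)

lemma tsy_step [simp]:
  "tsy q (elt a * f) = ext_elt a * tsy q f"
  "tsy q (dif a * f) = geo (\<lambda>k. ext_dif a * tsy k f + ext_elt a * d0 (tsy k f)) q
     - ext_elt a * geo (\<lambda>k. d0 (tsy k f)) q"
  "tsy q 1 = ext_t ^ q"
  using lin_ext_Cons[of "\<lambda>f. ext_elt a * tsy q f" "\<lambda>w. tsy_word w q" "Elt a" f]
    lin_ext_Cons[of "\<lambda>f. geo (\<lambda>k. ext_dif a * tsy k f + ext_elt a * d0 (tsy k f)) q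
     - ext_elt a * geo (\<lambda>k. d0 (tsy k f)) q" "\<lambda>w. tsy_word w q" "Dif a" f]
    lin_ext_one[of "\<lambda>w. tsy_word w q"]
  by (simp_all add: lin_intros tsy_monomial form_gen_monomial flip: tsy_def)

lemma tsy_elt [simp]: "tsy q (elt a) = ext_elt a * ext_t ^ q"
  using tsy_step(1)[where f = 1] by simp

text \<open>Deleting a leading \<open>t\<close> lowers \<open>k\<^sub>0\<close> by one and kills the
  terms with \<open>k\<^sub>0 = 0\<close> that contain a \<open>da\<close>. This compatibility
  drives the induction on the degree in \<open>t\<close>.\<close>

lemma eps_tsy: "eps (tsy (Suc q) x) = tsy q x"
  by (rule form_eqI) (auto intro!: lin_intros simp: algebra_simps)

lemma tsy_0: "tsy 0 x = incl x"
  by (rule form_eqI) (auto intro!: lin_intros simp: algebra_simps)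

text \<open>On \<open>a\<^sub>0 da\<^sub>1 ... da\<^sub>n\<close> the operator \<open>d0\<close>
  only turns the coefficient into \<open>da\<^sub>0\<close>, and \<open>geo\<close> supplies the
  power of \<open>t\<close> that has to stand in front of it.\<close>

lemma tsy_form_d: "tsy q (form_d x) = geo (\<lambda>k. d0 (tsy k x)) q"
proof -
  have "\<forall>q. tsy q (form_d (monomial w)) = geo (\<lambda>k. d0 (tsy k (monomial w))) q" for w
  proof (induction w)
    case Nil
    show ?case by simp
  next
    case (Cons x w)
    then show ?case
      by (cases x) (simp_all add: form_monomial_Cons d0_geo geo_add geo_diff geo_uminus algebra_simps)
  qed
  then show ?thesis
    by (intro lin_eqI[where f = "\<lambda>x. tsy q (form_d x)" and x = x]) (auto intro!: lin_intros)
qed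

lemma d0_homog:
  fixes f :: "('a, 'k::comm_ring_1) ext_free"
  assumes "f \<in> ext_homog n q" shows "d0 f \<in> ext_homog (Suc n) q"
proof (rule ext_homog_lin_memI[OF assms(1) lin_ops(1) subspace_ext_homog])
  fix w :: "'a ext_gen list"
  assume "word_deg ext_form_deg w = n" "word_deg ext_t_deg w = q"
  then show "(d0 (monomial w) :: ('a, 'k) ext_free) \<in> ext_homog (Suc n) q"
  proof (induction w arbitrary: n q)
    case (Cons x w)
    have e: "(ext_elt a :: ('a, 'k) ext_free) \<in> homog ext_form_deg 0" "(ext_elt a :: ('a, 'k) ext_free) \<in> homog ext_t_deg 0" 
      "(ext_dif a :: ('a, 'k) ext_free) \<in> homog ext_form_deg 1" "(ext_dif a :: ('a, 'k) ext_free) \<in> homog ext_t_deg 0" for a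
      by (auto simp: ext_elt_def ext_dif_def intro!: monomial_in_homog)
    have w: "(monomial w :: ('a, 'k) ext_free) \<in> homog ext_form_deg (word_deg ext_form_deg w)"
      "(monomial w :: ('a, 'k) ext_free) \<in> homog ext_t_deg (word_deg ext_t_deg w)"
      by (auto intro: monomial_in_homog)
    have IH: "d0 (monomial w :: ('a, 'k) ext_free) \<in> homog ext_form_deg (Suc (word_deg ext_form_deg w))"
      "d0 (monomial w :: ('a, 'k) ext_free) \<in> homog ext_t_deg (word_deg ext_t_deg w)"
      using Cons.IH by (auto simp: ext_homog_def)
    show ?case
      using Cons.prems homog_mult[OF e(1) IH(1)] homog_mult[OF e(2) IH(2)]
        homog_mult[OF e(3) IH(1)] homog_mult[OF e(4) IH(2)] homog_mult[OF e(3) w(1)] homog_mult[OF e(4) w(2)]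
      by (cases x rule: ext_gen_cases)
        (auto simp: ext_monomial_Cons ext_homog_def intro!: free.subspace_add[OF subspace_homog]
         free.subspace_neg[OF subspace_homog] free.subspace_0[OF subspace_homog])
  qed (simp add: free.subspace_0[OF subspace_ext_homog])
qed

lemma ext_homog_mult:
  "f \<in> ext_homog m n \<Longrightarrow> g \<in> ext_homog k l \<Longrightarrow> f * g \<in> ext_homog (m + k) (n + l)"
  by (auto simp: ext_homog_def homog_mult)

lemma ext_gen_homog: "ext_elt a \<in> ext_homog 0 0" "ext_dif a \<in> ext_homog 1 0" "ext_t \<in> ext_homog 0 1"
  by (auto simp: ext_homog_def ext_elt_def ext_dif_def ext_t_def intro!: monomial_in_homog)

lemma geo_homog: "(\<And>k. X k \<in> ext_homog n k) \<Longrightarrow> geo X q \<in> ext_homog n q"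
proof (induction q)
  case (Suc q)
  then show ?case using ext_homog_mult[OF ext_gen_homog(3) Suc.IH]
    by (auto intro!: free.subspace_add[OF subspace_ext_homog])
qed simp

lemma t_power_homog: "ext_t ^ q \<in> ext_homog 0 q"
proof (induction q)
  case (Suc q)
  then show ?case using ext_homog_mult[OF ext_gen_homog(3)] by force
qed (simp add: ext_homog_def one_in_homog)

lemma tsy_homog:
  fixes x :: "('a, 'k::comm_ring_1) form_free"
  assumes "x \<in> homog form_deg n" shows "tsy q x \<in> ext_homog n q"
proof (rule homog_lin_memI[OF assms lin_tsy subspace_ext_homog])
  fix w :: "'a form_gen list"
  assume "word_deg form_deg w = n"
  then show "(tsy q (monomial w) :: ('a, 'k) ext_free) \<in> ext_homog n q"
  proof (induction w arbitrary: n q)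
    case (Cons x w)
    have IH: "(tsy k (monomial w) :: ('a, 'k) ext_free) \<in> ext_homog (word_deg form_deg w) k" for k
      using Cons.IH by blast
    show ?case
    proof (cases x)
      case (Elt a)
      then show ?thesis using Cons.prems ext_homog_mult[OF ext_gen_homog(1) IH[of q], of a]
        by (simp add: form_monomial_Cons)
    next
      case (Dif a)
      have n: "n = Suc (word_deg form_deg w)" using Cons.prems Dif by simp
      have "geo (\<lambda>k. d0 (tsy k (monomial w))) q \<in> (ext_homog n q :: ('a, 'k) ext_free set)"
        unfolding n by (intro geo_homog d0_homog IH)
      from ext_homog_mult[OF ext_gen_homog(1) this, of a]
      have 1: "ext_elt a * geo (\<lambda>k. d0 (tsy k (monomial w))) q \<in> (ext_homog n q :: ('a, 'k) ext_free set)"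
        by simp
      have "ext_dif a * tsy k (monomial w) \<in> (ext_homog n k :: ('a, 'k) ext_free set)"
        "ext_elt a * d0 (tsy k (monomial w)) \<in> (ext_homog n k :: ('a, 'k) ext_free set)" for k
        using ext_homog_mult[OF ext_gen_homog(2) IH[of k], of a]
          ext_homog_mult[OF ext_gen_homog(1) d0_homog[OF IH[of k]], of a] by (simp_all add: n)
      then have "geo (\<lambda>k. ext_dif a * tsy k (monomial w) + ext_elt a * d0 (tsy k (monomial w))) q
          \<in> (ext_homog n q :: ('a, 'k) ext_free set)"
        by (intro geo_homog free.subspace_add[OF subspace_ext_homog])
      with 1 show ?thesis
        by (simp add: Dif form_monomial_Cons free.subspace_diff[OF subspace_ext_homog])
    qed
  qed (simp add: t_power_homog)
qed

lemma d0_tsy_pd: "d0 (tsy q (pd as)) = 0"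
proof (induction as arbitrary: q)
  case Nil
  then show ?case by (cases q) simp_all
next
  case (Cons a as)
  then show ?case by (simp add: d0_geo)
qed

lemma tsy_pd_Cons: "tsy q (pd (a # as)) = geo (\<lambda>k. ext_dif a * tsy k (pd as)) q"
  by (simp add: d0_tsy_pd)

lemma geo_shift: "Z 0 = 0 \<Longrightarrow> geo (\<lambda>k. a * Z k) (Suc q) = geo (\<lambda>k. a * Z (Suc k)) q"
  by (induction q) simp_all

text \<open>The commutator of \<open>e\<close> with \<open>t^k\<close> is the sum of
  \<open>t^i [e, t] t^j\<close> over \<open>i + j = k - 1\<close>.\<close>

lemma geo_elt_commute:
  "geo (\<lambda>k. e * Y k) (Suc q) - e * geo Y (Suc q) = - geo (\<lambda>k. (e * ext_t - ext_t * e) * geo Y k) q"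
proof (induction q)
  case (Suc q)
  have "geo (\<lambda>k. e * Y k) (Suc (Suc q)) - e * geo Y (Suc (Suc q)) =
      ext_t * (geo (\<lambda>k. e * Y k) (Suc q) - e * geo Y (Suc q)) - (e * ext_t - ext_t * e) * geo Y (Suc q)"
    by (simp add: algebra_simps)
  also have "\<dots> = - geo (\<lambda>k. (e * ext_t - ext_t * e) * geo Y k) (Suc q)"
    unfolding Suc by (simp add: algebra_simps)
  finally show ?case .
qed (simp add: algebra_simps)

text \<open>The sum of \<open>t^i [a, t] t^j\<close> over \<open>i + j = q\<close> telescopes to the
  commutator of \<open>a\<close> with \<open>t^(q+1)\<close>. Doing this at each letter leaves the
  terms of the Leibniz expansion of \<open>pd bs * elt a\<close> together with the one in which
  \<open>a\<close> has reached the right end.\<close>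

lemma ext_i_tsy_pd:
  fixes a :: 'a
  shows "(ext_i (tsy q (pd (bs @ [a]))) :: ('a, 'k::comm_ring_1) ext_free) =
    (-1) ^ length bs * (tsy (Suc q) (pd bs * elt a) - tsy (Suc q) (pd bs) * ext_elt a)"
proof (induction bs arbitrary: q)
  case Nil
  have *: "(geo (\<lambda>k. (ext_elt a * ext_t - ext_t * ext_elt a) * ext_t ^ k) q :: ('a, 'k) ext_free) =
      ext_elt a * ext_t ^ Suc q - ext_t ^ Suc q * ext_elt a" for q
  proof (induction q)
    case (Suc q)
    have "(ext_t :: ('a, 'k) ext_free) * (ext_elt a * ext_t ^ Suc q - ext_t ^ Suc q * ext_elt a) +
        (ext_elt a * ext_t - ext_t * ext_elt a) * ext_t ^ Suc q =
        ext_elt a * ext_t ^ Suc (Suc q) - ext_t ^ Suc (Suc q) * ext_elt a"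
      by (simp add: algebra_simps)
    then show ?case using Suc by (simp only: geo.simps add.commute)
  qed (simp add: algebra_simps)
  have "(ext_i (tsy q (dif a * 1)) :: ('a, 'k) ext_free) = geo (\<lambda>k. (ext_elt a * ext_t - ext_t * ext_elt a) * ext_t ^ k) q"
    unfolding tsy_step by (simp add: ext_i_geo algebra_simps)
  then show ?case by (simp add: * del: power_Suc)
next
  case (Cons c bs)
  let ?m = "length bs"
  define Y :: "nat \<Rightarrow> ('a, 'k) ext_free" where "Y k = d0 (tsy k (pd bs * elt a))" for k
  define U :: "nat \<Rightarrow> ('a, 'k) ext_free" where "U k = tsy k (pd (bs @ [a]))" for k
  define Z :: "nat \<Rightarrow> ('a, 'k) ext_free" where "Z k = tsy k (pd bs * elt a) - tsy k (pd bs) * ext_elt a" for k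
  have "(form_d (pd bs * elt a) :: ('a, 'k) form_free) = (-1) ^ ?m * pd (bs @ [a])"
    by (simp add: form_d_mult mult.assoc)
  \<comment> \<open>Up to sign \<open>U\<close> is \<open>geo Y\<close>, so the terms in which the
    commutator of \<open>c\<close> and \<open>t\<close> multiplies \<open>U\<close> have the shape
    that \<open>geo_elt_commute\<close> sums.\<close>
  then have geoY: "geo Y k = (-1) ^ ?m * U k" for k
    using tsy_form_d[of k "pd bs * elt a :: ('a, 'k) form_free"] unfolding Y_def U_def by (cases "even ?m") simp_all
  have Z0: "Z 0 = 0" by (simp add: Z_def tsy_0)
  have IH: "ext_i (U k) = (-1) ^ ?m * Z (Suc k)" for k
    unfolding U_def Z_def by (rule Cons)
  have "(ext_i (tsy q (pd ((c # bs) @ [a]))) :: ('a, 'k) ext_free) =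
      geo (\<lambda>k. (ext_elt c * ext_t - ext_t * ext_elt c) * U k - ext_dif c * ((-1) ^ ?m * Z (Suc k))) q"
    unfolding append_Cons tsy_pd_Cons ext_i_geo U_def[symmetric]
    by (rule geo_cong) (simp add: IH algebra_simps)
  also have "\<dots> = geo (\<lambda>k. (ext_elt c * ext_t - ext_t * ext_elt c) * U k) q
      - (-1) ^ ?m * geo (\<lambda>k. ext_dif c * Z (Suc k)) q"
    by (cases "even ?m") (simp_all add: geo_diff geo_uminus geo_add)
  also have "geo (\<lambda>k. ext_dif c * Z (Suc k)) q = geo (\<lambda>k. ext_dif c * Z k) (Suc q)"
    using geo_shift[of Z, OF Z0] by metis
  also have "geo (\<lambda>k. (ext_elt c * ext_t - ext_t * ext_elt c) * U k) q =
      - ((-1) ^ ?m * (geo (\<lambda>k. ext_elt c * Y k) (Suc q) - ext_elt c * geo Y (Suc q)))"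
    unfolding geo_elt_commute unfolding geoY
    by (cases "even ?m") (simp_all add: geo_uminus)
  finally have 1: "(ext_i (tsy q (pd ((c # bs) @ [a]))) :: ('a, 'k) ext_free) = - ((-1) ^ ?m *
      (geo (\<lambda>k. ext_dif c * Z k) (Suc q) + (geo (\<lambda>k. ext_elt c * Y k) (Suc q) - ext_elt c * geo Y (Suc q))))"
    by (simp add: algebra_simps)
  have "(tsy (Suc q) (pd (c # bs) * elt a) :: ('a, 'k) ext_free) - tsy (Suc q) (pd (c # bs)) * ext_elt a =
      geo (\<lambda>k. ext_dif c * Z k) (Suc q) + (geo (\<lambda>k. ext_elt c * Y k) (Suc q) - ext_elt c * geo Y (Suc q))"
    unfolding tsy_pd_Cons geo_mult_right[symmetric] Z_def Y_def
    by (simp add: mult.assoc geo_add geo_diff right_diff_distrib del: geo.simps)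
  with 1 show ?case by simp
qed

context form_algebra
begin

lemma geo_I: "(\<And>k. X k \<in> I) \<Longrightarrow> geo X q \<in> I"
  by (induction q) (auto intro: I_add I_mult_left)

lemma tsy_I: assumes "x \<in> I0" shows "tsy q x \<in> I"
  using assms unfolding form_ideal_def
proof (rule ideal_left_recI[where \<phi> = tsy, OF _ lin_tsy subspaces(1)])
  fix q r and v :: "('a, 'k) form_free"
  assume "r \<in> form_rels scale elt dif"
  then show "tsy q (r * v) \<in> I"
  proof (rule form_rels_cases)
    fix a b c
    let ?Y = "\<lambda>k. d0 (tsy k v)"
    show "tsy q ((elt 1 - 1) * v) \<in> I"
      by (rule memI[of "(ext_elt 1 - 1) * tsy q v"]) (blast intro: I_intros, simp add: algebra_simps)
    show "tsy q ((elt (a * b) - elt a * elt b) * v) \<in> I"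
      by (rule memI[of "(ext_elt (a * b) - ext_elt a * ext_elt b) * tsy q v"])
        (blast intro: I_intros, simp add: algebra_simps)
    show "tsy q ((elt (a + b) - (elt a + elt b)) * v) \<in> I"
      by (rule memI[of "(ext_elt (a + b) - (ext_elt a + ext_elt b)) * tsy q v"])
        (blast intro: I_intros, simp add: algebra_simps)
    show "tsy q ((elt (scale c a) - fscale c (elt a)) * v) \<in> I"
      by (rule memI[of "(ext_elt (scale c a) - fscale c (ext_elt a)) * tsy q v"])
        (blast intro: I_intros, simp add: algebra_simps fscale_mult_left)
    show "tsy q ((dif (a + b) - (dif a + dif b)) * v) \<in> I"
      by (rule memI[of "geo (\<lambda>k. (ext_dif (a + b) - (ext_dif a + ext_dif b)) * tsy k v +
            (ext_elt (a + b) - (ext_elt a + ext_elt b)) * ?Y k) q +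
            - ((ext_elt (a + b) - (ext_elt a + ext_elt b)) * geo ?Y q)"])
        (blast intro: I_intros geo_I, simp add: algebra_simps geo_add geo_diff)
    show "tsy q ((dif (scale c a) - fscale c (dif a)) * v) \<in> I"
      by (rule memI[of "geo (\<lambda>k. (ext_dif (scale c a) - fscale c (ext_dif a)) * tsy k v +
            (ext_elt (scale c a) - fscale c (ext_elt a)) * ?Y k) q +
            - ((ext_elt (scale c a) - fscale c (ext_elt a)) * geo ?Y q)"])
        (blast intro: I_intros geo_I, simp add: algebra_simps geo_add geo_diff fscale_mult_left geo_fscale
          free.scale_right_distrib free.scale_right_diff_distrib)
    show "tsy q (dif (scale c 1) * v) \<in> I"
      by (rule memI[of "geo (\<lambda>k. ext_dif (scale c 1) * tsy k v) q +
            geo (\<lambda>k. (ext_elt (scale c 1) - fscale c (ext_elt 1)) * ?Y k) q +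
            fscale c (geo (\<lambda>k. (ext_elt 1 - 1) * ?Y k) q) +
            - ((ext_elt (scale c 1) - fscale c (ext_elt 1)) * geo ?Y q) +
            - fscale c ((ext_elt 1 - 1) * geo ?Y q)"])
        (blast intro: I_intros geo_I I_scale, simp add: algebra_simps geo_add geo_diff fscale_mult_left geo_fscale
          free.scale_right_distrib free.scale_right_diff_distrib)
    show "tsy q ((dif (a * b) - (dif a * elt b + elt a * dif b)) * v) \<in> I"
      by (rule memI[of "geo (\<lambda>k. (ext_dif (a * b) - (ext_dif a * ext_elt b + ext_elt a * ext_dif b)) * tsy k v +
            (ext_elt (a * b) - ext_elt a * ext_elt b) * ?Y k) q +
            - ((ext_elt (a * b) - ext_elt a * ext_elt b) * geo ?Y q)"])
        (blast intro: I_intros geo_I, simp add: algebra_simps geo_add geo_diff)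
  qed
next
  fix q x and g :: "('a, 'k) form_free"
  assume "g \<in> two_sided_ideal (form_rels scale elt dif)" and g: "\<And>j. tsy j g \<in> I"
  show "tsy q (monomial [x] * g) \<in> I"
    by (cases x) (auto simp: form_gen_monomial intro!: g I_mult_left I_diff I_add geo_I d0_I)
qed

lemma I_sub_CA: "x \<in> I \<Longrightarrow> x \<in> CA"
  and comm_CA: "ext_elt a * f - f * ext_elt a \<in> CA"
  and t_power_CA: "ext_t ^ n \<in> CA"
  by (auto simp: comm_sub_def intro!: free.span_base)

lemma hpart_mult_elt:
  assumes "deg (Form (Elt a)) = 0"
  shows "hpart deg n (ext_elt a * f) = ext_elt a * hpart deg n f"
    "hpart deg n (f * ext_elt a) = hpart deg n f * ext_elt a"
proof -
  show "hpart deg n (ext_elt a * f) = ext_elt a * hpart deg n f"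
  proof (rule lin_eqI[where f = "\<lambda>f. hpart deg n (ext_elt a * f)"])
    show "hpart deg n (ext_elt a * monomial w) = ext_elt a * hpart deg n (monomial w)" for w
      using assms by (simp add: hpart_monomial flip: ext_monomial_Cons)
  qed (auto intro!: lin_intros)
  show "hpart deg n (f * ext_elt a) = hpart deg n f * ext_elt a"
  proof (rule lin_eqI[where f = "\<lambda>f. hpart deg n (f * ext_elt a)"])
    show "hpart deg n (monomial w * ext_elt a) = hpart deg n (monomial w) * ext_elt a" for w
      using assms by (simp add: ext_elt_def hpart_monomial flip: monomial_append)
  qed (auto intro!: lin_intros)
qed

text \<open>Several maps are controlled on homogeneous elements only. Multiplication by an element
  of \<open>A\<close> has degree \<open>0\<close>, so the generators of \<open>CA\<close> may be
  replaced by their components of degree \<open>n\<close>.\<close>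

lemma CA_homog_memI:
  assumes "y \<in> CA" "y \<in> homog deg n" "lin \<phi>" "free.subspace M"
    and deg: "\<And>a. deg (Form (Elt a)) = 0" "\<And>a. deg (Form (Dif a)) = m"
    and "\<And>x. x \<in> I \<Longrightarrow> x \<in> homog deg n \<Longrightarrow> \<phi> x \<in> M"
      "\<And>a f. f \<in> homog deg n \<Longrightarrow> \<phi> (ext_elt a * f - f * ext_elt a) \<in> M"
      "\<And>k. (ext_t ^ k :: ('a, 'k) ext_free) \<in> homog deg n \<Longrightarrow> \<phi> (ext_t ^ k) \<in> M"
  shows "\<phi> y \<in> M"
proof -
  have "\<phi> (hpart deg n y) \<in> M"
  proof (rule lin_span_memI[OF assms(1)[unfolded comm_sub_def] lin_compose[OF assms(3) lin_hpart] assms(4)])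
    fix s assume "s \<in> I \<union> {ext_elt a * f - f * ext_elt a |a f. True} \<union> range ((^) ext_t)"
    then consider "s \<in> I" | a f where "s = ext_elt a * f - f * ext_elt a" | k where "s = ext_t ^ k"
      by blast
    then show "\<phi> (hpart deg n s) \<in> M"
    proof cases
      case 1
      then show ?thesis using assms(7) I_graded[of s deg m n] deg hpart_in_homog by blast
    next
      case 2
      then show ?thesis using assms(8) deg
        by (simp add: module_hom.diff[OF lin_hpart] hpart_mult_elt hpart_in_homog)
    next
      case 3
      have "monomial (replicate k T) = (ext_t ^ k :: ('a, 'k) ext_free)"
        by (induction k) (auto simp: ext_monomial_Cons)
      then have "hpart deg n (ext_t ^ k :: ('a, 'k) ext_free) = ext_t ^ k \<or>
          hpart deg n (ext_t ^ k :: ('a, 'k) ext_free) = 0"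
        using hpart_monomial[of deg n "replicate k T"] by metis
      moreover have "(ext_t ^ k :: ('a, 'k) ext_free) \<in> homog deg n"
        if "hpart deg n (ext_t ^ k :: ('a, 'k) ext_free) = ext_t ^ k"
        using that by (simp add: homog_iff)
      ultimately show ?thesis using assms(9)
        by (auto simp: 3 module_hom.zero[OF assms(3)] free.subspace_0[OF assms(4)])
    qed
  qed
  then show ?thesis using assms(2) by (simp add: hpart_homog)
qed

text \<open>The formula for \<open>ext_i\<close> leaves the last element at the right end, whereas
  \<open>form_b\<close> puts it at the left end. The discrepancy is one commutator with
  \<open>A\<close>.\<close>

lemma tsy_chain: "ext_i (tsy q x) - tsy (Suc q) (form_b x) \<in> CA"
  if "x \<in> homog form_deg n"
proof (rule form_normal_cong[OF that])
  fix a and bs :: "'a list" assume n: "length bs = n"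
  show "ext_i (tsy q (elt a * pd bs)) - tsy (Suc q) (form_b (elt a * pd bs)) \<in> CA"
  proof (cases bs rule: rev_cases)
    case Nil
    then show ?thesis by (simp add: form_b_homog_0[OF elt_homog] free.subspace_0)
  next
    case (snoc cs c)
    let ?W = "ext_elt a * tsy (Suc q) (pd cs) :: ('a, 'k) ext_free"
    have "(form_b (elt a * pd bs) :: ('a, 'k) form_free) = form_b (elt a * pd cs * dif c)"
      by (simp add: snoc mult.assoc)
    also have "\<dots> = (-1) ^ length cs * (elt a * (pd cs * elt c) - elt c * (elt a * pd cs))"
      unfolding form_b_mult_dif by (cases "even (length cs)") (simp_all add: par_mult mult.assoc)
    finally have "(tsy (Suc q) (form_b (elt a * pd bs)) :: ('a, 'k) ext_free) =
        (-1) ^ length cs * (ext_elt a * tsy (Suc q) (pd cs * elt c) - ext_elt c * ?W)"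
      by (cases "even (length cs)") simp_all
    moreover have "(ext_i (tsy q (elt a * pd bs)) :: ('a, 'k) ext_free) =
       (-1) ^ length cs * (ext_elt a * tsy (Suc q) (pd cs * elt c) - ?W * ext_elt c)"
      unfolding snoc tsy_step ext_i_step ext_i_tsy_pd
      by (cases "even (length cs)") (simp_all add: right_diff_distrib mult.assoc)
    ultimately have "ext_i (tsy q (elt a * pd bs)) - tsy (Suc q) (form_b (elt a * pd bs)) =
        (-1) ^ length cs * (ext_elt c * ?W - ?W * ext_elt c)"
      by (simp add: algebra_simps)
    then show ?thesis using comm_CA[of c ?W] free.subspace_neg[OF subspaces(2) comm_CA[of c ?W]]
      by (cases "even (length cs)") simp_all
  qed
qed (auto intro!: lin_intros I_sub_CA ext_i_I tsy_I form_b_I0)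

lemma tsy_N0: assumes "x \<in> N0" shows "tsy q x \<in> CA"
  by (rule lin_span_memI[OF assms[unfolded reduced_form_sub_def] lin_tsy subspaces(2)])
    (auto intro: I_sub_CA tsy_I t_power_CA)

lemma eps_CA: assumes "y \<in> CA" shows "eps y \<in> CA"
proof (rule lin_span_memI[OF assms[unfolded comm_sub_def] lin_ops(2) subspaces(2)])
  fix s assume "s \<in> I \<union> {ext_elt a * f - f * ext_elt a |a f. True} \<union> range ((^) ext_t)"
  then consider "s \<in> I" | a f where "s = ext_elt a * f - f * ext_elt a" | k where "s = ext_t ^ k"
    by blast
  then show "eps s \<in> CA"
  proof cases
    case 3
    then show ?thesis by (cases k) (auto simp: t_power_CA free.subspace_0)
  qed (auto simp: I_sub_CA eps_I eps_mult_elt comm_CA)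
qed

section \<open>Lifting cycles by one power of \<open>t\<close>\<close>

definition CAi :: "('a, 'k) ext_free set" where
  "CAi = free.span (CA \<union> range ext_i)"

lemma subspace_CAi [simp]: "free.subspace CAi"
  by (simp add: CAi_def)

lemma CA_sub_CAi: "x \<in> CA \<Longrightarrow> x \<in> CAi" and ext_i_CAi: "ext_i x \<in> CAi"
  by (auto simp: CAi_def intro: free.span_base)

text \<open>If \<open>\<alpha>\<close> is a cycle, then by the homotopy \<open>hty\<close> it is homologous to \<open>lift (eps \<alpha>)\<close>.\<close>

definition lift :: "('a, 'k) ext_free \<Rightarrow> ('a, 'k) ext_free" where
  "lift y = ext_t * y + d0 (ext_i y)"

text \<open>Left multiplication by \<open>t\<close> does not respect the commutator of
  \<open>a\<close> and \<open>f\<close>. The correction \<open>d0 (ext_i y)\<close> makes the error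
  equal to the boundary of \<open>- da f\<close> up to further commutators. On boundaries the
  correction vanishes, and \<open>t\<close> commutes with \<open>ext_i\<close>.\<close>

lemma lift_CAi: assumes "y \<in> CAi" shows "lift y \<in> CAi"
proof (rule lin_span_memI[OF assms[unfolded CAi_def], of lift])
  show lin: "lin lift" unfolding lift_def[abs_def] by (intro lin_intros)
  fix s assume "s \<in> CA \<union> range ext_i"
  then consider "s \<in> CA" | x where "s = ext_i x" by blast
  then show "lift s \<in> CAi"
  proof cases
    case 1
    show ?thesis
    proof (rule lin_span_memI[OF _ lin subspace_CAi, OF 1[unfolded comm_sub_def]])
      fix s assume "s \<in> I \<union> {ext_elt a * f - f * ext_elt a |a f. True} \<union> range ((^) ext_t)"
      then consider "s \<in> I" | a f where "s = ext_elt a * f - f * ext_elt a" | k where "s = ext_t ^ k"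
        by blast
      then show "lift s \<in> CAi"
      proof cases
        case 1
        then show ?thesis
          by (auto simp: lift_def intro!: CA_sub_CAi I_sub_CA I_add I_mult_left d0_I ext_i_I)
      next
        case 2
        have "lift s = (ext_elt a * (ext_t * f) - (ext_t * f) * ext_elt a) +
            (ext_elt a * d0 (ext_i f) - d0 (ext_i f) * ext_elt a) - ext_i (ext_dif a * f)"
          by (simp add: 2 lift_def ext_i_mult_elt d0_ext_i_mult_elt algebra_simps)
        then show ?thesis
          by (simp only: free.subspace_diff[OF subspace_CAi free.subspace_add[OF subspace_CAi
                CA_sub_CAi[OF comm_CA] CA_sub_CAi[OF comm_CA]] ext_i_CAi])
      next
        case 3
        have "lift s = ext_t ^ Suc k" by (simp add: 3 lift_def)
        then show ?thesis using CA_sub_CAi t_power_CA by metis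
      qed
    qed
  next
    case 2
    have "lift s = ext_i (ext_t * x)" by (simp add: 2 lift_def)
    then show ?thesis by (metis ext_i_CAi)
  qed
qed simp

text \<open>On a commutator of \<open>a\<close> and \<open>f\<close> both maps produce the same term
  \<open>da eps f\<close>, and what remains are commutators with \<open>a\<close>. Degree at least
  two in \<open>t\<close> leaves a \<open>t\<close> in \<open>eps f\<close>, which stops
  \<open>d0\<close> before a factor \<open>a\<close> on its right.\<close>

lemma hty_d0_eps:
  assumes "y \<in> CA" "y \<in> homog ext_t_deg (Suc (Suc n))" shows "hty y - d0 (eps y) \<in> CA"
proof (rule CA_homog_memI[OF assms, where \<phi> = "\<lambda>y. hty y - d0 (eps y)" and m = 0])
  fix a and f :: "('a, 'k) ext_free" assume f: "f \<in> homog ext_t_deg (Suc (Suc n))"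
  have "eps f \<in> homog ext_t_deg (Suc n)"
  proof (rule homog_lin_memI[OF f lin_ops(2) subspace_homog])
    show "(eps (monomial w) :: ('a, 'k) ext_free) \<in> homog ext_t_deg (Suc n)"
      if "word_deg ext_t_deg w = Suc (Suc n)" for w :: "'a ext_gen list"
      using that
    proof (induction w)
      case (Cons x w)
      then show ?case using homog_mult[OF homog_gen(1)[of ext_t_deg]]
        by (cases x rule: ext_gen_cases)
          (auto simp: ext_monomial_Cons free.subspace_0[OF subspace_homog] intro!: monomial_in_homog)
    qed simp
  qed
  then have "d0 (eps f * ext_elt a) = d0 (eps f) * ext_elt a" by (rule d0_mult_T)
  then show "hty (ext_elt a * f - f * ext_elt a) - d0 (eps (ext_elt a * f - f * ext_elt a)) \<in> CA"
    by (intro memI[OF free.subspace_diff[OF subspaces(2) comm_CA[of a "hty f"] comm_CA[of a "d0 (eps f)"]]])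
      (simp add: hty_mult_elt eps_mult_elt algebra_simps)
next
  fix k :: nat assume "(ext_t ^ k :: ('a, 'k) ext_free) \<in> homog ext_t_deg (Suc (Suc n))"
  show "hty (ext_t ^ k :: ('a, 'k) ext_free) - d0 (eps (ext_t ^ k)) \<in> CA"
    by (cases k; cases "k - 1") (auto simp: free.subspace_0)
qed (auto intro!: lin_intros I_sub_CA I_diff hty_I d0_I eps_I)

lemma eps_homog:
  fixes f :: "('a, 'k) ext_free"
  assumes "f \<in> ext_homog p (Suc q)" shows "eps f \<in> ext_homog p q"
proof (rule ext_homog_lin_memI[OF assms lin_ops(2) subspace_ext_homog])
  fix w :: "'a ext_gen list"
  assume "word_deg ext_form_deg w = p" "word_deg ext_t_deg w = Suc q"
  then show "(eps (monomial w) :: ('a, 'k) ext_free) \<in> ext_homog p q"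
  proof (induction w)
    case (Cons x w)
    show ?case
    proof (cases x rule: ext_gen_cases)
      case (elt a)
      with Cons have "(eps (monomial w) :: ('a, 'k) ext_free) \<in> ext_homog p q" by simp
      from ext_homog_mult[OF ext_gen_homog(1) this, of a] elt show ?thesis
        by (simp add: ext_monomial_Cons)
    next
      case t
      with Cons.prems show ?thesis
        by (simp add: ext_monomial_Cons ext_homog_def monomial_in_homog)
    qed (simp add: ext_monomial_Cons free.subspace_0[OF subspace_ext_homog])
  qed simp
qed

text \<open>The homotopy formula writes the difference as the boundary of
  \<open>hty \<alpha>\<close> plus the amount by which \<open>hty\<close> and \<open>d0 eps\<close>
  disagree on \<open>ext_i \<alpha>\<close>. The latter is in \<open>CA\<close> since
  \<open>ext_i \<alpha>\<close> is.\<close>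

lemma cycle_lift:
  assumes "\<alpha> \<in> ext_homog p (Suc q)" "ext_i \<alpha> \<in> CA" shows "\<alpha> - lift (eps \<alpha>) \<in> CAi"
proof -
  have h: "\<alpha> = ext_t * eps \<alpha> + ext_i (hty \<alpha>) + hty (ext_i \<alpha>)"
    using assms(1) by (intro hty_homotopy[where n = q]) (simp add: ext_homog_def)
  have "\<alpha> - lift (eps \<alpha>) = ext_i (hty \<alpha>) + (hty (ext_i \<alpha>) - d0 (eps (ext_i \<alpha>)))"
    by (rule trans[OF arg_cong[OF h, of "\<lambda>x. x - lift (eps \<alpha>)"]]) (simp add: lift_def eps_ext_i)
  moreover have "hty (ext_i \<alpha>) - d0 (eps (ext_i \<alpha>)) \<in> CA"
  proof (cases p)
    case 0
    then have "ext_i \<alpha> = 0" using assms(1) by (simp add: ext_homog_def ext_i_homog_0)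
    then show ?thesis by (simp add: free.subspace_0)
  next
    case (Suc p')
    then show ?thesis
      using ext_i_homog[of \<alpha> p' "Suc q"] assms by (intro hty_d0_eps) (auto simp: ext_homog_def)
  qed
  ultimately show ?thesis
    by (simp add: free.subspace_add[OF subspace_CAi] ext_i_CAi CA_sub_CAi)
qed

lemma tsy_cycles_surj:
  assumes "\<alpha> \<in> ext_homog p q" "ext_i \<alpha> \<in> CA"
  shows "\<exists>x\<in>homog form_deg p. form_b x \<in> N0 \<and> \<alpha> - tsy q x \<in> CAi"
  using assms
proof (induction q arbitrary: \<alpha>)
  case 0
  let ?x = "t_to 0 \<alpha>"
  have \<alpha>: "incl ?x = \<alpha>" using 0 by (simp add: ext_homog_def incl_t_to_zero)
  moreover have "?x \<in> homog form_deg p"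
    using 0 by (intro t_to_homog) (simp_all add: ext_homog_def free.subspace_0[OF subspace_homog])
  moreover have "form_b ?x \<in> N0" using 0 \<alpha> by (simp add: form_b_def lam_comm_sub)
  ultimately show ?case by (intro bexI[of _ ?x]) (auto simp: tsy_0 free.subspace_0)
next
  case (Suc q)
  have "ext_i (eps \<alpha>) \<in> CA" using eps_CA[OF Suc.prems(2)] by (simp add: eps_ext_i)
  from Suc.IH[OF eps_homog[OF Suc.prems(1)] this] obtain x
    where x: "x \<in> homog form_deg p" "form_b x \<in> N0" "eps \<alpha> - tsy q x \<in> CAi" by blast
  \<comment> \<open>Subtracting this value makes \<open>eps ?\<alpha>\<close> homologous to zero,
    because \<open>eps\<close> takes \<open>tsy (Suc q) x\<close> to \<open>tsy q x\<close>. Its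
    lift is then homologous to zero, and so is \<open>?\<alpha>\<close>.\<close>
  let ?\<alpha> = "\<alpha> - tsy (Suc q) x"
  have "?\<alpha> \<in> ext_homog p (Suc q)"
    by (intro free.subspace_diff[OF subspace_ext_homog] Suc.prems tsy_homog x)
  moreover have "ext_i ?\<alpha> \<in> CA"
  proof -
    have "ext_i (tsy (Suc q) x) \<in> CA"
      using free.subspace_add[OF subspaces(2) tsy_chain[OF x(1), of "Suc q"] tsy_N0[OF x(2), of "Suc (Suc q)"]]
      by simp
    then show ?thesis using Suc.prems by (simp add: free.subspace_diff)
  qed
  ultimately have "?\<alpha> - lift (eps ?\<alpha>) \<in> CAi" by (rule cycle_lift)
  moreover have "lift (eps ?\<alpha>) \<in> CAi"
    using x(3) by (intro lift_CAi) (simp add: eps_tsy)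
  ultimately have "?\<alpha> - lift (eps ?\<alpha>) + lift (eps ?\<alpha>) \<in> CAi"
    by (intro free.subspace_add[OF subspace_CAi])
  then show ?case using x by auto
qed

end

section \<open>Cyclic words\<close>

lemma fscale_of_nat: "fscale (of_nat n) f = of_nat n * f"
  by (simp add: fscale_def flip: of_nat_single single_of_nat)

text \<open>Supercommutators with a single letter span all supercommutators, by
  \<open>[x u, v] = [x, u v] \<plusminus> [u, v x]\<close>.\<close>

definition letter_comm :: "('g \<Rightarrow> nat) \<Rightarrow> 'g \<Rightarrow> 'g list \<Rightarrow> ('g, 'k::comm_ring_1) free_alg" where
  "letter_comm deg x w =
     monomial [x] * monomial w - (-1) ^ (deg x * word_deg deg w) * (monomial w * monomial [x])"

lemma supercommutator_words:
  fixes u v :: "'g list"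
  shows "monomial u * monomial v - (-1) ^ (word_deg deg u * word_deg deg v) * (monomial v * monomial u)
    \<in> (free.span {letter_comm deg x w | x w. True} :: ('g, 'k::comm_ring_1) free_alg set)"
proof (induction u arbitrary: v)
  case Nil
  then show ?case by (simp add: free.span_zero)
next
  case (Cons x u)
  let ?S = "free.span {letter_comm deg x w | x w. True} :: ('g, 'k) free_alg set"
  have 1: "letter_comm deg x (u @ v) \<in> ?S" by (rule free.span_base) auto
  have 2: "(-1) ^ n * f \<in> ?S" if "f \<in> ?S" for n f
    using that by (cases "even n") (auto intro: free.span_neg)
  have eq: "monomial (x # u) * monomial v - (-1) ^ (word_deg deg (x # u) * word_deg deg v) * (monomial v * monomial (x # u))
    = (letter_comm deg x (u @ v) + (-1) ^ (deg x * word_deg deg (u @ v)) *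
       (monomial u * monomial (v @ [x]) - (-1) ^ (word_deg deg u * word_deg deg (v @ [x])) *
         (monomial (v @ [x]) * monomial u)) :: ('g, 'k) free_alg)"
    unfolding letter_comm_def monomial_Cons[of x u] monomial_append
    by (cases "even (deg x)"; cases "even (word_deg deg u)"; cases "even (word_deg deg v)")
      (simp_all add: algebra_simps)
  show ?case unfolding eq by (rule free.span_add[OF 1 2[OF Cons]])
qed

lemma supercommutators_span:
  assumes "s \<in> supercommutators deg" shows "s \<in> free.span {letter_comm deg x w | x w. True}"
proof -
  from assms obtain f g m n where s: "s = f * g - (-1) ^ (m * n) * (g * f)"
    and f: "f \<in> homog deg m" and g: "g \<in> homog deg n"
    by (auto simp: supercommutators_def)
  have "monomial u * g - (-1) ^ (m * n) * (g * monomial u) \<in> free.span {letter_comm deg x w | x w. True}"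
    if "word_deg deg u = m" for u
  proof (rule homog_lin_memI[OF g, where \<phi> = "\<lambda>g. monomial u * g - (-1) ^ (m * n) * (g * monomial u)"])
    fix v assume "word_deg deg v = n"
    then show "monomial u * monomial v - (-1) ^ (m * n) * (monomial v * monomial u) \<in>
        free.span {letter_comm deg x w | x w. True}"
      using supercommutator_words[of u v deg] that by simp
  qed (auto intro!: lin_intros)
  then show ?thesis unfolding s
    by (intro homog_lin_memI[OF f, where \<phi> = "\<lambda>f. f * g - (-1) ^ (m * n) * (g * f)"])
      (auto intro!: lin_intros)
qed

context form_algebra
begin

lemma rot_I_left: assumes "u \<in> I" shows "rot u f \<in> I"
proof (rule lin_memI[OF lin_rot subspaces(1)])
  show "rot u (monomial w) \<in> I" for w
    using assms
  proof (induction w arbitrary: u)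
    case (Cons x w)
    then show ?case
      by (cases x rule: ext_gen_cases) (auto simp: ext_monomial_Cons I_mult_left I_mult_right mult.assoc)
  qed (simp add: I_zero)
qed

text \<open>The Leibniz rule prevents the image from lying in \<open>I\<close>: rotating
  \<open>da b v\<close> carries \<open>b\<close> to the front together with \<open>v\<close> instead
  of leaving it behind \<open>da\<close>, and a commutator with \<open>b\<close> repairs
  this.\<close>

lemma rot_I: assumes "f \<in> I" shows "rot u f \<in> CA"
proof (rule ext_left_recI[where \<phi> = rot, OF assms lin_rot subspaces(2)])
  fix u and a b c and v :: "('a, 'k) ext_free"
  have e: "x \<in> I \<Longrightarrow> rot (u * x) v \<in> CA" for x
    by (intro I_sub_CA rot_I_left I_mult_left)
  show "rot u ((ext_elt 1 - 1) * v) \<in> CA"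
    by (rule memI[OF e[OF I_rels(1)]]) (simp add: rot_left_simps algebra_simps)
  show "rot u ((ext_elt (a * b) - ext_elt a * ext_elt b) * v) \<in> CA"
    by (rule memI[OF e[OF I_rels(2)[of a b]]]) (simp add: rot_left_simps algebra_simps)
  show "rot u ((ext_elt (a + b) - (ext_elt a + ext_elt b)) * v) \<in> CA"
    by (rule memI[OF e[OF I_rels(3)[of a b]]]) (simp add: rot_left_simps algebra_simps)
  show "rot u ((ext_elt (scale c a) - fscale c (ext_elt a)) * v) \<in> CA"
    by (rule memI[OF e[OF I_rels(4)[of c a]]])
      (simp add: rot_left_simps algebra_simps fscale_mult_left fscale_mult_right)
  have d: "x \<in> I \<Longrightarrow> sg v * u * x \<in> CA" for x
    by (intro I_sub_CA I_mult_left)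
  show "rot u ((ext_dif (a + b) - (ext_dif a + ext_dif b)) * v) \<in> CA"
    by (rule memI[OF d[OF I_rels(5)[of a b]]]) (simp add: algebra_simps)
  show "rot u ((ext_dif (scale c a) - fscale c (ext_dif a)) * v) \<in> CA"
    by (rule memI[OF d[OF I_rels(6)[of c a]]]) (simp add: algebra_simps fscale_mult_left fscale_mult_right)
  show "rot u (ext_dif (scale c 1) * v) \<in> CA"
    by (rule memI[OF d[OF I_rels(7)[of c]]]) simp
  show "rot u ((ext_dif (a * b) - (ext_dif a * ext_elt b + ext_elt a * ext_dif b)) * v) \<in> CA"
    by (rule memI[OF free.subspace_diff[OF subspaces(2) d[OF I_rels(8)[of a b]]
            comm_CA[of b "sg v * u * ext_dif a"]]])
      (simp add: algebra_simps par_mult)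
next
  fix u a and g :: "('a, 'k) ext_free" assume g: "g \<in> I" "\<And>j. rot j g \<in> CA"
  show "rot u (ext_elt a * g) \<in> CA" by (simp add: g)
  show "rot u (ext_dif a * g) \<in> CA" by (simp add: g sg_I I_mult_right I_sub_CA)
  show "rot u (ext_t * g) \<in> CA" by (simp add: g I_mult_right I_sub_CA)
qed

lemma rot_CA:
  assumes "y \<in> CA" "y \<in> homog ext_wt (Suc n)" shows "rot 1 y \<in> CA"
proof (rule CA_homog_memI[OF assms, where m = 1])
  fix a and f :: "('a, 'k) ext_free" assume "f \<in> homog ext_wt (Suc n)"
  then show "rot 1 (ext_elt a * f - f * ext_elt a) \<in> CA"
    using rot_mult_elt[of f n 1 a] by (simp add: free.subspace_0)
next
  show "rot 1 (ext_t ^ k :: ('a, 'k) ext_free) \<in> CA" for k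
  proof (cases k)
    case (Suc j)
    have "(rot 1 (ext_t ^ k) :: ('a, 'k) ext_free) = ext_t ^ k" by (simp add: Suc power_commutes)
    then show ?thesis by (simp only: t_power_CA)
  qed (simp add: free.subspace_0)
qed (auto intro!: lin_intros rot_I)

lemma rot_power_homog:
  assumes "y \<in> homog deg n" "\<And>a. deg (Form (Elt a)) = 0" shows "(rot 1 ^^ k) y \<in> homog deg n"
  by (induction k) (auto intro!: rot_homog assms one_in_homog)

lemma rot_power_CA:
  assumes "y \<in> CA" "y \<in> homog ext_wt (Suc n)" shows "(rot 1 ^^ k) y \<in> CA"
proof (induction k)
  case (Suc k)
  have "(rot 1 ^^ k) y \<in> homog ext_wt (Suc n)" by (rule rot_power_homog[OF assms(2)]) simp
  with Suc show ?case by (auto intro: rot_CA)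
qed (simp add: assms)

lemma comm_weight_0_CA:
  fixes f :: "('a, 'k) ext_free"
  assumes "word_deg ext_wt u = 0" shows "monomial u * f - f * monomial u \<in> CA"
  using assms
proof (induction u arbitrary: f)
  case (Cons x u)
  then obtain a where x: "x = Form (Elt a)" by (cases x rule: ext_gen_cases) auto
  have "monomial u * (f * ext_elt a) - (f * ext_elt a) * monomial u \<in> CA"
    using Cons by simp
  from free.subspace_add[OF subspaces(2) comm_CA[of a "monomial u * f"] this] show ?case
    by (rule memI) (simp add: x ext_monomial_Cons algebra_simps)
qed (simp add: free.subspace_0)

text \<open>After one full turn all letters \<open>da\<close> and \<open>t\<close> are back in their
  order, and the signs cancel. Only the elements of \<open>A\<close> behind the last of these
  letters are found at the other end.\<close>

lemma rot_power_weight: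
  assumes "z \<in> homog ext_wt (Suc n)" shows "z - (rot 1 ^^ Suc n) z \<in> CA"
proof (rule homog_lin_memI[OF assms _ subspaces(2), where \<phi> = "\<lambda>z. z - (rot 1 ^^ Suc n) z"])
  fix w :: "'a ext_gen list" assume "word_deg ext_wt w = Suc n"
  from rot_power_word[OF this, of "[]"] obtain u1 u2 where u: "w = u1 @ u2"
    "word_deg ext_wt u2 = 0" "(rot 1 ^^ Suc n) (monomial w :: ('a, 'k) ext_free) = monomial (u2 @ u1)"
    by auto
  show "(monomial w :: ('a, 'k) ext_free) - (rot 1 ^^ Suc n) (monomial w) \<in> CA"
    unfolding u(3) 
    by (rule memI[OF free.subspace_neg[OF subspaces(2) comm_weight_0_CA[OF u(2), of "monomial u1"]]])
      (simp add: u(1) monomial_append)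
qed (intro lin_intros)

definition cyc_norm :: "nat \<Rightarrow> ('a, 'k) ext_free \<Rightarrow> ('a, 'k) ext_free" where
  "cyc_norm n f = (\<Sum>k<n. (rot 1 ^^ k) f)"

lemma lin_cyc_norm: "lin (cyc_norm n)"
  unfolding cyc_norm_def[abs_def] by (intro lin_intros)

lemma hpart_letter_comm:
  "hpart d n (letter_comm deg x w) = (if d x + word_deg d w = n then letter_comm deg x w else 0)"
  by (cases "even (deg x * word_deg deg w)")
    (simp_all add: letter_comm_def module_hom.diff[OF lin_hpart] module_hom.add[OF lin_hpart]
      hpart_monomial flip: monomial_append)

lemma DR_homog_memI:
  assumes "y \<in> DR" "y \<in> homog deg n" "lin \<phi>" "free.subspace M"
    and deg: "\<And>a. deg (Form (Elt a)) = 0" "\<And>a. deg (Form (Dif a)) = m"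
    and I: "\<And>x. x \<in> I \<Longrightarrow> x \<in> homog deg n \<Longrightarrow> \<phi> x \<in> M"
    and L: "\<And>x w. deg x + word_deg deg w = n \<Longrightarrow> \<phi> (letter_comm ext_form_deg x w) \<in> M"
    and t: "\<And>k. (ext_t ^ k :: ('a, 'k) ext_free) \<in> homog deg n \<Longrightarrow> \<phi> (ext_t ^ k) \<in> M"
  shows "\<phi> y \<in> M"
proof -
  have lin: "lin (\<lambda>y. \<phi> (hpart deg n y))" by (rule lin_compose[OF assms(3) lin_hpart])
  have "\<phi> (hpart deg n y) \<in> M"
  proof (rule lin_span_memI[OF assms(1)[unfolded reduced_DR_sub_def] lin assms(4)])
    fix s :: "('a, 'k) ext_free" assume "s \<in> I \<union> supercommutators ext_form_deg \<union> range ((^) ext_t)"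
    then consider "s \<in> I" | "s \<in> supercommutators ext_form_deg" | k where "s = ext_t ^ k"
      by blast
    then show "\<phi> (hpart deg n s) \<in> M"
    proof cases
      case 1
      then show ?thesis using I I_graded[of s deg m n] deg hpart_in_homog by blast
    next
      case 2
      show ?thesis
        by (rule lin_span_memI[OF supercommutators_span[OF 2] lin assms(4)])
          (auto simp: hpart_letter_comm L module_hom.zero[OF assms(3)] free.subspace_0[OF assms(4)])
    next
      case 3
      have "monomial (replicate k T) = (ext_t ^ k :: ('a, 'k) ext_free)"
        by (induction k) (auto simp: ext_monomial_Cons)
      then have "hpart deg n (ext_t ^ k :: ('a, 'k) ext_free) = ext_t ^ k \<or>
          hpart deg n (ext_t ^ k :: ('a, 'k) ext_free) = 0"
        using hpart_monomial[of deg n "replicate k T"] by metis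
      moreover have "(ext_t ^ k :: ('a, 'k) ext_free) \<in> homog deg n"
        if "hpart deg n (ext_t ^ k :: ('a, 'k) ext_free) = ext_t ^ k"
        using that by (simp add: homog_iff)
      ultimately show ?thesis using t
        by (auto simp: 3 module_hom.zero[OF assms(3)] free.subspace_0[OF assms(4)])
    qed
  qed
  then show ?thesis using assms(2) by (simp add: hpart_homog)
qed

lemma letter_comm_homog:
  fixes x :: "'g" and d deg :: "'g \<Rightarrow> nat"
  assumes "d x + word_deg d w = n" shows "letter_comm deg x w \<in> homog d n"
  using hpart_in_homog[of d n "letter_comm deg x w"] assms by (simp add: hpart_letter_comm)

lemma cyc_norm_CA:
  assumes "y \<in> CA" "y \<in> homog ext_wt (Suc n)" shows "cyc_norm m y \<in> CA"
  unfolding cyc_norm_def by (intro free.subspace_sum[OF subspaces(2)] rot_power_CA[OF assms])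

lemma cyc_norm_rot:
  assumes "z \<in> homog ext_wt (Suc n)" shows "cyc_norm (Suc n) (z - rot 1 z) \<in> CA"
proof -
  have "(rot 1 ^^ k) (z - rot 1 z) = (rot 1 ^^ k) z - (rot 1 ^^ Suc k) z" for k
    by (simp add: module_hom.diff[OF lin_funpow[OF lin_rot]] funpow_swap1)
  then have "cyc_norm (Suc n) (z - rot 1 z) = (\<Sum>k<Suc n. (rot 1 ^^ k) z - (rot 1 ^^ Suc k) z)"
    by (simp only: cyc_norm_def)
  also have "\<dots> = z - (rot 1 ^^ Suc n) z"
    using sum_lessThan_telescope'[of "\<lambda>k. (rot 1 ^^ k) z" "Suc n"] by simp
  finally show ?thesis using rot_power_weight[OF assms] by simp
qed

text \<open>The supercommutator with a letter \<open>da\<close> or \<open>t\<close> is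
  \<open>z - rot 1 z\<close>, on which the sum over a full turn telescopes. The commutator with an
  element of \<open>A\<close> is in \<open>CA\<close> to begin with.\<close>

lemma cyc_norm_DR:
  assumes "y \<in> DR" "y \<in> homog ext_wt (Suc n)" shows "cyc_norm (Suc n) y \<in> CA"
proof (rule DR_homog_memI[OF assms lin_cyc_norm subspaces(2), where m = 1])
  fix x :: "'a ext_gen" and w :: "'a ext_gen list" assume n: "ext_wt x + word_deg ext_wt w = Suc n"
  then have hom: "(letter_comm ext_form_deg x w :: ('a, 'k) ext_free) \<in> homog ext_wt (Suc n)"
    by (rule letter_comm_homog)
  have hom': "(monomial (x # w) :: ('a, 'k) ext_free) \<in> homog ext_wt (Suc n)"
    by (rule monomial_in_homog) (use n in simp)
  show "cyc_norm (Suc n) (letter_comm ext_form_deg x w) \<in> CA"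
  proof (cases x rule: ext_gen_cases)
    case (elt a)
    have "(letter_comm ext_form_deg x w :: ('a, 'k) ext_free) = ext_elt a * monomial w - monomial w * ext_elt a"
      by (simp add: elt letter_comm_def ext_gen_monomial)
    with cyc_norm_CA[OF comm_CA hom[unfolded this]] show ?thesis by simp
  next
    case (dif a)
    have "(letter_comm ext_form_deg x w :: ('a, 'k) ext_free) = monomial (x # w) - rot 1 (monomial (x # w))"
      by (simp add: dif letter_comm_def ext_gen_monomial ext_monomial_Cons mult.assoc)
    with cyc_norm_rot[OF hom'] show ?thesis by simp
  next
    case t
    have "(letter_comm ext_form_deg x w :: ('a, 'k) ext_free) = monomial (x # w) - rot 1 (monomial (x # w))"
      by (simp add: t letter_comm_def ext_gen_monomial ext_monomial_Cons mult.assoc)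
    with cyc_norm_rot[OF hom'] show ?thesis by simp
  qed
next
  fix k :: nat assume "(ext_t ^ k :: ('a, 'k) ext_free) \<in> homog ext_wt (Suc n)"
  then show "cyc_norm (Suc n) (ext_t ^ k) \<in> CA" by (rule cyc_norm_CA[OF t_power_CA])
next
  fix x assume "x \<in> I" "x \<in> homog ext_wt (Suc n)"
  then show "cyc_norm (Suc n) x \<in> CA" by (intro cyc_norm_CA I_sub_CA)
qed auto

text \<open>The maps differ only in how they treat the first letter if it is \<open>da\<close>.
  Replaced by \<open>a t - t a\<close> before or after the rotation, it contributes terms whose
  difference is the commutator of \<open>a\<close> with \<open>w u t\<close>.\<close>

lemma rot_ext_i:
  assumes "ext_i u = 0" "sg u = u" shows "ext_i (rot u f) - rot u (ext_i f) \<in> CA"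
proof (rule lin_memI[where f = "\<lambda>f. ext_i (rot u f) - rot u (ext_i f)", OF _ subspaces(2)])
  show "ext_i (rot u (monomial w)) - rot u (ext_i (monomial w)) \<in> CA" for w
    using assms
  proof (induction w arbitrary: u)
    case (Cons x w)
    show ?case
    proof (cases x rule: ext_gen_cases)
      case (elt a)
      then show ?thesis using Cons by (simp add: ext_monomial_Cons ext_i_mult par_mult)
    next
      case (dif a)
      have "ext_i (rot u (monomial (x # w))) - rot u (ext_i (monomial (x # w))) =
          ext_elt a * (monomial w * u * ext_t) - (monomial w * u * ext_t) * ext_elt a"
        using Cons.prems
        by (simp only: dif ext_monomial_Cons rot_step ext_i_step ext_i_mult par_mult par_par
            sg_ext_i ext_gen_images par_gen rot_lin_simps mult_1_left)
          (simp add: algebra_simps sg_ext_i)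
      then show ?thesis by (simp only: comm_CA)
    next
      case t
      then show ?thesis using Cons.prems by (simp add: ext_monomial_Cons ext_i_mult free.subspace_0)
    qed
  qed (simp add: free.subspace_0)
qed (intro lin_intros)

lemma ext_i_homog_wt:
  assumes "f \<in> ext_homog p q" shows "ext_i f \<in> homog ext_wt (p + q)"
proof (cases p)
  case 0
  then show ?thesis using assms by (simp add: ext_homog_def ext_i_homog_0 free.subspace_0[OF subspace_homog])
next
  case (Suc p')
  have "ext_homog a b \<subseteq> homog ext_wt (a + b)" for a b
    by (auto simp: ext_homog_def homog_def word_deg_ext_wt)
  then show ?thesis using ext_i_homog assms Suc by fastforce
qed

lemma ext_homog_wt: "f \<in> ext_homog p q \<Longrightarrow> f \<in> homog ext_wt (p + q)"
  by (auto simp: ext_homog_def homog_def word_deg_ext_wt)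

lemma cyc_norm_homog: "f \<in> ext_homog p q \<Longrightarrow> cyc_norm n f \<in> ext_homog p q"
  unfolding cyc_norm_def
  by (rule free.subspace_sum[OF subspace_ext_homog]) (auto simp: ext_homog_def intro: rot_power_homog)

lemma ext_i_cyc_norm:
  assumes "f \<in> ext_homog p q" "p + q = Suc n" shows "ext_i (cyc_norm m f) - cyc_norm m (ext_i f) \<in> CA"
proof -
  have "ext_i ((rot 1 ^^ k) f) - (rot 1 ^^ k) (ext_i f) \<in> CA" for k
  proof (induction k)
    case (Suc k)
    let ?c = "ext_i ((rot 1 ^^ k) f) - (rot 1 ^^ k) (ext_i f)"
    have "(rot 1 ^^ k) f \<in> ext_homog p q"
      using assms(1) by (auto simp: ext_homog_def intro: rot_power_homog)
    then have "?c \<in> homog ext_wt (Suc n)"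
      using ext_i_homog_wt[OF assms(1)] ext_i_homog_wt assms(2)
      by (intro free.subspace_diff[OF subspace_homog] rot_power_homog) fastforce+
    then have "rot 1 ?c \<in> CA" using Suc rot_CA by blast
    from free.subspace_add[OF subspaces(2) rot_ext_i[of 1 "(rot 1 ^^ k) f"] this]
    show ?case by simp
  qed (simp add: free.subspace_0)
  then have "(\<Sum>k<m. ext_i ((rot 1 ^^ k) f) - (rot 1 ^^ k) (ext_i f)) \<in> CA"
    by (intro free.subspace_sum[OF subspaces(2)])
  then show ?thesis
    by (simp add: cyc_norm_def module_hom.sum[OF lin_ext_i] sum_subtractf)
qed

lemma I_sub_DR: "x \<in> I \<Longrightarrow> x \<in> DR"
  and t_power_DR: "ext_t ^ n \<in> DR"
  and super_DR: "f \<in> homog ext_form_deg m \<Longrightarrow> g \<in> homog ext_form_deg k \<Longrightarrow>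
    f * g - (-1) ^ (m * k) * (g * f) \<in> DR"
  by (auto simp: reduced_DR_sub_def supercommutators_def intro!: free.span_base)

lemma comm_DR:
  assumes "u \<in> homog ext_form_deg 0" shows "u * f - f * u \<in> DR"
proof (rule lin_memI[where f = "\<lambda>f. u * f - f * u", OF _ subspaces(3)])
  show "u * monomial w - monomial w * u \<in> DR" for w
    using super_DR[OF assms monomial_in_homog[OF refl, where w = w]] by simp
qed (intro lin_intros)

lemma CA_sub_DR: "x \<in> CA \<Longrightarrow> x \<in> DR"
  unfolding comm_sub_def
  by (erule lin_span_memI[where f = "\<lambda>x. x"])
    (auto intro: lin_id I_sub_DR t_power_DR comm_DR simp: ext_elt_def monomial_in_homog)

lemma rot_DR:
  assumes "u \<in> homog ext_form_deg 0" "f \<in> homog ext_wt (Suc n)" shows "rot u f - u * f \<in> DR"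
proof (rule homog_lin_memI[OF assms(2) _ subspaces(3), where \<phi> = "\<lambda>f. rot u f - u * f"])
  show "rot u (monomial w) - u * monomial w \<in> DR" if "word_deg ext_wt w = Suc n" for w
    using that assms(1)
  proof (induction w arbitrary: u)
    case (Cons x w)
    have w: "(monomial w :: ('a, 'k) ext_free) \<in> homog ext_form_deg (word_deg ext_form_deg w)"
      by (simp add: monomial_in_homog)
    show ?case
    proof (cases x rule: ext_gen_cases)
      case (elt a)
      have "u * ext_elt a \<in> homog ext_form_deg 0"
        using homog_mult[OF Cons.prems(2), of "ext_elt a" 0] by (simp add: ext_elt_def monomial_in_homog)
      from Cons.IH[OF _ this] show ?thesis using Cons.prems elt
        by (simp add: ext_monomial_Cons mult.assoc)
    next
      case (dif a)
      have "u * ext_dif a \<in> homog ext_form_deg 1"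
        using homog_mult[OF Cons.prems(2), of "ext_dif a" 1] by (simp add: ext_dif_def monomial_in_homog)
      from free.subspace_neg[OF subspaces(3) super_DR[OF this w]] show ?thesis
        by (simp add: dif ext_monomial_Cons mult.assoc)
    next
      case t
      have "u * ext_t \<in> homog ext_form_deg 0"
        using homog_mult[OF Cons.prems(2), of "ext_t" 0] by (simp add: ext_t_def monomial_in_homog)
      from free.subspace_neg[OF subspaces(3) super_DR[OF this w]] show ?thesis
        by (simp add: t ext_monomial_Cons mult.assoc)
    qed
  qed simp
qed (intro lin_intros)

lemma cyc_norm_cong_DR:
  assumes "f \<in> homog ext_wt (Suc n)" shows "cyc_norm m f - of_nat m * f \<in> DR"
proof -
  have "(rot 1 ^^ k) f - f \<in> DR" for k
  proof (induction k)
    case (Suc k)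
    have "(rot 1 ^^ k) f \<in> homog ext_wt (Suc n)" by (rule rot_power_homog[OF assms]) simp
    from free.subspace_add[OF subspaces(3) rot_DR[OF one_in_homog this] Suc] show ?case by simp
  qed (simp add: free.subspace_0)
  then have "(\<Sum>k<m. (rot 1 ^^ k) f - f) \<in> DR"
    by (intro free.subspace_sum[OF subspaces(3)])
  then show ?thesis by (simp add: cyc_norm_def sum_subtractf)
qed

definition DRi :: "('a, 'k) ext_free set" where
  "DRi = add_image DR ext_i"

lemma subspace_DRi [simp]: "free.subspace DRi"
  by (simp add: DRi_def add_image_def)

lemma DR_sub_DRi: "x \<in> DR \<Longrightarrow> x \<in> DRi" and ext_i_DRi: "ext_i x \<in> DRi"
  by (auto simp: DRi_def add_image_def intro: free.span_base)

lemma CAi_sub_DRi: "x \<in> CAi \<Longrightarrow> x \<in> DRi"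
  unfolding CAi_def
  by (erule lin_span_memI[where f = "\<lambda>x. x"]) (auto intro: lin_id DR_sub_DRi CA_sub_DR ext_i_DRi)

text \<open>The sum of all rotations turns a cycle modulo supercommutators into a cycle modulo commutators
  with elements of \<open>A\<close>, and is multiplication by \<open>p + q\<close> modulo supercommutators. The maximum covers
  the junk case of bidegree \<open>(0, 0)\<close>, where there is nothing to rotate.\<close>

lemma DR_cycles_surj:
  assumes f: "f \<in> ext_homog p q" "ext_i f \<in> DR"
  shows "\<exists>x\<in>homog form_deg p. form_b x \<in> N0 \<and> of_nat (max 1 (p + q)) * f - tsy q x \<in> DRi"
proof (cases "p + q")
  case 0
  let ?x = "t_to 0 f"
  have x: "?x \<in> homog form_deg 0"
    using f 0 by (intro t_to_homog) (simp_all add: ext_homog_def free.subspace_0[OF subspace_homog])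
  moreover have "f - tsy q ?x = 0"
    using f 0 by (simp add: tsy_0 ext_homog_def incl_t_to_zero)
  ultimately show ?thesis using 0
    by (intro bexI[of _ ?x]) (auto simp: form_b_homog_0 free.subspace_0)
next
  case (Suc n)
  let ?\<alpha> = "cyc_norm (Suc n) f"
  have wt: "f \<in> homog ext_wt (Suc n)" "ext_i f \<in> homog ext_wt (Suc n)"
    using ext_homog_wt[OF f(1)] ext_i_homog_wt[OF f(1)] Suc by simp_all
  have "ext_i ?\<alpha> \<in> CA"
    using free.subspace_add[OF subspaces(2) ext_i_cyc_norm[OF f(1) Suc, of "Suc n"]
        cyc_norm_DR[OF f(2) wt(2)]] by simp
  from tsy_cycles_surj[OF cyc_norm_homog[OF f(1)] this] obtain x
    where x: "x \<in> homog form_deg p" "form_b x \<in> N0" "?\<alpha> - tsy q x \<in> CAi" by blast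
  have "(?\<alpha> - tsy q x) - (?\<alpha> - of_nat (Suc n) * f) \<in> DRi"
    by (intro free.subspace_diff[OF subspace_DRi] CAi_sub_DRi x DR_sub_DRi cyc_norm_cong_DR[OF wt(1)])
  then show ?thesis using x Suc by (intro bexI[of _ x]) auto
qed

end

section \<open>The Karoubi operator and injectivity\<close>

locale rational_form_algebra = form_algebra scale + Q: unital_algebra qscale
  for scale :: "'k::comm_ring_1 \<Rightarrow> 'a::ring_1 \<Rightarrow> 'a" and qscale :: "rat \<Rightarrow> 'k \<Rightarrow> 'k"
begin

lemma qscale_mult: "qscale (a * b) 1 = qscale a 1 * qscale b 1"
proof -
  have "qscale (a * b) 1 = qscale a (qscale b 1)" by simp
  also have "\<dots> = qscale a (1 * qscale b 1)" by simp
  also have "\<dots> = qscale a 1 * qscale b 1" by (rule Q.scale_mult_left)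
  finally show ?thesis .
qed

lemma qscale_of_nat: "qscale (of_nat n) 1 = of_nat n"
  by (induction n) (simp_all add: Q.scale_left_distrib)

lemma fscale_inverse:
  fixes x :: "('g, 'k) free_alg"
  assumes "n > 0" shows "fscale (qscale (1 / of_nat n) 1) (of_nat n * x) = x"
proof -
  have "qscale (1 / of_nat n) 1 * of_nat n = (1 :: 'k)"
    using qscale_mult[of "1 / of_nat n" "of_nat n"] assms by (simp add: qscale_of_nat)
  then show ?thesis by (simp flip: fscale_of_nat)
qed

lemma divide_mem:
  fixes x :: "('g, 'k) free_alg"
  assumes "free.subspace N" "n > 0" "of_nat n * x \<in> N" shows "x \<in> N"
  using free.subspace_scale[OF assms(1,3), of "qscale (1 / of_nat n) 1"] by (simp add: fscale_inverse assms)

end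

lemma karoubi_identity:
  "form_b (form_d (f * dif a)) + form_d (form_b (f * dif a)) = f * dif a - dif a * sg0 f"
  by (simp add: form_b_mult_dif form_d_mult sg0_form_d algebra_simps par_mult)

text \<open>Taking the homotopy formula as the definition gives a lift of \<open>\<kappa>\<close> in
  every degree, which commutes with \<open>d\<close> exactly and with \<open>b\<close> modulo
  \<open>I0\<close>.\<close>

definition kap :: "('a, 'k::comm_ring_1) form_free \<Rightarrow> ('a, 'k) form_free" where
  "kap x = x - form_b (form_d x) - form_d (form_b x)"

lemma lin_kap [lin_intros]: "lin kap"
  unfolding kap_def[abs_def] by (intro lin_intros)

lemmas kap_lin_simps [simp] = module_hom.add[OF lin_kap] module_hom.diff[OF lin_kap]
  module_hom.neg[OF lin_kap] module_hom.zero[OF lin_kap] module_hom.scale[OF lin_kap]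

lemma kap_mult_dif [simp]: "kap (f * dif a) = dif a * sg0 f"
  using karoubi_identity[of f a] by (simp add: kap_def algebra_simps)

lemma form_d_kap: "form_d (kap x) = kap (form_d x)"
  by (simp add: kap_def)

lemma form_d_kap_power: "form_d ((kap ^^ i) x) = (kap ^^ i) (form_d x)"
  by (induction i) (simp_all add: form_d_kap)

lemma kap_power_neg_one: "(kap ^^ i) ((-1) ^ n * x) = (-1) ^ n * (kap ^^ i) x"
  using module_hom.neg[OF lin_funpow[OF lin_kap], of i x] by (cases "even n") auto

lemma kap_power_pd:
  fixes u :: "('a, 'k::comm_ring_1) form_free"
  assumes "u \<in> homog form_deg m"
  shows "(kap ^^ length as) (u * pd as) = (-1) ^ (length as * m) * (pd as * u)"
  using assms
proof (induction as arbitrary: u m rule: rev_induct)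
  case (snoc a as)
  let ?j = "length as"
  have "u * pd as \<in> homog form_deg (m + ?j)" by (intro homog_mult snoc.prems pd_homog)
  then have "kap (u * pd (as @ [a])) = (-1) ^ (m + ?j) * (dif a * u * pd as)"
    using kap_mult_dif[of "u * pd as" a]
    by (cases "even (m + ?j)") (simp_all add: par_homog mult.assoc)
  moreover have "(kap ^^ ?j) (dif a * u * pd as) = (-1) ^ (?j * (1 + m)) * (pd as * (dif a * u))"
    by (rule snoc.IH) (intro homog_mult snoc.prems dif_homog)
  ultimately have "(kap ^^ length (as @ [a])) (u * pd (as @ [a])) =
      (-1) ^ (m + ?j) * ((-1) ^ (?j * (1 + m)) * (pd as * (dif a * u)))"
    by (simp add: funpow_Suc_right kap_power_neg_one del: funpow.simps)
  also have "\<dots> = (-1) ^ (length (as @ [a]) * m) * (pd (as @ [a]) * u)"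
    by (cases "even ?j"; cases "even m") (simp_all add: mult.assoc)
  finally show ?case .
qed simp

lemma kap_homog:
  assumes "x \<in> homog form_deg n" shows "kap x \<in> homog form_deg n"
proof -
  have "form_d (form_b x) \<in> homog form_deg n"
  proof (cases n)
    case 0
    then show ?thesis using assms by (simp add: form_b_homog_0 free.subspace_0[OF subspace_homog])
  next
    case (Suc m)
    then show ?thesis using form_d_homog[OF form_b_homog, of x m] assms by simp
  qed
  then show ?thesis
    unfolding kap_def by (intro free.subspace_diff[OF subspace_homog] assms form_b_homog form_d_homog)
qed

lemma kap_power_homog: "x \<in> homog form_deg n \<Longrightarrow> (kap ^^ i) x \<in> homog form_deg n"
  by (induction i) (auto intro: kap_homog)

section \<open>The Connes operator\<close>

definition form_B :: "('a, 'k::comm_ring_1) form_free \<Rightarrow> ('a, 'k) form_free" where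
  "form_B = lin_ext (\<lambda>w. \<Sum>i\<le>word_deg form_deg w. (kap ^^ i) (form_d (monomial w)))"

lemma lin_form_B [lin_intros]: "lin form_B"
  unfolding form_B_def by (rule lin_intros)

lemmas form_B_lin_simps [simp] = module_hom.add[OF lin_form_B] module_hom.diff[OF lin_form_B]
  module_hom.neg[OF lin_form_B] module_hom.zero[OF lin_form_B] module_hom.scale[OF lin_form_B]

lemma form_B_homog:
  assumes "x \<in> homog form_deg n" shows "form_B x = (\<Sum>i\<le>n. (kap ^^ i) (form_d x))"
  by (rule homog_lin_eqI[OF assms lin_form_B])
    (auto intro!: lin_sum lin_compose[OF lin_funpow[OF lin_kap] lin_form_d] simp: form_B_def)

lemma form_B_in_homog:
  assumes "x \<in> homog form_deg n" shows "form_B x \<in> homog form_deg (Suc n)"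
  unfolding form_B_homog[OF assms]
  by (intro free.subspace_sum[OF subspace_homog] kap_power_homog form_d_homog assms)

lemma form_d_form_B [simp]: "form_d (form_B x) = 0"
  by (rule lin_eqI[where f = "\<lambda>x. form_d (form_B x)" and g = "\<lambda>_. 0"])
    (auto intro!: lin_compose[OF lin_form_d lin_form_B] lin_zero
      simp: form_B_homog[OF monomial_in_homog[OF refl]] module_hom.sum[OF lin_form_d] form_d_kap_power module_hom.zero[OF lin_funpow[OF lin_kap]])

lemma form_B_form_B: assumes "x \<in> homog form_deg n" shows "form_B (form_B x) = 0"
  using form_B_homog[OF form_B_in_homog[OF assms]]
  by (simp add: module_hom.zero[OF lin_funpow[OF lin_kap]])

lemma hpart_one: "hpart deg n 1 = (if n = 0 then 1 else 0)"
  unfolding monomial_Nil[symmetric] hpart_monomial by simp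

lemma hpart_form_d:
  "hpart form_deg 0 (form_d x) = 0" "hpart form_deg (Suc n) (form_d x) = form_d (hpart form_deg n x)"
proof -
  have z: "hpart form_deg m (form_d (monomial w)) = 
      (if word_deg form_deg w + 1 = m then form_d (monomial w) else 0)" for m w
  proof -
    have h: "form_d (monomial w) \<in> homog form_deg (word_deg form_deg w + 1)"
      using form_d_homog[OF monomial_in_homog[OF refl]] by simp
    show ?thesis
    proof (cases "word_deg form_deg w + 1 = m")
      case True
      then show ?thesis using hpart_homog[OF h] by simp
    next
      case False
      have "hpart form_deg m (form_d (monomial w)) = 0"
        by (rule homog_lin_eqI[OF h lin_hpart lin_zero]) (use False in \<open>simp add: hpart_monomial\<close>)
      then show ?thesis using False by simp
    qed
  qed
  show "hpart form_deg 0 (form_d x) = 0"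
    by (rule lin_eqI[where f = "\<lambda>x. hpart form_deg 0 (form_d x)" and g = "\<lambda>_. 0"])
      (auto intro!: lin_intros simp: z)
  show "hpart form_deg (Suc n) (form_d x) = form_d (hpart form_deg n x)"
    by (rule lin_eqI[where f = "\<lambda>x. hpart form_deg (Suc n) (form_d x)"])
      (auto intro!: lin_intros simp: z hpart_monomial)
qed

lemma hpart_form_b: "hpart form_deg n (form_b x) = form_b (hpart form_deg (Suc n) x)"
proof (rule lin_eqI[where f = "\<lambda>x. hpart form_deg n (form_b x)"])
  fix w
  show "hpart form_deg n (form_b (monomial w)) = form_b (hpart form_deg (Suc n) (monomial w))"
  proof (cases "word_deg form_deg w")
    case 0
    then show ?thesis
      by (simp add: hpart_monomial form_b_homog_0 monomial_in_homog module_hom.zero[OF lin_hpart])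
  next
    case (Suc m)
    then have h: "form_b (monomial w) \<in> homog form_deg m"
      by (intro form_b_homog monomial_in_homog)
    show ?thesis
    proof (cases "m = n")
      case True
      then show ?thesis using hpart_homog[OF h] Suc by (simp add: hpart_monomial)
    next
      case False
      have "hpart form_deg n (form_b (monomial w)) = 0"
        by (rule homog_lin_eqI[OF h lin_hpart lin_zero]) (use False in \<open>simp add: hpart_monomial\<close>)
      then show ?thesis using False Suc by (simp add: hpart_monomial)
    qed
  qed
qed (auto intro!: lin_intros)

lemma add_imageD:
  assumes "x \<in> add_image N \<delta>" "free.subspace N" "lin \<delta>" obtains y z where "y \<in> N" "x = y + \<delta> z"
proof -
  have "\<exists>y\<in>N. \<exists>z. x = y + \<delta> z"
    using assms(1) unfolding add_image_def
  proof (induction rule: free.span_induct_alt)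
    case base
    show ?case by (intro bexI[of _ 0] exI[of _ 0])
      (auto simp: module_hom.zero[OF assms(3)] free.subspace_0[OF assms(2)])
  next
    case (step c s x)
    then obtain y z where yz: "y \<in> N" "x = y + \<delta> z" by blast
    from step(1) consider "s \<in> N" | w where "s = \<delta> w" by blast
    then show ?case
    proof cases
      case 1
      then show ?thesis using yz
        by (intro bexI[of _ "fscale c s + y"] exI[of _ z])
          (auto intro: free.subspace_add[OF assms(2)] free.subspace_scale[OF assms(2)])
    next
      case 2
      then show ?thesis using yz
        by (intro bexI[of _ y] exI[of _ "fscale c w + z"])
          (auto simp: module_hom.add[OF assms(3)] module_hom.scale[OF assms(3)])
    qed
  qed
  then show ?thesis using that by blast
qed

lemma subspace_add_image [simp]: "free.subspace (add_image N \<delta>)"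
  by (simp add: add_image_def)

lemma add_image_base: "x \<in> N \<Longrightarrow> x \<in> add_image N \<delta>" and add_image_range: "\<delta> x \<in> add_image N \<delta>"
  by (auto simp: add_image_def intro: free.span_base)

lemma lin_add_image:
  assumes "x \<in> add_image N \<delta>" "lin f" "free.subspace M" "\<And>y. y \<in> N \<Longrightarrow> f y \<in> M" "\<And>y. f (\<delta> y) \<in> M"
  shows "f x \<in> M"
  by (rule lin_span_memI[OF assms(1)[unfolded add_image_def] assms(2,3)]) (use assms(4,5) in auto)

context form_algebra
begin

lemma form_rels_homog: assumes "r \<in> form_rels scale elt dif" shows "\<exists>m. r \<in> homog form_deg m"
proof -
  have "elt a * elt b \<in> homog form_deg 0" "dif a * elt b \<in> homog form_deg 1"
    "elt a * dif b \<in> homog form_deg 1" for a b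
    using homog_mult[OF elt_homog[of a] elt_homog[of b]] homog_mult[OF dif_homog[of a] elt_homog[of b]]
      homog_mult[OF elt_homog[of a] dif_homog[of b]] by auto
  note homs = free.subspace_diff[OF subspace_homog] free.subspace_add[OF subspace_homog]
    free.subspace_scale[OF subspace_homog] elt_homog dif_homog one_in_homog this
  show ?thesis
    using assms by (rule form_rels_cases) (rule exI, (rule homs)+)+
qed

lemma I0_graded: "x \<in> I0 \<Longrightarrow> hpart form_deg n x \<in> I0"
  unfolding form_ideal_def by (erule hpart_ideal) (rule form_rels_homog)

lemma hpart_N0: assumes "x \<in> N0" shows "hpart form_deg n x \<in> N0"
  by (rule lin_span_memI[OF assms[unfolded reduced_form_sub_def] lin_hpart subspaces0(2)])
    (auto simp: hpart_one one_in_N0 free.subspace_0 intro: I0_sub_N0 I0_graded)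

lemma kap_I0: "x \<in> I0 \<Longrightarrow> kap x \<in> I0"
  unfolding kap_def by (intro I0_diff form_b_I0 form_d_I0)

lemma kap_power_I0: "x \<in> I0 \<Longrightarrow> (kap ^^ i) x \<in> I0"
  by (induction i) (auto intro: kap_I0)

lemma form_b_form_b: assumes "x \<in> homog form_deg n" shows "form_b (form_b x) \<in> I0"
proof (rule form_normal_memI[OF assms, where f = "\<lambda>x. form_b (form_b x)"])
  fix a and as :: "'a list"
  show "form_b (form_b (elt a * pd as)) \<in> I0"
  proof (cases as rule: rev_cases)
    case Nil
    then show ?thesis by (simp add: form_b_homog_0[OF elt_homog] I0_zero)
  next
    case (snoc bs e)
    let ?f = "sg0 (elt a * pd bs) :: ('a, 'k) form_free"
    have 1: "(form_b (elt a * pd as) :: ('a, 'k) form_free) = ?f * elt e - elt e * ?f"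
      using form_b_mult_dif[of "elt a * pd bs" e] by (simp add: snoc mult.assoc)
    show ?thesis
    proof (cases bs rule: rev_cases)
      case Nil
      have "(elt a * elt e :: ('a, 'k) form_free) \<in> homog form_deg 0"
        "(elt e * elt a :: ('a, 'k) form_free) \<in> homog form_deg 0"
        using homog_mult[OF elt_homog[of a] elt_homog[of e]] homog_mult[OF elt_homog[of e] elt_homog[of a]]
        by auto
      then have "?f * elt e - elt e * ?f \<in> homog form_deg 0"
        using Nil by (simp add: free.subspace_diff[OF subspace_homog])
      then show ?thesis unfolding 1 by (simp only: form_b_homog_0 I0_zero)
    next
      case (snoc cs c)
      let ?g = "elt a * pd cs :: ('a, 'k) form_free"
      have f: "?f = - (sg0 ?g * dif c)" by (simp add: snoc par_mult mult.assoc)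
      \<comment> \<open>Rewriting \<open>dc e\<close> as \<open>d(ce) - c de\<close> puts a
        differential at the end of every term, so that the formula for \<open>form_b\<close> applies
        a second time.\<close>
      have "?f * elt e - elt e * ?f = sg0 ?g * elt c * dif e - sg0 ?g * dif (c * e) + elt e * sg0 ?g * dif c
          + sg0 ?g * (dif (c * e) - (dif c * elt e + elt c * dif e))"
        unfolding f by (simp add: algebra_simps)
      then have "form_b (form_b (elt a * pd as)) = form_b (sg0 ?g * elt c * dif e) - form_b (sg0 ?g * dif (c * e)) 
          + form_b (elt e * sg0 ?g * dif c) + form_b (sg0 ?g * (dif (c * e) - (dif c * elt e + elt c * dif e)))"
        unfolding 1 by simp
      also have "\<dots> = (elt (c * e) - elt c * elt e) * ?g - ?g * (elt (c * e) - elt c * elt e)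
          + form_b (sg0 ?g * (dif (c * e) - (dif c * elt e + elt c * dif e)))"
        unfolding form_b_mult_dif by (simp add: par_mult[of _ _ "elt _"] par_mult[of _ "elt _" "sg0 _"] del: sg0_pd)
          (simp add: algebra_simps)
      also have "\<dots> \<in> I0"
        by (intro I0_add I0_diff I0_mult_right I0_mult_left form_b_I0 I0_rels)
      finally show ?thesis .
    qed
  qed
qed (auto intro!: lin_intros form_b_I0)

lemma kap_form_b:
  assumes "x \<in> homog form_deg n" shows "form_b (kap x) - kap (form_b x) \<in> I0"
proof -
  have "form_b (kap x) - kap (form_b x) = form_d (form_b (form_b x)) - form_b (form_b (form_d x))"
    by (simp add: kap_def)
  then show ?thesis
    using form_b_form_b[OF assms] form_b_form_b[OF form_d_homog[OF assms]] by (simp add: I0_diff form_d_I0)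
qed

lemma kap_power_form_b:
  assumes "x \<in> homog form_deg n" shows "form_b ((kap ^^ i) x) - (kap ^^ i) (form_b x) \<in> I0"
proof (induction i)
  case (Suc i)
  from I0_add[OF kap_form_b[OF kap_power_homog[OF assms, of i]] kap_I0[OF Suc]]
  show ?case by simp
qed (simp add: I0_zero)

text \<open>Applying \<open>kap\<close> \<open>n\<close> times to
  \<open>da\<^sub>0 da\<^sub>1 ... da\<^sub>n\<close> moves the last \<open>n\<close> differentials
  to the front; \<open>b\<close> then returns the commutator of
  \<open>da\<^sub>1 ... da\<^sub>n\<close> with \<open>a\<^sub>0\<close>. The same power of
  \<open>kap\<close> sends \<open>a\<^sub>0 da\<^sub>1 ... da\<^sub>n\<close> to the first half of
  that commutator.\<close>

lemma form_b_kap_power_form_d: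
  assumes "x \<in> homog form_deg n" shows "form_b ((kap ^^ n) (form_d x)) - ((kap ^^ n) x - x) \<in> I0"
proof (rule form_normal_cong[OF assms])
  fix a and as :: "'a list" assume n: "length as = n"
  have "(kap ^^ n) (elt a * pd as :: ('a, 'k) form_free) = pd as * elt a"
    using kap_power_pd[OF elt_homog, of as a] n by simp
  moreover have *: "(kap ^^ n) ((dif a :: ('a, 'k) form_free) * pd as) = (-1) ^ n * (pd as * dif a)"
    using kap_power_pd[OF dif_homog, of as a] n by simp
  moreover have "form_b ((kap ^^ n) (form_d (elt a * pd as) :: ('a, 'k) form_free)) = pd as * elt a - elt a * pd as"
    using * by (cases "even n") (simp_all add: form_b_mult_dif n)
  ultimately show "form_b ((kap ^^ n) (form_d (elt a * pd as))) -
      ((kap ^^ n) (elt a * pd as) - elt a * pd as) \<in> I0"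
    by (simp add: I0_zero)
qed (auto intro!: lin_compose_form_b lin_compose[OF lin_funpow[OF lin_kap] lin_form_d] lin_minus
    lin_funpow lin_kap lin_id form_b_I0 kap_power_I0 form_d_I0 I0_diff)

lemma kap_telescope: "(\<Sum>i<n. (kap ^^ i) (x - kap x)) = x - (kap ^^ n) x"
proof -
  have "(kap ^^ i) (x - kap x) = (kap ^^ i) x - (kap ^^ Suc i) x" for i
    by (simp add: module_hom.diff[OF lin_funpow[OF lin_kap]] funpow_swap1)
  then have "(\<Sum>i<n. (kap ^^ i) (x - kap x)) = (\<Sum>i<n. (kap ^^ i) x - (kap ^^ Suc i) x)"
    by (simp only:)
  also have "\<dots> = x - (kap ^^ n) x"
    using sum_lessThan_telescope'[of "\<lambda>i. (kap ^^ i) x" n] by simp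
  finally show ?thesis .
qed

text \<open>The sum in \<open>b B\<close> has one term more than the sum in \<open>B b\<close>.
  Pairing the others gives the sum of \<open>kap^i (1 - kap)\<close> over \<open>i < n\<close>,
  which telescopes to \<open>1 - kap^n\<close>; the unpaired term \<open>b kap^n d\<close> is its
  negative modulo \<open>I0\<close>.\<close>

lemma form_b_form_B:
  assumes x: "x \<in> homog form_deg n" shows "form_b (form_B x) + form_B (form_b x) \<in> I0"
proof -
  have 1: "form_b (form_B x) = (\<Sum>i<n. form_b ((kap ^^ i) (form_d x))) + form_b ((kap ^^ n) (form_d x))"
    by (simp add: form_B_homog[OF x] module_hom.sum[OF lin_form_b] flip: lessThan_Suc_atMost)
  have 2: "form_B (form_b x) = (\<Sum>i<n. (kap ^^ i) (form_d (form_b x)))"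
  proof (cases n)
    case 0
    then show ?thesis using x by (simp add: form_b_homog_0)
  next
    case (Suc m)
    then show ?thesis
      using form_B_homog[OF form_b_homog, of x m] x by (simp only: lessThan_Suc_atMost)
  qed
  have "form_b (form_B x) + form_B (form_b x) =
      (\<Sum>i<n. form_b ((kap ^^ i) (form_d x)) - (kap ^^ i) (form_b (form_d x)))
      + (\<Sum>i<n. (kap ^^ i) (x - kap x)) + form_b ((kap ^^ n) (form_d x))"
    unfolding 1 2 by (simp add: kap_def module_hom.diff[OF lin_funpow[OF lin_kap]]
        module_hom.add[OF lin_funpow[OF lin_kap]] sum.distrib sum_subtractf)
  also have "\<dots> = (\<Sum>i<n. form_b ((kap ^^ i) (form_d x)) - (kap ^^ i) (form_b (form_d x)))
      + (form_b ((kap ^^ n) (form_d x)) - ((kap ^^ n) x - x))"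
    by (simp add: kap_telescope)
  also have "\<dots> \<in> I0"
    by (intro I0_add free.subspace_sum[OF subspaces0(1)] kap_power_form_b[OF form_d_homog[OF x]]
        form_b_kap_power_form_d x)
  finally show ?thesis .
qed

text \<open>For operators such as \<open>form_B\<close> and \<open>tsyE\<close>, whose formula
  depends on the degree. \<open>I0\<close> is graded, and an element is the finite sum of its
  components.\<close>

lemma I0_homog_memI:
  assumes "x \<in> I0" "lin \<phi>" "free.subspace M" "\<And>y n. y \<in> I0 \<Longrightarrow> y \<in> homog form_deg n \<Longrightarrow> \<phi> y \<in> M"
  shows "\<phi> x \<in> M"
proof -
  have "\<exists>N. \<forall>m\<ge>N. x = (\<Sum>n\<le>m. hpart form_deg n x)"
  proof (induction x rule: free_alg_induct)
    case (add x y)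
    then obtain M N where "\<forall>m\<ge>M. x = (\<Sum>n\<le>m. hpart form_deg n x)" "\<forall>m\<ge>N. y = (\<Sum>n\<le>m. hpart form_deg n y)"
      by blast
    then show ?case
      by (intro exI[of _ "max M N"]) (auto simp: module_hom.add[OF lin_hpart] sum.distrib)
  next
    case (scale c x)
    then obtain N where "\<forall>m\<ge>N. x = (\<Sum>n\<le>m. hpart form_deg n x)" by blast
    then show ?case
      by (intro exI[of _ N]) (auto simp: module_hom.scale[OF lin_hpart] simp flip: free.scale_sum_right)
  next
    case (monomial w)
    then show ?case
      by (intro exI[of _ "word_deg form_deg w"]) (auto simp: hpart_monomial)
  qed
  then obtain N where "x = (\<Sum>n\<le>N. hpart form_deg n x)" by blast
  then have "\<phi> x = (\<Sum>n\<le>N. \<phi> (hpart form_deg n x))"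
    using module_hom.sum[OF assms(2), of "\<lambda>n. hpart form_deg n x" "{..N}"] by simp
  then show ?thesis
    using assms(1,4) by (auto intro!: free.subspace_sum[OF assms(3)] I0_graded hpart_in_homog)
qed

lemma form_B_I0: assumes "x \<in> I0" shows "form_B x \<in> I0"
  by (rule I0_homog_memI[OF assms lin_form_B subspaces0(1)])
    (auto simp: form_B_homog intro: free.subspace_sum[OF subspaces0(1)] kap_power_I0 form_d_I0)

lemma form_B_N0: assumes "x \<in> N0" shows "form_B x \<in> I0"
  by (rule lin_span_memI[OF assms[unfolded reduced_form_sub_def] lin_form_B subspaces0(1)])
    (auto simp: form_B_I0 form_B_homog[OF one_in_homog] I0_zero)

text \<open>\<open>t \<mapsto> 1\<close> maps supercommutators into \<open>KD\<close>, since \<open>[\<omega>, da] = \<plusminus> (b d + d b) (\<omega> da)\<close>.\<close>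

definition KD :: "('a, 'k) form_free set" where
  "KD = add_image (add_image N0 form_b) (\<lambda>x. form_d (form_b x))"

lemma subspace_KD [simp]: "free.subspace KD"
  by (simp add: KD_def)

lemma KD_cases:
  assumes "x \<in> KD" "x \<in> homog form_deg n"
  obtains \<nu> y z where "\<nu> \<in> N0" "x = \<nu> + form_b y + form_d (form_b z)"
    "y \<in> homog form_deg (Suc n)" "z \<in> homog form_deg n" "n = 0 \<longrightarrow> z = 0"
proof -
  from assms(1) obtain x' z where 1: "x' \<in> add_image N0 form_b" "x = x' + form_d (form_b z)"
    unfolding KD_def by (rule add_imageD) (auto intro!: lin_intros)
  from 1(1) obtain \<nu> y where 2: "\<nu> \<in> N0" "x' = \<nu> + form_b y"
    by (rule add_imageD) (auto intro!: lin_intros)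
  have "hpart form_deg n x = x" using assms(2) by (simp add: hpart_homog)
  then have 3: "x = hpart form_deg n \<nu> + form_b (hpart form_deg (Suc n) y) + hpart form_deg n (form_d (form_b z))"
    by (simp add: 1 2 module_hom.add[OF lin_hpart] hpart_form_b)
  have 4: "hpart form_deg n \<nu> \<in> N0" by (rule hpart_N0[OF 2(1)])
  show ?thesis
  proof (cases n)
    case 0
    then show ?thesis using that[OF 4, of "hpart form_deg (Suc n) y" 0] 3
      by (simp add: hpart_form_d hpart_in_homog free.subspace_0[OF subspace_homog])
  next
    case (Suc m)
    then show ?thesis using that[OF 4, of "hpart form_deg (Suc n) y" "hpart form_deg n z"] 3
      by (simp add: hpart_form_d hpart_form_b hpart_in_homog)
  qed
qed

lemma kap_power_invariant:
  assumes "y - kap y \<in> I0" shows "(kap ^^ i) y - y \<in> I0"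
proof (induction i)
  case (Suc i)
  from I0_diff[OF kap_I0[OF Suc] assms] show ?case by simp
qed (simp add: I0_zero)

lemma form_B_invariant:
  assumes "w \<in> homog form_deg m" "form_d w - kap (form_d w) \<in> I0"
  shows "form_B w - of_nat (Suc m) * form_d w \<in> I0"
proof -
  have "(\<Sum>i\<le>m. (kap ^^ i) (form_d w) - form_d w) \<in> I0"
    by (intro free.subspace_sum[OF subspaces0(1)] kap_power_invariant assms)
  then show ?thesis by (simp add: form_B_homog[OF assms(1)] sum_subtractf)
qed

lemma form_d_form_b_form_d: "form_d (form_b (form_d w)) = form_d w - kap (form_d w)"
  by (simp add: kap_def)

lemma t_to_supercommutator:
  assumes "s \<in> supercommutators ext_form_deg" shows "t_to 1 s \<in> KD"
proof (rule lin_span_memI[OF supercommutators_span[OF assms]])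
  fix s :: "('a, 'k) ext_free" assume "s \<in> {letter_comm ext_form_deg x w | x w. True}"
  then obtain x w where s: "s = letter_comm ext_form_deg x w" by blast
  let ?w = "t_to 1 (monomial w) :: ('a, 'k) form_free"
  have b: "form_b y \<in> KD" for y
    unfolding KD_def by (intro add_image_base add_image_range)
  have sgw: "sg0 ?w = (-1) ^ word_deg ext_form_deg w * ?w"
    using t_to_one_sg[of "monomial w :: ('a, 'k) ext_free"] by (cases "even (word_deg ext_form_deg w)") simp_all
  show "t_to 1 s \<in> KD"
  proof (cases x rule: ext_gen_cases)
    case (elt a)
    have "t_to 1 s = - form_b (sg0 ?w * dif a)"
      by (simp add: s elt letter_comm_def ext_gen_monomial form_b_mult_dif)
    then show ?thesis using free.subspace_neg[OF _ b] by (simp add: KD_def)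
  next
    case (dif a)
    let ?y = "sg0 ?w * dif a"
    have "t_to 1 s = dif a * ?w - ?y"
      unfolding sgw
      by (cases "even (word_deg ext_form_deg w)") (simp_all add: s dif letter_comm_def ext_gen_monomial)
    also have "\<dots> = - (form_b (form_d ?y) + form_d (form_b ?y))"
      by (simp add: karoubi_identity)
    finally have "t_to 1 s = - (form_b (form_d ?y) + form_d (form_b ?y))" .
    moreover have "form_d (form_b ?y) \<in> KD" unfolding KD_def by (rule add_image_range)
    ultimately show ?thesis
      using free.subspace_neg[OF _ free.subspace_add[OF _ b]] by (simp add: KD_def)
  next
    case t
    then show ?thesis by (simp add: s letter_comm_def ext_gen_monomial KD_def free.subspace_0)
  qed
qed (auto intro!: lin_intros simp: KD_def)

lemma N0_sub_KD: "x \<in> N0 \<Longrightarrow> x \<in> KD"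
  unfolding KD_def by (intro add_image_base)

lemma t_to_DR: assumes "y \<in> DR" shows "t_to 1 y \<in> KD"
proof (rule lin_span_memI[OF assms[unfolded reduced_DR_sub_def]])
  fix s :: "('a, 'k) ext_free"
  assume "s \<in> I \<union> supercommutators ext_form_deg \<union> range ((^) ext_t)"
  then show "t_to 1 s \<in> KD"
    by (auto intro: N0_sub_KD I0_sub_N0 t_to_I t_to_supercommutator N0_sub_KD[OF one_in_N0])
qed (auto intro!: lin_intros simp: KD_def)

lemma t_to_DRi: "y \<in> DRi \<Longrightarrow> t_to 1 y \<in> KD"
  unfolding DRi_def
  by (erule lin_add_image) (auto intro!: lin_intros t_to_DR simp: free.subspace_0)

end

text \<open>The number of exponents \<open>(k\<^sub>0, ..., k\<^sub>n)\<close> with sum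
  \<open>q\<close>, that is the binomial coefficient of \<open>q + n\<close> over \<open>n\<close>.
  It is the multiple that remains of the Tsygan sum at \<open>t = 1\<close>.\<close>

primrec tsy_count :: "nat \<Rightarrow> nat \<Rightarrow> nat" where
  "tsy_count 0 q = 1"
| "tsy_count (Suc n) q = (\<Sum>k\<le>q. tsy_count n k)"

lemma tsy_count_pos: "tsy_count n q > 0"
  by (induction n arbitrary: q) (auto intro!: sum_pos)

lemma of_nat_left_commute: "a * (of_nat n * p) = of_nat n * (a * (p::'a::ring_1))"
  by (metis mult.assoc mult_of_nat_commute)

lemma t_to_tsy_pd:
  fixes a :: 'a
  shows "(t_to 1 (tsy q (pd as)) :: ('a, 'k::comm_ring_1) form_free) = of_nat (tsy_count (length as) q) * pd as"
proof (induction as arbitrary: q)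
  case (Cons a as)
  have "t_to 1 (geo X q) = (\<Sum>k\<le>q. t_to 1 (X k))" for X :: "nat \<Rightarrow> ('a, 'k) ext_free" and q
    by (induction q) simp_all
  then have "(t_to 1 (tsy q (pd (a # as))) :: ('a, 'k) form_free) = (\<Sum>k\<le>q. dif a * (of_nat (tsy_count (length as) k) * pd as))"
    unfolding tsy_pd_Cons by (simp add: Cons)
  also have "\<dots> = of_nat (tsy_count (length (a # as)) q) * pd (a # as)"
    by (simp add: sum_distrib_right of_nat_left_commute)
  finally show ?case .
qed simp

context rational_form_algebra
begin

lemma t_to_tsy:
  assumes "x \<in> homog form_deg n" shows "t_to 1 (tsy q x) - of_nat (tsy_count n q) * x \<in> I0"
proof (rule form_normal_cong[OF assms])
  fix a and as :: "'a list" assume "length as = n"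
  then show "t_to 1 (tsy q (elt a * pd as)) - of_nat (tsy_count n q) * (elt a * pd as) \<in> I0"
    by (simp add: t_to_tsy_pd I0_zero of_nat_left_commute)
qed (auto intro!: lin_intros t_to_I tsy_I I0_mult_left)

lemma tsy_memD:
  assumes "x \<in> homog form_deg n" "t_to 1 (tsy q x) \<in> M" "free.subspace M" "\<And>y. y \<in> I0 \<Longrightarrow> y \<in> M"
  shows "x \<in> M"
proof (rule divide_mem[OF assms(3) tsy_count_pos[of n q]])
  show "of_nat (tsy_count n q) * x \<in> M"
    using free.subspace_diff[OF assms(3,2) assms(4)[OF t_to_tsy[OF assms(1), of q]]] by simp
qed

text \<open>In \<open>x = \<nu> + b y + d b z\<close> put \<open>w = b z\<close>. Since
  \<open>x\<close> is a cycle, \<open>b d w\<close> is a constant, so \<open>d b d w\<close>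
  vanishes and \<open>d w\<close> is invariant under \<open>kap\<close>. Hence
  \<open>(m + 1) d w = B b z = - b B z\<close> is a boundary.\<close>

lemma KD_cycle:
  assumes "x \<in> homog form_deg n" "form_b x \<in> N0" "x \<in> KD" shows "x \<in> add_image N0 form_b"
proof -
  let ?M = "add_image N0 form_b"
  obtain \<nu> y z where *: "\<nu> \<in> N0" "x = \<nu> + form_b y + form_d (form_b z)"
    "y \<in> homog form_deg (Suc n)" "z \<in> homog form_deg n" "n = 0 \<longrightarrow> z = 0"
    using KD_cases[OF assms(3,1)] by blast
  have "form_d (form_b z) \<in> ?M"
  proof (cases n)
    case 0
    with * show ?thesis by (simp add: free.subspace_0)
  next
    case (Suc m)
    let ?w = "form_b z"
    have w: "?w \<in> homog form_deg m" using * Suc form_b_homog by blast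
    have "form_b (form_d ?w) = form_b x - form_b \<nu> - form_b (form_b y)" by (simp add: *)
    also have "\<dots> \<in> N0"
      using assms(2) form_b_N0[OF *(1)] I0_sub_N0[OF form_b_form_b[OF *(3)]]
      by (simp add: free.subspace_diff)
    finally have "form_d (form_b (form_d ?w)) \<in> I0" by (rule form_d_N0)
    then have "form_B ?w - of_nat (Suc m) * form_d ?w \<in> I0"
      by (intro form_B_invariant w) (simp add: form_d_form_b_form_d)
    moreover have "form_B ?w + form_b (form_B z) \<in> I0"
      using form_b_form_B[OF *(4)] by (simp add: add.commute)
    ultimately have "form_B ?w + form_b (form_B z) - (form_B ?w - of_nat (Suc m) * form_d ?w) \<in> I0"
      by (rule I0_diff[rotated])
    from free.subspace_diff[OF subspace_add_image add_image_base[OF I0_sub_N0[OF this]] add_image_range, of form_b "form_B z"]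
    have "of_nat (Suc m) * form_d ?w \<in> ?M" by simp
    then show ?thesis by (rule divide_mem[of ?M "Suc m", rotated -1]) simp_all
  qed
  from free.subspace_add[OF subspace_add_image free.subspace_add[OF subspace_add_image
      add_image_base[OF *(1)] add_image_range] this]
  show ?thesis by (simp add: *(2))
qed

lemma tsy_inj:
  assumes "x \<in> homog form_deg n" "form_b x \<in> N0" "tsy q x \<in> DRi"
  shows "x \<in> add_image N0 form_b"
proof (rule KD_cycle[OF assms(1,2)])
  show "x \<in> KD"
    using t_to_DRi[OF assms(3)] by (rule tsy_memD[OF assms(1)]) (auto simp: KD_def intro: add_image_base I0_sub_N0)
qed

definition NB :: "('a, 'k) form_free set" where
  "NB = add_image N0 form_B"

definition DRd :: "('a, 'k) ext_free set" where
  "DRd = add_image DR ext_d"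

lemma form_d_NB: "x \<in> NB \<Longrightarrow> form_d x \<in> I0"
  unfolding NB_def by (erule lin_add_image) (auto intro!: lin_intros form_d_N0 simp: I0_zero)

lemma I0_sub_NB: "x \<in> I0 \<Longrightarrow> x \<in> NB"
  unfolding NB_def by (intro add_image_base I0_sub_N0)

text \<open>Setting \<open>t = 1\<close> now gives \<open>x = x' + d w\<close> with
  \<open>x'\<close> in the image of \<open>b\<close> up to constants. As \<open>d\<close>
  annihilates \<open>NB\<close>, the hypothesis on \<open>b x\<close> yields that
  \<open>d b d w\<close> vanishes, so \<open>d w\<close> is invariant under \<open>kap\<close> and
  \<open>(m + 1) d w = B w\<close>.\<close>

lemma tsy_inj_cyclic:
  assumes x: "x \<in> homog form_deg n" "form_b x \<in> NB" "tsy q x \<in> add_image DRd ext_i"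
  shows "x \<in> add_image NB form_b"
proof -
  let ?M = "add_image NB form_b"
  let ?D = "add_image (add_image N0 form_b) form_d"
  have KD: "y \<in> ?D" if "y \<in> KD" for y
    using that unfolding KD_def
    by (rule lin_add_image[where f = "\<lambda>y. y"])
      (auto intro: lin_id add_image_base add_image_range)
  have "t_to 1 (tsy q x) \<in> ?D"
    using x(3)
  proof (rule lin_add_image[where f = "t_to 1"])
    fix y assume "y \<in> DRd"
    then show "t_to 1 y \<in> ?D"
      unfolding DRd_def
      by (rule lin_add_image[where f = "t_to 1"])
        (auto intro!: lin_intros KD t_to_DR add_image_range simp: t_to_one_ext_d)
  qed (auto intro!: lin_intros simp: free.subspace_0)
  then have "x \<in> ?D"
    by (rule tsy_memD[OF x(1)]) (auto intro: add_image_base I0_sub_N0)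
  then obtain x' w where 1: "x' \<in> add_image N0 form_b" "x = x' + form_d w"
    by (rule add_imageD) (auto intro!: lin_intros)
  from 1(1) obtain \<nu> y where 2: "\<nu> \<in> N0" "x' = \<nu> + form_b y"
    by (rule add_imageD) (auto intro!: lin_intros)
  have eq: "x = hpart form_deg n x' + hpart form_deg n (form_d w)"
    using 1(2) x(1) by (metis hpart_homog lin_hpart module_hom.add)
  have h: "hpart form_deg n y \<in> ?M" if y: "y \<in> add_image N0 form_b" for y n
    using y
  proof (rule lin_add_image[where f = "hpart form_deg n"])
    fix y assume "y \<in> N0"
    then show "hpart form_deg n y \<in> ?M"
      unfolding NB_def by (intro add_image_base hpart_N0)
  qed (auto intro!: lin_intros add_image_range simp: hpart_form_b)
  show ?thesis
  proof (cases n)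
    case 0
    then show ?thesis using h[OF 1(1), of n] eq by (simp add: hpart_form_d)
  next
    case (Suc m)
    let ?w = "hpart form_deg m w"
    have w: "?w \<in> homog form_deg m" by (rule hpart_in_homog)
    have eq': "form_d ?w = x - hpart form_deg n x'" using eq Suc by (simp add: hpart_form_d)
    have "form_d (form_b (form_d ?w)) \<in> I0"
    proof -
      have "hpart form_deg n x' = hpart form_deg n \<nu> + form_b (hpart form_deg (Suc n) y)"
        by (simp add: 2 module_hom.add[OF lin_hpart] hpart_form_b)
      \<comment> \<open>The degree is positive, and there the constants in \<open>N0\<close> have no
        component.\<close>
      moreover have "hpart form_deg n \<nu> \<in> I0"
        using 2(1) unfolding reduced_form_sub_def
      proof (rule lin_span_memI[OF _ lin_hpart subspaces0(1)])
        fix s :: "('a, 'k) form_free" assume "s \<in> I0 \<union> {1}"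
        then show "hpart form_deg n s \<in> I0"
          using Suc by (auto intro: I0_graded simp: I0_zero hpart_one)
      qed
      ultimately have "form_d (form_b (hpart form_deg n x')) \<in> I0"
        using form_b_form_b[OF hpart_in_homog, of "Suc n" y]
        by (simp add: I0_add form_d_I0 form_b_I0)
      then show ?thesis
        unfolding eq' using form_d_NB[OF x(2)] by (simp add: I0_diff)
    qed
    then have "form_B ?w - of_nat (Suc m) * form_d ?w \<in> I0"
      by (intro form_B_invariant w) (simp add: form_d_form_b_form_d)
    from free.subspace_diff[OF subspace_add_image add_image_range add_image_base[OF I0_sub_N0[OF this]], of form_B ?w]
    have "of_nat (Suc m) * form_d ?w \<in> NB" by (simp add: NB_def)
    then have "form_d ?w \<in> NB" by (rule divide_mem[of NB "Suc m", rotated -1]) (simp_all add: NB_def)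
    then have "hpart form_deg n x' + form_d ?w \<in> ?M"
      using h[OF 1(1), of n] by (intro free.subspace_add[OF subspace_add_image]) (auto intro: add_image_base)
    then show ?thesis by (simp add: eq')
  qed
qed

end

section \<open>The Poincare lemma\<close>

fun pr_word :: "('a::ring_1 \<Rightarrow> 'k::comm_ring_1) \<Rightarrow> 'a \<Rightarrow> 'a ext_gen list \<Rightarrow> ('a, 'k) ext_free" where
  "pr_word r x [] = fscale (r x) 1"
| "pr_word r x (Form (Elt a) # v) = pr_word r (x * a) v"
| "pr_word r x (Form (Dif a) # v) =
     fscale (r x) (ext_dif a * monomial v + ext_elt a * d0 (monomial v)) - fscale (r (x * a)) (d0 (monomial v))"
| "pr_word r x (T # v) = fscale (r x) (ext_t * monomial v)"

text \<open>If \<open>f = a\<^sub>0 \<beta>\<close> with \<open>\<beta>\<close> starting with \<open>t\<close> or with some \<open>da\<close>, then \<open>pr r x f = r (x a\<^sub>0) \<beta>\<close>.\<close>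

definition pr :: "('a::ring_1 \<Rightarrow> 'k::comm_ring_1) \<Rightarrow> 'a \<Rightarrow> ('a, 'k) ext_free \<Rightarrow> ('a, 'k) ext_free" where
  "pr r x = lin_ext (pr_word r x)"

lemma lin_pr [lin_intros]: "lin (pr r x)"
  unfolding pr_def by (rule lin_intros)

lemmas lin_compose_pr [lin_intros] = lin_compose[OF lin_pr]
lemmas pr_lin_simps [simp] = module_hom.add[OF lin_pr] module_hom.diff[OF lin_pr]
  module_hom.neg[OF lin_pr] module_hom.zero[OF lin_pr] module_hom.scale[OF lin_pr]

lemma pr_monomial: "pr r x (monomial w) = pr_word r x w"
  by (simp add: pr_def)

lemma pr_step [simp]:
  "pr r x (ext_elt a * f) = pr r (x * a) f"
  "pr r x (ext_dif a * f) =
     fscale (r x) (ext_dif a * f + ext_elt a * d0 f) - fscale (r (x * a)) (d0 f)"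
  "pr r x (ext_t * f) = fscale (r x) (ext_t * f)" "pr r x 1 = fscale (r x) 1"
  using lin_ext_Cons[of "pr r (x * a)" "pr_word r x" "Form (Elt a)" f]
    lin_ext_Cons[of "\<lambda>f. fscale (r x) (ext_dif a * f + ext_elt a * d0 f) - fscale (r (x * a)) (d0 f)"
      "pr_word r x" "Form (Dif a)" f]
    lin_ext_Cons[of "\<lambda>f. fscale (r x) (ext_t * f)" "pr_word r x" T f] lin_ext_one[of "pr_word r x"]
  by (simp_all add: lin_intros pr_monomial ext_gen_monomial flip: pr_def)

fun con_word :: "('a::ring_1 \<Rightarrow> 'k::comm_ring_1) \<Rightarrow> 'a \<Rightarrow> 'a ext_gen list \<Rightarrow> ('a, 'k) ext_free" where
  "con_word r x [] = 0"
| "con_word r x (Form (Elt a) # v) = con_word r (x * a) v"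
| "con_word r x (Form (Dif a) # v) = fscale (r x) (ext_elt a * monomial v - pr r a (monomial v))
     - fscale (r (x * a)) (monomial v - pr r 1 (monomial v))"
| "con_word r x (T # v) = fscale (r x) (ext_t * con_word r 1 v)"

text \<open>The contraction \<open>a\<^sub>0 da\<^sub>1 \<beta> \<mapsto> r a\<^sub>0 (a\<^sub>1 - r a\<^sub>1) \<beta>\<close> for the differential \<open>d\<close>, applied to \<open>x f\<close>.\<close>

definition con :: "('a::ring_1 \<Rightarrow> 'k::comm_ring_1) \<Rightarrow> 'a \<Rightarrow> ('a, 'k) ext_free \<Rightarrow> ('a, 'k) ext_free" where
  "con r x = lin_ext (con_word r x)"

lemma lin_con [lin_intros]: "lin (con r x)"
  unfolding con_def by (rule lin_intros)

lemmas lin_compose_con [lin_intros] = lin_compose[OF lin_con]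
lemmas con_lin_simps [simp] = module_hom.add[OF lin_con] module_hom.diff[OF lin_con]
  module_hom.neg[OF lin_con] module_hom.zero[OF lin_con] module_hom.scale[OF lin_con]

lemma con_monomial: "con r x (monomial w) = con_word r x w"
  by (simp add: con_def)

lemma con_step [simp]:
  "con r x (ext_elt a * f) = con r (x * a) f"
  "con r x (ext_dif a * f) =
     fscale (r x) (ext_elt a * f - pr r a f) - fscale (r (x * a)) (f - pr r 1 f)"
  "con r x (ext_t * f) = fscale (r x) (ext_t * con r 1 f)" "con r x 1 = 0"
  using lin_ext_Cons[of "con r (x * a)" "con_word r x" "Form (Elt a)" f]
    lin_ext_Cons[of "\<lambda>f. fscale (r x) (ext_elt a * f - pr r a f) - fscale (r (x * a)) (f - pr r 1 f)"
      "con_word r x" "Form (Dif a)" f]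
    lin_ext_Cons[of "\<lambda>f. fscale (r x) (ext_t * con r 1 f)" "con_word r x" T f] lin_ext_one[of "con_word r x"]
  by (simp_all add: lin_intros con_monomial ext_gen_monomial flip: con_def)

text \<open>\<open>pr\<close> replaces the coefficient \<open>a\<^sub>0\<close> by a scalar. The
  only term of \<open>d\<close> lost by this is the one that differentiates the coefficient, and
  \<open>d0\<close> restores it.\<close>

lemma pr_ext_d: "pr r x (ext_d f) = ext_d (pr r x f) + fscale (r x) (d0 f)"
proof (rule lin_eqI[where f = "\<lambda>f. pr r x (ext_d f)"])
  show "pr r x (ext_d (monomial w)) = ext_d (pr r x (monomial w)) + fscale (r x) (d0 (monomial w))" for w
  proof (induction w arbitrary: x)
    case (Cons y w)
    then show ?case
      by (cases y rule: ext_gen_cases)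
        (simp_all add: ext_monomial_Cons ext_d_d0 free.scale_right_distrib free.scale_right_diff_distrib)
  qed simp
qed (auto intro!: lin_intros)

text \<open>The retraction \<open>r\<close> of the unit map extracts the constant part of an element
  of \<open>A\<close>; the contraction of \<open>d\<close> is built from it.\<close>

locale split_form_algebra = rational_form_algebra scale qscale
  for scale :: "'k::comm_ring_1 \<Rightarrow> 'a::ring_1 \<Rightarrow> 'a" and qscale :: "rat \<Rightarrow> 'k \<Rightarrow> 'k" +
  fixes r :: "'a \<Rightarrow> 'k"
  assumes r_hom: "module_hom scale (*) r" and r_unit: "r (scale c 1) = c"
begin

lemma r_simps [simp]: "r (x + y) = r x + r y" "r (x - y) = r x - r y" "r (scale c x) = c * r x" "r 1 = 1" "r 0 = 0"
  using r_unit[of 1] module_hom.add[OF r_hom] module_hom.scale[OF r_hom] module_hom.diff[OF r_hom] module_hom.zero[OF r_hom]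
  by simp_all

lemma scale_mult [simp]: "scale c x * y = scale c (x * y)" "x * scale c y = scale c (x * y)"
  by (simp_all flip: scale_mult_left scale_mult_right)

lemma pr_left: "pr r (x + y) f = pr r x f + pr r y f" "pr r (scale c x) f = fscale c (pr r x f)"
proof -
  have "\<forall>x y. pr r (x + y) (monomial w) = pr r x (monomial w) + pr r y (monomial w)" for w
    by (rule ext_word_induct) (auto simp: algebra_simps free.scale_left_distrib free.scale_right_distrib)
  then show "pr r (x + y) f = pr r x f + pr r y f"
    by (intro lin_eqI[of "pr r (x + y)" _ f]) (auto intro!: lin_intros)
  have "\<forall>x. pr r (scale c x) (monomial w) = fscale c (pr r x (monomial w))" for w
    by (rule ext_word_induct) (auto simp: free.scale_right_diff_distrib)
  then show "pr r (scale c x) f = fscale c (pr r x f)"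
    by (intro lin_eqI[of "pr r (scale c x)" _ f]) (auto intro!: lin_intros)
qed

lemma con_left: "con r (x + y) f = con r x f + con r y f" "con r (scale c x) f = fscale c (con r x f)"
proof -
  have "\<forall>x y. con r (x + y) (monomial w) = con r x (monomial w) + con r y (monomial w)" for w
    by (rule ext_word_induct) (auto simp: algebra_simps free.scale_left_distrib free.scale_right_distrib)
  then show "con r (x + y) f = con r x f + con r y f"
    by (intro lin_eqI[of "con r (x + y)" _ f]) (auto intro!: lin_intros)
  have "\<forall>x. con r (scale c x) (monomial w) = fscale c (con r x (monomial w))" for w
    by (rule ext_word_induct) (auto simp: free.scale_right_diff_distrib)
  then show "con r (scale c x) f = fscale c (con r x f)"
    by (intro lin_eqI[of "con r (scale c x)" _ f]) (auto intro!: lin_intros)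
qed

lemma pr_I: assumes "f \<in> I" shows "pr r x f \<in> I"
proof (rule ext_left_recI[where \<phi> = "pr r", OF assms lin_pr subspaces(1)])
  fix x a b c and v :: "('a, 'k) ext_free"
  show "pr r x ((ext_elt 1 - 1) * v) \<in> I" by (simp add: algebra_simps I_zero)
  show "pr r x ((ext_elt (a * b) - ext_elt a * ext_elt b) * v) \<in> I"
    by (simp add: left_diff_distrib mult.assoc I_zero)
  show "pr r x ((ext_elt (a + b) - (ext_elt a + ext_elt b)) * v) \<in> I"
    by (simp add: ring_distribs pr_left I_zero)
  show "pr r x ((ext_elt (scale c a) - fscale c (ext_elt a)) * v) \<in> I"
    by (simp add: left_diff_distrib fscale_mult_left pr_left I_zero)
  show "pr r x ((ext_dif (a + b) - (ext_dif a + ext_dif b)) * v) \<in> I"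
    by (rule memI[of "fscale (r x) ((ext_dif (a + b) - (ext_dif a + ext_dif b)) * v +
         (ext_elt (a + b) - (ext_elt a + ext_elt b)) * d0 v)"])
      (blast intro: I_intros I_scale, simp add: algebra_simps free.scale_left_distrib
        free.scale_right_distrib free.scale_right_diff_distrib)
  show "pr r x ((ext_dif (scale c a) - fscale c (ext_dif a)) * v) \<in> I"
    by (rule memI[of "fscale (r x) ((ext_dif (scale c a) - fscale c (ext_dif a)) * v +
         (ext_elt (scale c a) - fscale c (ext_elt a)) * d0 v)"])
      (blast intro: I_intros I_scale, simp add: algebra_simps fscale_mult_left free.scale_left_distrib
        free.scale_right_distrib free.scale_right_diff_distrib)
  show "pr r x (ext_dif (scale c 1) * v) \<in> I"
    by (rule memI[of "fscale (r x) (ext_dif (scale c 1) * v + (ext_elt (scale c 1) - fscale c (ext_elt 1)) * d0 v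
         + fscale c ((ext_elt 1 - 1) * d0 v))"])
      (blast intro: I_intros I_scale, simp add: algebra_simps fscale_mult_left free.scale_left_distrib
        free.scale_right_distrib free.scale_right_diff_distrib)
  show "pr r x ((ext_dif (a * b) - (ext_dif a * ext_elt b + ext_elt a * ext_dif b)) * v) \<in> I"
    by (rule memI[of "fscale (r x) ((ext_dif (a * b) - (ext_dif a * ext_elt b + ext_elt a * ext_dif b)) * v +
         (ext_elt (a * b) - ext_elt a * ext_elt b) * d0 v)"])
      (blast intro: I_intros I_scale, simp add: algebra_simps free.scale_left_distrib
        free.scale_right_distrib free.scale_right_diff_distrib)
next
  fix x a and g :: "('a, 'k) ext_free" assume "g \<in> I" "\<And>j. pr r j g \<in> I"
  then show "pr r x (ext_dif a * g) \<in> I"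
    unfolding pr_step by (intro I_diff I_scale I_add I_mult_left d0_I)
qed (auto intro: I_scale I_mult_left)

lemma con_I: assumes "f \<in> I" shows "con r x f \<in> I"
proof (rule ext_left_recI[where \<phi> = "con r", OF assms lin_con subspaces(1)])
  fix x a b c and v :: "('a, 'k) ext_free"
  show "con r x ((ext_elt 1 - 1) * v) \<in> I" by (simp add: algebra_simps I_zero)
  show "con r x ((ext_elt (a * b) - ext_elt a * ext_elt b) * v) \<in> I"
    by (simp add: left_diff_distrib mult.assoc I_zero)
  show "con r x ((ext_elt (a + b) - (ext_elt a + ext_elt b)) * v) \<in> I"
    by (simp add: ring_distribs con_left I_zero)
  show "con r x ((ext_elt (scale c a) - fscale c (ext_elt a)) * v) \<in> I"
    by (simp add: left_diff_distrib fscale_mult_left con_left I_zero)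
  show "con r x ((ext_dif (a + b) - (ext_dif a + ext_dif b)) * v) \<in> I"
    by (rule memI[of "fscale (r x) ((ext_elt (a + b) - (ext_elt a + ext_elt b)) * v)"])
      (blast intro: I_intros I_scale, simp add: algebra_simps pr_left free.scale_left_distrib
        free.scale_right_distrib free.scale_right_diff_distrib)
  show "con r x ((ext_dif (scale c a) - fscale c (ext_dif a)) * v) \<in> I"
    by (rule memI[of "fscale (r x) ((ext_elt (scale c a) - fscale c (ext_elt a)) * v)"])
      (blast intro: I_intros I_scale, simp add: algebra_simps pr_left fscale_mult_left free.scale_left_distrib
        free.scale_right_distrib free.scale_right_diff_distrib)
  show "con r x (ext_dif (scale c 1) * v) \<in> I"
    by (rule memI[of "fscale (r x) ((ext_elt (scale c 1) - fscale c (ext_elt 1)) * v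
         + fscale c ((ext_elt 1 - 1) * v))"])
      (blast intro: I_intros I_scale, simp add: algebra_simps pr_left fscale_mult_left free.scale_left_distrib
        free.scale_right_distrib free.scale_right_diff_distrib)
  show "con r x ((ext_dif (a * b) - (ext_dif a * ext_elt b + ext_elt a * ext_dif b)) * v) \<in> I"
    by (rule memI[of "fscale (r x) ((ext_elt (a * b) - ext_elt a * ext_elt b) * v)"])
      (blast intro: I_intros I_scale, simp add: algebra_simps free.scale_left_distrib
        free.scale_right_distrib free.scale_right_diff_distrib)
qed (auto intro: I_scale I_mult_left I_add I_diff pr_I)

text \<open>The powers of \<open>t\<close> are closed under \<open>d\<close> and represent the
  constants: the homotopy formula for \<open>d\<close> holds modulo \<open>k[t]\<close>.\<close>

definition TI :: "('a, 'k) ext_free set" where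
  "TI = free.span (I \<union> range (\<lambda>n. ext_t ^ n))"

lemma subspace_TI [simp]: "free.subspace TI"
  by (simp add: TI_def)

lemma I_sub_TI: "x \<in> I \<Longrightarrow> x \<in> TI" and t_power_TI: "ext_t ^ n \<in> TI"
  by (auto simp: TI_def intro: free.span_base)

lemma TI_mult_t: assumes "x \<in> TI" shows "ext_t * x \<in> TI"
  by (rule lin_span_memI[OF assms[unfolded TI_def], where f = "\<lambda>x. ext_t * x"])
    (auto intro!: lin_intros intro: I_sub_TI I_mult_left simp flip: power_Suc simp: t_power_TI)

text \<open>This is \<open>y = d h y + h d y\<close> for \<open>h = con r 1\<close> and
  \<open>y = x f\<close>, with \<open>d y = dx f + x df\<close> expanded. Keeping the coefficient
  \<open>x\<close> apart lets the induction absorb the next element of \<open>A\<close> into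
  it.\<close>

lemma con_homotopy:
  "ext_elt x * f - ext_d (con r x f) - con r 1 (ext_dif x * f) - con r x (ext_d f) \<in> TI"
proof (rule lin_memI[where f = "\<lambda>f. ext_elt x * f - ext_d (con r x f) - con r 1 (ext_dif x * f) - con r x (ext_d f)"])
  show "ext_elt x * monomial w - ext_d (con r x (monomial w)) - con r 1 (ext_dif x * monomial w)
      - con r x (ext_d (monomial w)) \<in> TI" for w
  proof (induction w arbitrary: x)
    case Nil
    have "fscale (r x) (ext_t ^ 0) \<in> TI" by (intro free.subspace_scale t_power_TI subspace_TI)
    then show ?case using con_step(2)[of r 1 x 1] by (simp add: free.scale_right_diff_distrib)
  next
    case (Cons y w)
    let ?w = "monomial w :: ('a, 'k) ext_free"
    show ?case
    proof (cases y rule: ext_gen_cases)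
      case (elt a)
      have "ext_elt x * ext_elt a * ?w - ext_elt (x * a) * ?w \<in> I"
        by (rule memI[OF I_neg[OF I_mult_right[OF I_rels(2)[of x a], of ?w]]]) (simp add: algebra_simps)
      moreover have "con r 1 ((ext_dif (x * a) - (ext_dif x * ext_elt a + ext_elt x * ext_dif a)) * ?w) \<in> I"
        by (intro con_I I_mult_right I_rels)
      ultimately have "(ext_elt x * ext_elt a * ?w - ext_elt (x * a) * ?w) +
        con r 1 ((ext_dif (x * a) - (ext_dif x * ext_elt a + ext_elt x * ext_dif a)) * ?w) \<in> TI"
        by (intro I_sub_TI I_add)
      from free.subspace_add[OF subspace_TI Cons[of "x * a"] this] show ?thesis
        by (rule memI) (simp add: elt ext_monomial_Cons algebra_simps free.scale_right_distrib free.scale_right_diff_distrib)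
    next
      case (dif a)
      have "ext_elt x * monomial (y # w) - ext_d (con r x (monomial (y # w))) - con r 1 (ext_dif x * monomial (y # w))
        - con r x (ext_d (monomial (y # w))) = 0"
        by (simp add: dif ext_monomial_Cons algebra_simps pr_ext_d free.scale_right_distrib free.scale_right_diff_distrib)
      then show ?thesis by (simp only: free.subspace_0 subspace_TI)
    next
      case t
      \<comment> \<open>In front of a \<open>t\<close> the letter \<open>dx\<close> accounts for
        \<open>x - r x\<close>. What is left is \<open>r x\<close> times \<open>t\<close> times the
        formula for \<open>w\<close> with \<open>x = 1\<close>.\<close>
      have 1: "ext_elt 1 * ?w - ?w \<in> I"
        by (rule memI[OF I_mult_right[OF I_rels(1)]]) (simp add: algebra_simps)
      have 2: "con r 1 (ext_dif 1 * ?w) \<in> I" by (intro con_I I_mult_right I_dif_one)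
      from free.subspace_diff[OF subspace_TI Cons[of 1] I_sub_TI[OF I_diff[OF 1 2]]]
      have "ext_t * (?w - ext_d (con r 1 ?w) - con r 1 (ext_d ?w)) \<in> TI"
        by (intro TI_mult_t) (simp add: algebra_simps)
      from free.subspace_scale[OF subspace_TI this, of "r x"] show ?thesis
        by (rule memI) (simp add: t ext_monomial_Cons algebra_simps free.scale_right_distrib free.scale_right_diff_distrib)
    qed
  qed
qed (intro lin_intros subspace_TI)+

lemma ext_d_exact:
  assumes "ext_d f \<in> TI" shows "f - ext_d (con r 1 f) \<in> TI"
proof -
  have 1: "ext_elt 1 * f - f \<in> I"
    by (rule memI[OF I_mult_right[OF I_rels(1)]]) (simp add: algebra_simps)
  have 2: "con r 1 (ext_dif 1 * f) \<in> I" by (intro con_I I_mult_right I_dif_one)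
  have t: "con r 1 (ext_t ^ n) = 0" for n by (induction n) auto
  have 3: "con r 1 (ext_d f) \<in> I"
    by (rule lin_span_memI[OF assms[unfolded TI_def] lin_con subspaces(1)]) (auto simp: t con_I I_zero)
  from free.subspace_diff[OF subspace_TI con_homotopy[of 1 f] I_sub_TI[OF I_diff[OF I_diff[OF 1 2] 3]]]
  show ?thesis by (rule memI) (simp add: algebra_simps)
qed

end

section \<open>Cutting cyclic words at the letters \<open>t\<close>\<close>

text \<open>\<open>tcut \<Phi> w\<close> is the sum of \<open>\<Phi> u v\<close> over all decompositions \<open>w = u t v\<close>.\<close>

fun tcut_word :: "(('a, 'k::comm_ring_1) ext_free \<Rightarrow> ('a, 'k) ext_free \<Rightarrow> ('a, 'k) ext_free) \<Rightarrow>
    'a ext_gen list \<Rightarrow> ('a, 'k) ext_free" where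
  "tcut_word \<Phi> [] = 0"
| "tcut_word \<Phi> (x # w) = (if x = T then \<Phi> 1 (monomial w) else 0) + tcut_word (\<lambda>u. \<Phi> (monomial [x] * u)) w"

definition tcut :: "(('a, 'k::comm_ring_1) ext_free \<Rightarrow> ('a, 'k) ext_free \<Rightarrow> ('a, 'k) ext_free) \<Rightarrow>
    ('a, 'k) ext_free \<Rightarrow> ('a, 'k) ext_free" where
  "tcut \<Phi> = lin_ext (tcut_word \<Phi>)"

lemma lin_tcut [lin_intros]: "lin (tcut \<Phi>)"
  unfolding tcut_def by (rule lin_intros)

lemmas lin_compose_tcut [lin_intros] = lin_compose[OF lin_tcut]
lemmas tcut_lin_simps [simp] = module_hom.add[OF lin_tcut] module_hom.diff[OF lin_tcut]
  module_hom.neg[OF lin_tcut] module_hom.zero[OF lin_tcut] module_hom.scale[OF lin_tcut]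

lemma tcut_monomial: "tcut \<Phi> (monomial w) = tcut_word \<Phi> w"
  by (simp add: tcut_def)

lemma tcut_one [simp]: "tcut \<Phi> 1 = 0"
  unfolding monomial_Nil[symmetric] tcut_monomial by simp

lemma tcut_step:
  assumes "\<And>u. lin (\<Phi> u)"
  shows "tcut \<Phi> (ext_elt a * f) = tcut (\<lambda>u. \<Phi> (ext_elt a * u)) f"
    "tcut \<Phi> (ext_dif a * f) = tcut (\<lambda>u. \<Phi> (ext_dif a * u)) f"
    "tcut \<Phi> (ext_t * f) = \<Phi> 1 f + tcut (\<lambda>u. \<Phi> (ext_t * u)) f"
  using lin_ext_Cons[of "tcut (\<lambda>u. \<Phi> (ext_elt a * u))" "tcut_word \<Phi>" "Form (Elt a)" f]
    lin_ext_Cons[of "tcut (\<lambda>u. \<Phi> (ext_dif a * u))" "tcut_word \<Phi>" "Form (Dif a)" f]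
    lin_ext_Cons[of "\<lambda>f. \<Phi> 1 f + tcut (\<lambda>u. \<Phi> (ext_t * u)) f" "tcut_word \<Phi>" T f]
  by (simp_all add: lin_intros assms tcut_monomial ext_gen_monomial flip: tcut_def)

lemma tcut_word_cong:
  assumes "\<And>u v. w = u @ T # v \<Longrightarrow> \<Phi> (monomial u) (monomial v) = \<Psi> (monomial u) (monomial v)"
  shows "tcut_word \<Phi> w = tcut_word \<Psi> w"
  using assms
proof (induction w arbitrary: \<Phi> \<Psi>)
  case (Cons x w)
  have "tcut_word (\<lambda>u. \<Phi> (monomial [x] * u)) w = tcut_word (\<lambda>u. \<Psi> (monomial [x] * u)) w"
  proof (rule Cons.IH)
    show "\<Phi> (monomial [x] * monomial u) (monomial v) = \<Psi> (monomial [x] * monomial u) (monomial v)"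
      if "w = u @ T # v" for u v
      using Cons.prems[of "x # u" v] that by (simp add: monomial_Cons[of x u])
  qed
  then show ?case using Cons.prems[of "[]" w] by auto
qed simp

lemma tcut_word_mem:
  assumes "free.subspace N" "\<And>u v. w = u @ T # v \<Longrightarrow> \<Phi> (monomial u) (monomial v) - c \<in> N"
  shows "tcut_word \<Phi> w - of_nat (word_deg ext_t_deg w) * c \<in> N"
  using assms(2)
proof (induction w arbitrary: \<Phi>)
  case (Cons x w)
  have 1: "tcut_word (\<lambda>u. \<Phi> (monomial [x] * u)) w - of_nat (word_deg ext_t_deg w) * c \<in> N"
  proof (rule Cons.IH)
    show "\<Phi> (monomial [x] * monomial u) (monomial v) - c \<in> N" if "w = u @ T # v" for u v
      using Cons.prems[of "x # u" v] that by (simp add: monomial_Cons[of x u])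
  qed
  show ?case
  proof (cases "x = T")
    case True
    then have "\<Phi> 1 (monomial w) - c \<in> N" using Cons.prems[of "[]" w] by simp
    from free.subspace_add[OF assms(1) this 1] True show ?thesis by (simp add: algebra_simps)
  next
    case False
    then have "ext_t_deg x = 0" by (cases x rule: ext_gen_cases) auto
    then show ?thesis using 1 False by simp
  qed
qed (simp add: free.subspace_0[OF assms(1)])

lemma tcut_add: "tcut (\<lambda>u v. \<Phi> u v + \<Psi> u v) f = tcut \<Phi> f + tcut \<Psi> f"
proof (rule lin_eqI[of "tcut (\<lambda>u v. \<Phi> u v + \<Psi> u v)"])
  show "tcut (\<lambda>u v. \<Phi> u v + \<Psi> u v) (monomial w) = tcut \<Phi> (monomial w) + tcut \<Psi> (monomial w)" for w
    unfolding tcut_monomial by (induction w arbitrary: \<Phi> \<Psi>) (auto simp: algebra_simps)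
qed (intro lin_intros)+

lemma tcut_neg: "tcut (\<lambda>u v. - \<Phi> u v) f = - tcut \<Phi> f"
proof (rule lin_eqI[of "tcut (\<lambda>u v. - \<Phi> u v)"])
  show "tcut (\<lambda>u v. - \<Phi> u v) (monomial w) = - tcut \<Phi> (monomial w)" for w
    unfolding tcut_monomial by (induction w arbitrary: \<Phi>) auto
qed (intro lin_intros)+

lemma tcut_lin: assumes "lin L" shows "L (tcut \<Phi> f) = tcut (\<lambda>u v. L (\<Phi> u v)) f"
proof (rule lin_eqI[where f = "\<lambda>f. L (tcut \<Phi> f)"])
  show "L (tcut \<Phi> (monomial w)) = tcut (\<lambda>u v. L (\<Phi> u v)) (monomial w)" for w
    unfolding tcut_monomial
    by (induction w arbitrary: \<Phi>) (auto simp: module_hom.add[OF assms] module_hom.zero[OF assms])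
qed (intro lin_intros lin_compose[OF assms])+

definition bilin :: "(('a, 'k::comm_ring_1) ext_free \<Rightarrow> ('a, 'k) ext_free \<Rightarrow> ('a, 'k) ext_free) \<Rightarrow> bool" where
  "bilin \<Phi> \<longleftrightarrow> (\<forall>u. lin (\<Phi> u)) \<and> (\<forall>v. lin (\<lambda>u. \<Phi> u v))"

lemma bilin_mult_left: assumes "bilin \<Phi>" shows "bilin (\<lambda>u. \<Phi> (y * u))"
  using assms lin_compose[of "\<lambda>u. \<Phi> u v" "\<lambda>u. y * u" for v, OF _ lin_mult_left[OF lin_id]]
  by (simp add: bilin_def)

lemma tcut_mult_word:
  assumes "bilin \<Phi>"
  shows "tcut \<Phi> (monomial w * g) = tcut (\<lambda>u v. \<Phi> u (v * g)) (monomial w) + tcut (\<lambda>u. \<Phi> (monomial w * u)) g"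
  using assms
proof (induction w arbitrary: \<Phi>)
  case Nil
  then show ?case by simp
next
  case (Cons x w)
  have b: "bilin (\<lambda>u. \<Phi> (y * u))" and l: "lin (\<Phi> u)" for y u
    using Cons.prems bilin_mult_left[of \<Phi>] by (auto simp: bilin_def)
  have l': "lin (\<lambda>v. \<Phi> u (v * g))" for u by (rule lin_compose[OF l]) (intro lin_intros)
  show ?case
    by (cases x rule: ext_gen_cases)
      (simp_all add: ext_monomial_Cons tcut_step l l' Cons.IH[OF b] mult.assoc)
qed

lemma bilin_left:
  assumes "bilin \<Phi>"
  shows "\<Phi> (u + v) = (\<lambda>w. \<Phi> u w + \<Phi> v w)" "\<Phi> (- u) = (\<lambda>w. - \<Phi> u w)" "\<Phi> 0 = (\<lambda>w. 0)"
    "\<Phi> (fscale c u) = (\<lambda>w. fscale c (\<Phi> u w))"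
proof -
  have l: "lin (\<lambda>u. \<Phi> u v)" for v using assms by (simp add: bilin_def)
  show "\<Phi> (u + v) = (\<lambda>w. \<Phi> u w + \<Phi> v w)" by (rule ext) (rule module_hom.add[OF l])
  show "\<Phi> (- u) = (\<lambda>w. - \<Phi> u w)" by (rule ext) (rule module_hom.neg[OF l])
  show "\<Phi> 0 = (\<lambda>w. 0)" by (rule ext) (rule module_hom.zero[OF l])
  show "\<Phi> (fscale c u) = (\<lambda>w. fscale c (\<Phi> u w))" by (rule ext) (rule module_hom.scale[OF l])
qed

lemma tcut_mult:
  fixes \<Phi> :: "('a, 'k::comm_ring_1) ext_free \<Rightarrow> ('a, 'k) ext_free \<Rightarrow> ('a, 'k) ext_free"
  assumes "bilin \<Phi>"
  shows "tcut \<Phi> (f * g) = tcut (\<lambda>u v. \<Phi> u (v * g)) f + tcut (\<lambda>u. \<Phi> (f * u)) g"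
proof (rule lin_eqI[where f = "\<lambda>f. tcut \<Phi> (f * g)"])
  show "lin (\<lambda>f. tcut (\<lambda>u v. \<Phi> u (v * g)) f + tcut (\<lambda>u. \<Phi> (f * u)) g)"
  proof (intro lin_plus lin_tcut linI)
    fix x y :: "('a, 'k) ext_free" and c
    show "tcut (\<lambda>u. \<Phi> ((x + y) * u)) g = tcut (\<lambda>u. \<Phi> (x * u)) g + tcut (\<lambda>u. \<Phi> (y * u)) g"
      by (simp add: distrib_right bilin_left[OF assms] tcut_add)
    show "tcut (\<lambda>u. \<Phi> (fscale c x * u)) g = fscale c (tcut (\<lambda>u. \<Phi> (x * u)) g)"
      by (simp add: fscale_mult_left bilin_left[OF assms] tcut_lin[OF lin_fscale[OF lin_id]])
  qed
qed (auto intro!: lin_intros tcut_mult_word assms)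

lemma tcut_ext_d:
  assumes "bilin \<Phi>"
  shows "tcut \<Phi> (ext_d f) = tcut (\<lambda>u. \<Phi> (ext_d u)) f + tcut (\<lambda>u v. \<Phi> (sg u) (ext_d v)) f"
proof (rule lin_eqI[where f = "\<lambda>f. tcut \<Phi> (ext_d f)"])
  fix w
  show "tcut \<Phi> (ext_d (monomial w)) =
      tcut (\<lambda>u. \<Phi> (ext_d u)) (monomial w) + tcut (\<lambda>u v. \<Phi> (sg u) (ext_d v)) (monomial w)"
    using assms
  proof (induction w arbitrary: \<Phi>)
    case Nil
    then show ?case by simp
  next
    case (Cons x w)
    have b: "bilin (\<lambda>u. \<Phi> (y * u))" and l: "lin (\<Phi> u)" for y u
      using Cons.prems bilin_mult_left[of \<Phi>] by (auto simp: bilin_def)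
    have l': "lin (\<lambda>v. \<Phi> u (ext_d v))" for u by (rule lin_compose[OF l lin_ext_d])
    note ls = bilin_left[OF Cons.prems]
    show ?case
      by (cases x rule: ext_gen_cases)
        (simp_all add: ext_monomial_Cons tcut_step l l' Cons.IH[OF b] par_mult ls tcut_add tcut_neg)
  qed
qed (intro lin_intros)+

lemma tcut_t_free:
  assumes "f \<in> homog ext_t_deg 0" shows "tcut \<Phi> f = 0"
proof (rule homog_lin_eqI[OF assms lin_tcut lin_zero])
  show "tcut \<Phi> (monomial w) = 0" if "word_deg ext_t_deg w = 0" for w
    using that unfolding tcut_monomial
  proof (induction w arbitrary: \<Phi>)
    case (Cons x w)
    then show ?case by (cases x rule: ext_gen_cases) auto
  qed simp
qed

text \<open>\<open>v u\<close> with its Koszul sign. For a word \<open>u t v\<close> this is the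
  cyclic word read from behind the \<open>t\<close> that is removed.\<close>

definition flip :: "('a, 'k::comm_ring_1) ext_free \<Rightarrow> ('a, 'k) ext_free \<Rightarrow> ('a, 'k) ext_free" where
  "flip f g = lin_ext (\<lambda>u. lin_ext (\<lambda>v. (-1) ^ (word_deg ext_form_deg u * word_deg ext_form_deg v) *
     monomial (v @ u)) g) f"

lemma flip_monomial:
  "flip (monomial u) (monomial v) =
     (-1) ^ (word_deg ext_form_deg u * word_deg ext_form_deg v) * (monomial v * monomial u)"
  by (simp add: flip_def monomial_append)

lemma lin_flip:
  fixes f g :: "('a, 'k::comm_ring_1) ext_free"
  shows "lin (flip f)" "lin (\<lambda>f. flip f g)"
proof -
  show "lin (\<lambda>f. flip f g)" unfolding flip_def by (intro lin_intros)
  then have l: "lin (\<lambda>f. flip f g)" for g :: "('a, 'k) ext_free" unfolding flip_def by (intro lin_intros)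
  show "lin (flip f)"
  proof (induction f rule: free_alg_induct)
    case (add x y)
    have "flip (x + y) = (\<lambda>g. flip x g + flip y g)" by (rule ext) (rule module_hom.add[OF l])
    then show ?case using lin_plus[OF add] by (simp only:)
  next
    case (scale c x)
    have "flip (fscale c x) = (\<lambda>g. fscale c (flip x g))" by (rule ext) (rule module_hom.scale[OF l])
    then show ?case using lin_fscale[OF scale] by (simp only:)
  next
    case (monomial w)
    show ?case unfolding flip_def by (simp add: lin_intros)
  qed
qed

lemma bilin_flip: "bilin flip"
  by (simp add: bilin_def lin_flip)

lemma flip_left_monomial:
  fixes g :: "('a, 'k::comm_ring_1) ext_free"
  shows "flip (monomial u) g = (if even (word_deg ext_form_deg u) then g else sg g) * monomial u"
proof (rule lin_eqI[of "flip (monomial u)" _ g])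
  fix w :: "'a ext_gen list"
  show "flip (monomial u) (monomial w) =
      (if even (word_deg ext_form_deg u) then monomial w else sg (monomial w)) * monomial u"
    by (cases "even (word_deg ext_form_deg w)") (simp_all add: flip_monomial)
qed (cases "even (word_deg ext_form_deg u)"; auto intro!: lin_flip lin_intros)+

lemma flip_right_monomial:
  fixes f :: "('a, 'k::comm_ring_1) ext_free"
  shows "flip f (monomial v) = monomial v * (if even (word_deg ext_form_deg v) then f else sg f)"
proof (rule lin_eqI[of "\<lambda>f. flip f (monomial v)" _ f])
  fix w :: "'a ext_gen list"
  show "flip (monomial w) (monomial v) =
      monomial v * (if even (word_deg ext_form_deg v) then monomial w else sg (monomial w))"
    by (cases "even (word_deg ext_form_deg w)") (simp_all add: flip_monomial)
qed (cases "even (word_deg ext_form_deg v)"; auto intro!: lin_flip lin_intros)+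

lemma ext_d_flip: "ext_d (flip f g) = flip (ext_d f) g + flip (sg f) (ext_d g)"
proof (rule lin_eqI[where f = "\<lambda>f. ext_d (flip f g)" and x = f])
  fix u
  show "ext_d (flip (monomial u) g) = flip (ext_d (monomial u)) g + flip (sg (monomial u)) (ext_d g)"
  proof (rule lin_eqI[where f = "\<lambda>g. ext_d (flip (monomial u) g)" and x = g])
    fix v
    show "ext_d (flip (monomial u) (monomial v)) =
        flip (ext_d (monomial u)) (monomial v) + flip (sg (monomial u)) (ext_d (monomial v))"
      unfolding flip_left_monomial flip_right_monomial
      by (cases "even (word_deg ext_form_deg u)"; cases "even (word_deg ext_form_deg v)")
        (simp_all add: flip_left_monomial ext_d_mult sg_ext_d module_hom.neg[OF lin_flip(2)])
  qed (auto intro!: lin_intros lin_flip lin_compose[OF lin_ext_d] lin_compose[OF lin_flip(1)])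
qed (auto intro!: lin_intros lin_flip lin_compose[OF lin_ext_d] lin_compose[OF lin_flip(2)])

text \<open>As \<open>d\<close> neither creates nor destroys a \<open>t\<close>, the cuts before and
  after it correspond, and with the sign in \<open>flip\<close> it acts on the two pieces as a
  superderivation.\<close>

lemma ext_d_tcut_flip: "ext_d (tcut flip f) = tcut flip (ext_d f)"
  unfolding tcut_lin[OF lin_ext_d] tcut_ext_d[OF bilin_flip] ext_d_flip tcut_add ..

context split_form_algebra
begin

lemma flip_I: "g \<in> I \<Longrightarrow> flip f g \<in> I" "f \<in> I \<Longrightarrow> flip f g \<in> I"
proof -
  show "flip f g \<in> I" if "g \<in> I"
    by (rule lin_memI[OF lin_flip(2) subspaces(1)])
      (use that in \<open>auto simp: flip_left_monomial intro: I_mult_right sg_I\<close>)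
  show "flip f g \<in> I" if "f \<in> I"
    by (rule lin_memI[OF lin_flip(1) subspaces(1)])
      (use that in \<open>auto simp: flip_right_monomial intro: I_mult_left sg_I\<close>)
qed

lemma tcut_mem: assumes "free.subspace N" "\<And>u v. \<Phi> u v \<in> N" shows "tcut \<Phi> f \<in> N"
proof (rule lin_memI[OF lin_tcut assms(1)])
  show "tcut \<Phi> (monomial w) \<in> N" for w
    using tcut_word_mem[OF assms(1), of w \<Phi> 0] assms(2) by (simp add: tcut_monomial)
qed

text \<open>The relations contain no \<open>t\<close>, so each cut falls to the left or to the right
  of the relation and leaves it intact.\<close>

lemma tcut_flip_I: assumes "f \<in> I" shows "tcut flip f \<in> I"
proof (rule lin_span_memI[OF assms[unfolded ext_ideal_def two_sided_ideal_def] lin_tcut subspaces(1)], safe)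
  fix u v s :: "('a, 'k) ext_free" assume s: "s \<in> form_rels scale ext_elt ext_dif"
  then have sI: "s \<in> I" by (simp add: ext_ideal_def ideal_gen)
  have st: "s \<in> homog ext_t_deg 0"
  proof -
    have e: "ext_elt a \<in> homog ext_t_deg 0" "ext_dif a \<in> homog ext_t_deg 0" for a
      using homog_gen[of ext_t_deg a] by auto
    have m: "x * y \<in> homog ext_t_deg 0" if "x \<in> homog ext_t_deg 0" "y \<in> homog ext_t_deg 0" for x y :: "('a, 'k) ext_free"
      using homog_mult[OF that] by simp
    show ?thesis
      using s by (rule form_rels_cases)
        (intro free.subspace_diff[OF subspace_homog] free.subspace_add[OF subspace_homog]
          free.subspace_scale[OF subspace_homog] e m one_in_homog)+
  qed
  have *: "tcut flip (monomial u * (s * v)) \<in> I" for u v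
  proof -
    have 1: "tcut (\<lambda>p q. flip p (q * (s * v))) (monomial u) \<in> I"
      by (intro tcut_mem subspaces flip_I I_mult_left I_mult_right sI)
    have 2: "tcut (\<lambda>p. flip (monomial u * p)) (s * v) \<in> I"
      unfolding tcut_mult[OF bilin_mult_left[OF bilin_flip]]
      using tcut_t_free[OF st] by (simp add: tcut_mem flip_I I_mult_left I_mult_right sI)
    show ?thesis unfolding tcut_mult[OF bilin_flip] by (rule I_add[OF 1 2])
  qed
  have "tcut flip (u * (s * v)) \<in> I"
    by (rule lin_memI[where f = "\<lambda>u. tcut flip (u * (s * v))", OF _ subspaces(1) *]) (intro lin_intros)
  then show "tcut flip (u * s * v) \<in> I" by (simp add: mult.assoc)
qed

text \<open>Cutting at all letters \<open>t\<close> does not depend on where the cyclic word was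
  opened: moving \<open>x\<close> to the other end permutes nothing but the signs, and these agree
  with the sign of the supercommutator.\<close>

lemma tcut_flip_letter_comm:
  fixes x :: "'a ext_gen"
  shows "tcut flip (letter_comm ext_form_deg x w :: ('a, 'k) ext_free) = 0"
proof -
  let ?s = "(-1) ^ (ext_form_deg x * word_deg ext_form_deg w) :: ('a, 'k) ext_free"
  have sgn: "tcut flip (?s * f) = ?s * tcut flip f" for f
    by (cases "even (ext_form_deg x * word_deg ext_form_deg w)") simp_all
  have 1: "tcut (\<lambda>u v. flip u (v * monomial w)) (monomial [x]) = ?s * tcut (\<lambda>u. flip (monomial w * u)) (monomial [x])"
    by (cases x rule: ext_gen_cases)
      (simp_all add: tcut_monomial flip_left_monomial[of "[]", simplified] flip_right_monomial[of _ "[]", simplified])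
  have 2: "tcut (\<lambda>u. flip (monomial [x] * u)) (monomial w) = ?s * tcut (\<lambda>u v. flip u (v * monomial [x])) (monomial w)"
  proof -
    have "?s * tcut (\<lambda>u v. flip u (v * monomial [x])) (monomial w) =
       tcut (\<lambda>u v. ?s * flip u (v * monomial [x])) (monomial w)"
      by (rule tcut_lin) (intro lin_intros)
    also have "\<dots> = tcut (\<lambda>u. flip (monomial [x] * u)) (monomial w)"
      unfolding tcut_monomial
    proof (rule tcut_word_cong)
      fix u v assume w: "w = u @ T # v"
      show "?s * flip (monomial u) (monomial v * monomial [x]) = flip (monomial [x] * monomial u) (monomial v)"
        unfolding monomial_append[symmetric] flip_monomial
        by (cases "even (ext_form_deg x)"; cases "even (word_deg ext_form_deg u)"; cases "even (word_deg ext_form_deg v)")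
          (simp_all add: w)
    qed
    finally show ?thesis by simp
  qed
  have "tcut flip (monomial [x] * monomial w) = ?s * tcut flip (monomial w * monomial [x])"
    unfolding tcut_mult[OF bilin_flip] 1 2 by (simp add: distrib_left)
  then show ?thesis by (simp add: letter_comm_def sgn)
qed

lemma tcut_flip_DR: assumes "f \<in> DR" shows "tcut flip f \<in> TI"
proof (rule lin_span_memI[OF assms[unfolded reduced_DR_sub_def] lin_tcut subspace_TI])
  fix s :: "('a, 'k) ext_free" assume "s \<in> I \<union> supercommutators ext_form_deg \<union> range ((^) ext_t)"
  then consider "s \<in> I" | "s \<in> supercommutators ext_form_deg" | k where "s = ext_t ^ k" by blast
  then show "tcut flip s \<in> TI"
  proof cases
    case 1
    then show ?thesis by (intro I_sub_TI tcut_flip_I)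
  next
    case 2
    show ?thesis
      by (rule lin_span_memI[OF supercommutators_span[OF 2] lin_tcut subspace_TI])
        (auto simp: tcut_flip_letter_comm free.subspace_0)
  next
    case 3
    have m: "monomial (replicate j T) = (ext_t ^ j :: ('a, 'k) ext_free)" for j
      by (induction j) (auto simp: ext_monomial_Cons)
    have "(tcut_word flip (replicate k T) :: ('a, 'k) ext_free) - of_nat (word_deg ext_t_deg (replicate k (T :: 'a ext_gen))) * 0 \<in> TI"
    proof (rule tcut_word_mem[OF subspace_TI])
      fix u v :: "'a ext_gen list" assume uv: "replicate k T = u @ T # v"
      have "\<forall>x\<in>set (u @ T # v). x = T" unfolding uv[symmetric] by simp
      then have "u = replicate (length u) T" "v = replicate (length v) T"
        by (auto simp: replicate_length_same)
      then obtain i j where ij: "u = replicate i T" "v = replicate j T" by blast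
      have "(flip (monomial u) (monomial v) :: ('a, 'k) ext_free) = monomial v * monomial u"
        unfolding flip_monomial by (simp add: ij word_deg_def sum_list_replicate)
      then show "(flip (monomial u) (monomial v) :: ('a, 'k) ext_free) - 0 \<in> TI"
        using t_power_TI[of "j + i"] by (simp add: ij m power_add)
    qed
    then show ?thesis by (simp add: 3 tcut_monomial flip: m)
  qed
qed

text \<open>Closing up the piece \<open>v u\<close> with a \<open>t\<close> recovers the cyclic word
  of \<open>u t v\<close>, once for each of the \<open>q\<close> letters \<open>t\<close>.\<close>

lemma tcut_flip_mult_t:
  assumes "f \<in> homog ext_t_deg q" shows "tcut flip f * ext_t - of_nat q * f \<in> DR"
proof (rule homog_lin_memI[OF assms, where \<phi> = "\<lambda>f. tcut flip f * ext_t - of_nat q * f"])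
  fix w :: "'a ext_gen list" assume q: "word_deg ext_t_deg w = q"
  have "(tcut flip (monomial w) :: ('a, 'k) ext_free) * ext_t = tcut_word (\<lambda>u v. flip u v * ext_t) w"
    by (simp only: tcut_lin[OF lin_mult_right[OF lin_id]] tcut_monomial[symmetric])
  moreover have "tcut_word (\<lambda>u v. flip u v * ext_t) w - of_nat (word_deg ext_t_deg w) * monomial w \<in> DR"
  proof (rule tcut_word_mem[OF subspaces(3)])
    fix u v :: "'a ext_gen list" assume w: "w = u @ T # v"
    let ?s = "(-1) ^ (word_deg ext_form_deg u * word_deg ext_form_deg v) :: ('a, 'k) ext_free"
    have u: "(monomial (u @ [T]) :: ('a, 'k) ext_free) \<in> homog ext_form_deg (word_deg ext_form_deg u)"
      by (rule monomial_in_homog) simp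
    have "monomial (u @ [T]) * monomial v - ?s * (monomial v * monomial (u @ [T])) \<in> DR"
      by (rule super_DR[OF u monomial_in_homog[OF refl]])
    from free.subspace_neg[OF subspaces(3) this]
    show "flip (monomial u) (monomial v) * ext_t - monomial w \<in> DR"
      by (rule memI) (simp add: w flip_monomial monomial_append ext_monomial_Cons ext_gen_monomial mult.assoc)
  qed
  ultimately show "tcut flip (monomial w) * ext_t - of_nat q * monomial w \<in> DR" by (simp add: q)
qed (auto intro!: lin_intros)

text \<open>Cutting turns a closed cyclic word into a closed linear one, which has a primitive
  modulo \<open>k[t]\<close>. Multiplying by \<open>t\<close> closes the words again and yields a
  primitive of \<open>q + 1\<close> times \<open>f\<close>.\<close>

lemma Poincare_DR:
  assumes f: "f \<in> homog ext_t_deg (Suc q)" "ext_d f \<in> DR" shows "f \<in> DRd"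
proof -
  let ?\<alpha> = "tcut flip f"
  have "ext_d ?\<alpha> \<in> TI" unfolding ext_d_tcut_flip by (rule tcut_flip_DR[OF f(2)])
  then have "?\<alpha> - ext_d (con r 1 ?\<alpha>) \<in> TI" by (rule ext_d_exact)
  moreover have "x * ext_t \<in> DR" if "x \<in> TI" for x
    using that unfolding TI_def
    by (rule lin_span_memI[where f = "\<lambda>x. x * ext_t"])
      (auto intro!: lin_intros intro: I_sub_DR I_mult_right t_power_DR[of "Suc _", unfolded power_Suc2])
  ultimately have "(?\<alpha> - ext_d (con r 1 ?\<alpha>)) * ext_t \<in> DR" by blast
  then have "?\<alpha> * ext_t - ext_d (con r 1 ?\<alpha> * ext_t) \<in> DR"
    by (simp add: left_diff_distrib ext_d_mult)
  from free.subspace_diff[OF subspaces(3) tcut_flip_mult_t[OF f(1)] this]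
  have "- (of_nat (Suc q) * f - ext_d (con r 1 ?\<alpha> * ext_t)) \<in> DR" by (simp add: algebra_simps)
  from free.subspace_neg[OF subspaces(3) this]
  have "of_nat (Suc q) * f - ext_d (con r 1 ?\<alpha> * ext_t) \<in> DR" by simp
  from free.subspace_add[OF subspace_add_image add_image_base[OF this] add_image_range, of ext_d "con r 1 ?\<alpha> * ext_t"]
  have "of_nat (Suc q) * f \<in> DRd" by (simp add: DRd_def)
  then show ?thesis by (rule divide_mem[of DRd "Suc q", rotated -1]) (simp_all add: DRd_def)
qed

end

section \<open>The Tsygan map and the Connes operator\<close>

lemma geo_eq_sum: "geo X q = (\<Sum>k\<le>q. ext_t ^ k * X (q - k))"
proof (induction q)
  case (Suc q)
  have "(\<Sum>k\<le>Suc q. ext_t ^ k * X (Suc q - k)) = X (Suc q) + (\<Sum>k\<le>q. ext_t ^ Suc k * X (q - k))"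
    by (subst sum.atMost_Suc_shift) simp
  then show ?case by (simp add: Suc sum_distrib_left mult.assoc)
qed simp

text \<open>On generating series this is
  \<open>db\<^sub>1 G db\<^sub>2 G ... db\<^sub>m G X\<close>, with \<open>G\<close> the geometric
  series in \<open>t\<close>. For \<open>X = unit_seq\<close> it is the sum of the words that start
  with \<open>db\<^sub>1\<close> and have a power of \<open>t\<close> behind every
  differential.\<close>

primrec dprod :: "'a list \<Rightarrow> (nat \<Rightarrow> ('a, 'k::comm_ring_1) ext_free) \<Rightarrow> nat \<Rightarrow> ('a, 'k) ext_free" where
  "dprod [] X = X"
| "dprod (b # bs) X = (\<lambda>q. ext_dif b * geo (dprod bs X) q)"

definition unit_seq :: "nat \<Rightarrow> ('a, 'k::comm_ring_1) ext_free" where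
  "unit_seq q = (if q = 0 then 1 else 0)"

lemma geo_unit_seq: "geo unit_seq q = ext_t ^ q"
  by (induction q) (simp_all add: unit_seq_def)

lemma tsy_pd: "tsy q (pd as) = geo (dprod as unit_seq) q"
proof (induction as arbitrary: q)
  case (Cons a as)
  then show ?case by (simp add: tsy_pd_Cons del: list.map prod_list.Cons)
qed (simp add: geo_unit_seq)

lemma geo_convolution:
  "geo (\<lambda>k. \<Sum>i\<le>k. A i * X (k - i)) q = (\<Sum>i\<le>q. geo A i * X (q - i))"
proof (induction q)
  case (Suc q)
  have "(\<Sum>i\<le>Suc q. geo A i * X (Suc q - i)) = A 0 * X (Suc q) + (\<Sum>i\<le>q. geo A (Suc i) * X (q - i))"
    by (subst sum.atMost_Suc_shift) simp
  also have "\<dots> = A 0 * X (Suc q) + (\<Sum>i\<le>q. A (Suc i) * X (q - i)) + ext_t * (\<Sum>i\<le>q. geo A i * X (q - i))"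
    by (simp add: distrib_right sum.distrib sum_distrib_left mult.assoc)
  also have "A 0 * X (Suc q) + (\<Sum>i\<le>q. A (Suc i) * X (q - i)) = (\<Sum>i\<le>Suc q. A i * X (Suc q - i))"
    using sum.atMost_Suc_shift[of "\<lambda>i. A i * X (Suc q - i)" q] by simp
  finally show ?case by (simp add: Suc)
qed simp

lemma dprod_convolution: "dprod as X q = (\<Sum>i\<le>q. dprod as unit_seq i * X (q - i))"
proof (induction as arbitrary: q)
  case Nil
  have "(\<Sum>i\<le>q. unit_seq i * X (q - i)) = (\<Sum>i\<le>q. if i = 0 then X q else 0)"
    by (rule sum.cong) (auto simp: unit_seq_def)
  then show ?case by simp
next
  case (Cons a as)
  have "dprod as X = (\<lambda>q. \<Sum>i\<le>q. dprod as unit_seq i * X (q - i))"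
    using Cons by (intro ext)
  then have "dprod (a # as) X q = ext_dif a * (\<Sum>i\<le>q. geo (dprod as unit_seq) i * X (q - i))"
    by (simp only: dprod.simps geo_convolution)
  then show ?case by (simp add: sum_distrib_left mult.assoc)
qed

lemma dprod_append: "dprod (as @ bs) X = dprod as (dprod bs X)"
  by (induction as) simp_all

text \<open>For \<open>i + j = q\<close> the product of \<open>t^i\<close> and \<open>A j\<close>
  occurs \<open>i + 1\<close> times in the first sum and \<open>j + m\<close> times in the
  second.\<close>

lemma geo_of_nat:
  "geo (geo A) q + geo (\<lambda>k. of_nat (k + m) * A k) q = of_nat (Suc (q + m)) * geo A q"
proof (induction q)
  case 0
  then show ?case by (simp add: distrib_right)
next
  case (Suc q)
  have "geo (geo A) (Suc q) + geo (\<lambda>k. of_nat (k + m) * A k) (Suc q) =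
      geo A (Suc q) + of_nat (Suc q + m) * A (Suc q)
        + ext_t * (geo (geo A) q + geo (\<lambda>k. of_nat (k + m) * A k) q)"
    by (simp add: algebra_simps)
  also have "\<dots> = geo A (Suc q) + of_nat (Suc (q + m)) * geo A (Suc q)"
    unfolding Suc by (simp add: of_nat_left_commute distrib_left del: of_nat_Suc of_nat_add)
  finally show ?case by (simp add: distrib_right)
qed

lemma geo_sum: "geo (\<lambda>k. \<Sum>j\<in>S. X j k) q = (\<Sum>j\<in>S. geo (X j) q)"
  by (induction q) (simp_all add: sum.distrib sum_distrib_left)

text \<open>Cutting a cyclic word \<open>da\<^sub>1 t\<^bsup>k\<^sub>1\<^esup> \<cdots> da\<^sub>n t\<^bsup>k\<^sub>n\<^esup>\<close> inside one of the powers of \<open>t\<close> can be done in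
  \<open>(k\<^sub>1 + 1) + \<cdots> + (k\<^sub>n + 1)\<close> ways.\<close>

lemma sum_cuts:
  fixes as :: "'a list"
  shows "(\<Sum>j<length as. dprod (take (Suc j) as) (geo (dprod (drop (Suc j) as) unit_seq)) q :: ('a, 'k::comm_ring_1) ext_free) =
     of_nat (q + length as) * dprod as unit_seq q"
proof (induction as arbitrary: q)
  case Nil
  then show ?case by (simp add: unit_seq_def)
next
  case (Cons b bs)
  let ?u = "unit_seq :: nat \<Rightarrow> ('a, 'k) ext_free"
  let ?A = "dprod bs ?u"
  have "(\<Sum>j<length (b # bs). dprod (take (Suc j) (b # bs)) (geo (dprod (drop (Suc j) (b # bs)) ?u)) q)
     = ext_dif b * geo (geo ?A) q +
       (\<Sum>j<length bs. ext_dif b * geo (dprod (take (Suc j) bs) (geo (dprod (drop (Suc j) bs) ?u))) q)"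
    by (simp only: length_Cons sum.lessThan_Suc_shift) simp
  also have "(\<Sum>j<length bs. ext_dif b * geo (dprod (take (Suc j) bs) (geo (dprod (drop (Suc j) bs) ?u))) q)
     = ext_dif b * geo (\<lambda>k. of_nat (k + length bs) * ?A k) q"
    by (simp only: Cons[symmetric] geo_sum sum_distrib_left)
  also have "ext_dif b * geo (geo ?A) q + ext_dif b * geo (\<lambda>k. of_nat (k + length bs) * ?A k) q =
      ext_dif b * (of_nat (Suc (q + length bs)) * geo ?A q)"
    by (simp only: geo_of_nat flip: distrib_left)
  finally show ?case by (simp add: of_nat_left_commute del: of_nat_Suc of_nat_add)
qed

lemma dprod_homog:
  fixes as :: "'a list"
  shows "(dprod as unit_seq q :: ('a, 'k::comm_ring_1) ext_free) \<in> homog ext_form_deg (length as)"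
proof (induction as arbitrary: q)
  case Nil
  then show ?case by (simp add: unit_seq_def one_in_homog free.subspace_0[OF subspace_homog])
next
  case (Cons a as)
  have t: "(ext_t ^ k :: ('a, 'k) ext_free) \<in> homog ext_form_deg 0" for k
    using t_power_homog by (auto simp: ext_homog_def)
  have "(geo (dprod as unit_seq) q :: ('a, 'k) ext_free) \<in> homog ext_form_deg (length as)"
    unfolding geo_eq_sum using homog_mult[OF t Cons] by (intro free.subspace_sum[OF subspace_homog]) simp
  from homog_mult[OF _ this, of "ext_dif a" 1] show ?case
    by (simp add: ext_dif_def monomial_in_homog)
qed

lemma ext_d_tsy_pd: "ext_d (tsy q (pd as)) = 0"
proof (induction as arbitrary: q)
  case (Cons a as)
  then show ?case unfolding tsy_pd_Cons by (simp add: ext_d_geo)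
qed simp

context form_algebra
begin

text \<open>The series of a concatenation is a product of two series, whose factors may be exchanged
  up to supercommutators. Afterwards the power of \<open>t\<close> behind the last differential of
  \<open>ys\<close> meets the one in front of \<open>zs\<close>, so the two together are a power of
  \<open>t\<close> with a cut in it.\<close>

lemma tsy_rotate:
  "tsy q (pd (zs @ ys)) - (-1) ^ (length zs * length ys) * dprod ys (geo (dprod zs unit_seq)) q \<in> DR"
proof -
  let ?A = "geo (dprod zs unit_seq) :: nat \<Rightarrow> ('a, 'k) ext_free"
  let ?B = "dprod ys unit_seq :: nat \<Rightarrow> ('a, 'k) ext_free"
  let ?s = "(-1) ^ (length zs * length ys) :: ('a, 'k) ext_free"
  have t: "(ext_t ^ k :: ('a, 'k) ext_free) \<in> homog ext_form_deg 0" for k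
    using t_power_homog by (auto simp: ext_homog_def)
  have A: "?A i \<in> homog ext_form_deg (length zs)" for i
    unfolding geo_eq_sum using homog_mult[OF t dprod_homog] by (intro free.subspace_sum[OF subspace_homog]) simp
  have "dprod zs ?B = (\<lambda>k. \<Sum>i\<le>k. dprod zs unit_seq i * ?B (k - i))"
    by (intro ext dprod_convolution)
  then have 1: "tsy q (pd (zs @ ys)) = (\<Sum>i\<le>q. ?A i * ?B (q - i))"
    by (simp only: tsy_pd dprod_append geo_convolution)
  have "dprod ys ?A q = (\<Sum>i\<le>q. ?B i * ?A (q - i))"
    by (rule dprod_convolution)
  also have "\<dots> = (\<Sum>i\<le>q. ?B (q - i) * ?A i)"
    using sum.nat_diff_reindex[of "\<lambda>i. ?B i * ?A (q - i)" "Suc q"] by (simp add: lessThan_Suc_atMost)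
  finally have 2: "?s * dprod ys ?A q = (\<Sum>i\<le>q. ?s * (?B (q - i) * ?A i))"
    by (simp add: sum_distrib_left)
  show ?thesis unfolding 1 2 sum_subtractf[symmetric]
    by (intro free.subspace_sum[OF subspaces(3)] super_DR[OF A dprod_homog])
qed

text \<open>The \<open>n + 1\<close> terms of \<open>B\<close> are the rotations of
  \<open>da\<^sub>0 ... da\<^sub>n\<close>. Rotated back to begin with \<open>da\<^sub>0\<close>,
  their Tsygan sums list each word once for every place where one of its powers of \<open>t\<close>
  can be cut, which makes \<open>q + n + 1\<close> times.\<close>

lemma tsy_form_B:
  assumes x: "x \<in> homog form_deg n"
  shows "tsy q (form_B x) - of_nat (Suc (q + n)) * ext_d (tsy q x) \<in> DR"
proof (rule form_normal_cong[OF x])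
  fix a and bs :: "'a list" assume n: "length bs = n"
  let ?as = "a # bs"
  have hom: "(elt a * pd bs :: ('a, 'k) form_free) \<in> homog form_deg n"
    using homog_mult[OF elt_homog pd_homog] n by fastforce
  have k: "(kap ^^ j) (pd ?as :: ('a, 'k) form_free) = (-1) ^ (j * (Suc n - j)) *
      pd (drop (Suc n - j) ?as @ take (Suc n - j) ?as)" if "j \<le> n" for j
  proof -
    let ?i = "Suc n - j"
    have "length (drop ?i ?as) = j" "length (take ?i ?as) = ?i" using that n by auto
    moreover have "pd ?as = (pd (take ?i ?as) * pd (drop ?i ?as) :: ('a, 'k) form_free)"
      by (simp only: append_take_drop_id flip: prod_list.append map_append)
    ultimately show ?thesis
      using kap_power_pd[OF pd_homog, of "drop ?i ?as" "take ?i ?as"] by simp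
  qed
  have s: "tsy q ((-1) ^ m * y) = (-1) ^ m * tsy q y" for m and y :: "('a, 'k) form_free"
    by (cases "even m") simp_all
  have B: "tsy q (form_B (elt a * pd bs :: ('a, 'k) form_free)) = (\<Sum>j<Suc n. (-1) ^ (j * (Suc n - j)) *
      tsy q (pd (drop (Suc n - j) ?as @ take (Suc n - j) ?as)))"
    unfolding form_B_homog[OF hom] module_hom.sum[OF lin_tsy] lessThan_Suc_atMost
  proof (rule sum.cong[OF refl])
    fix j assume "j \<in> {..n}"
    then have "j \<le> n" by simp
    moreover have "form_d (elt a * pd bs :: ('a, 'k) form_free) = pd ?as" by simp
    ultimately show "tsy q ((kap ^^ j) (form_d (elt a * pd bs :: ('a, 'k) form_free))) =
        (-1) ^ (j * (Suc n - j)) * tsy q (pd (drop (Suc n - j) ?as @ take (Suc n - j) ?as))"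
      by (simp only: k s)
  qed
  have "tsy q (form_B (elt a * pd bs)) - (\<Sum>j<Suc n. dprod (take (Suc n - j) ?as)
      (geo (dprod (drop (Suc n - j) ?as) unit_seq)) q) \<in> DR"
    unfolding B sum_subtractf[symmetric]
  proof (rule free.subspace_sum[OF subspaces(3)])
    fix j assume "j \<in> {..<Suc n}"
    then have l: "length (drop (Suc n - j) ?as) = j" "length (take (Suc n - j) ?as) = Suc n - j"
      using n by auto
    from tsy_rotate[of q "drop (Suc n - j) ?as" "take (Suc n - j) ?as"]
    have "tsy q (pd (drop (Suc n - j) ?as @ take (Suc n - j) ?as)) - (-1) ^ (j * (Suc n - j)) *
        dprod (take (Suc n - j) ?as) (geo (dprod (drop (Suc n - j) ?as) unit_seq)) q \<in> DR"
      unfolding l .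
    from this free.subspace_neg[OF subspaces(3) this]
    show "(-1) ^ (j * (Suc n - j)) * tsy q (pd (drop (Suc n - j) ?as @ take (Suc n - j) ?as)) -
       dprod (take (Suc n - j) ?as) (geo (dprod (drop (Suc n - j) ?as) unit_seq)) q \<in> DR"
      by (cases "even (j * (Suc n - j))") (auto simp del: even_mult_iff)
  qed
  also have "(\<Sum>j<Suc n. dprod (take (Suc n - j) ?as) (geo (dprod (drop (Suc n - j) ?as) unit_seq)) q) =
     (\<Sum>j<Suc n. dprod (take (Suc j) ?as) (geo (dprod (drop (Suc j) ?as) unit_seq)) q)"
    using sum.nat_diff_reindex[of "\<lambda>j. dprod (take (Suc j) ?as) (geo (dprod (drop (Suc j) ?as) unit_seq)) q" "Suc n"]
    by (simp add: Suc_diff_le cong: sum.cong_simp)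
  also have "\<dots> = of_nat (Suc (q + n)) * dprod ?as unit_seq q"
    using sum_cuts[of ?as q] n by simp
  also have "dprod ?as unit_seq q = ext_d (tsy q (elt a * pd bs))"
    by (simp add: ext_d_tsy_pd) (simp add: tsy_pd)
  finally show "tsy q (form_B (elt a * pd bs)) - of_nat (Suc (q + n)) * ext_d (tsy q (elt a * pd bs)) \<in> DR" .
qed (auto intro!: lin_intros I_sub_DR tsy_I form_B_I0 I_mult_left ext_d_I)

end

lemma finite_compositions: "finite {ks. length ks = n \<and> sum_list ks = (q::nat)}"
proof (rule finite_subset)
  show "{ks. length ks = n \<and> sum_list ks = q} \<subseteq> {ks. set ks \<subseteq> {..q} \<and> length ks = n}"
    by (auto dest: member_le_sum_list)
qed (rule finite_lists_length_eq, simp)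

lemma sum_compositions_Suc:
  fixes q :: nat
  shows "(\<Sum>ks\<in>{ks. length ks = Suc n \<and> sum_list ks = q}. F ks) =
     (\<Sum>k\<le>q. \<Sum>ks\<in>{ks. length ks = n \<and> sum_list ks = q - k}. F (k # ks))"
proof -
  let ?K = "\<lambda>q. {ks. length ks = n \<and> sum_list ks = q}"
  have "(\<Sum>k\<le>q. \<Sum>ks\<in>?K (q - k). F (k # ks)) = (\<Sum>(k, ks)\<in>(SIGMA k:{..q}. ?K (q - k)). F (k # ks))"
    by (rule sum.Sigma) (auto intro: finite_compositions)
  also have "\<dots> = (\<Sum>ks\<in>{ks. length ks = Suc n \<and> sum_list ks = q}. F ks)"
    by (rule sum.reindex_bij_witness[of _ "\<lambda>ks. (hd ks, tl ks)" "\<lambda>(k, ks). k # ks"])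
      (auto simp: length_Suc_conv)
  finally show ?thesis by simp
qed

lemma sum_compositions_dprod:
  fixes as :: "'a list"
  shows "(\<Sum>ks\<in>{ks. length ks = length as \<and> sum_list ks = q}.
      prod_list (map2 (\<lambda>x k. x * ext_t ^ k) (map ext_dif as) ks)) =
    (dprod as unit_seq q :: ('a, 'k::comm_ring_1) ext_free)"
proof (induction as arbitrary: q)
  case Nil
  have "{ks. length ks = length [] \<and> sum_list ks = q} = (if q = 0 then {[]} else {})" by auto
  then show ?case by (simp add: unit_seq_def)
next
  case (Cons a as)
  have "(\<Sum>ks\<in>{ks. length ks = length (a # as) \<and> sum_list ks = q}.
      prod_list (map2 (\<lambda>x k. x * ext_t ^ k) (map ext_dif (a # as)) ks)) =
    (\<Sum>k\<le>q. ext_dif a * (ext_t ^ k * (dprod as unit_seq (q - k) :: ('a, 'k) ext_free)))"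
    unfolding length_Cons sum_compositions_Suc by (simp add: mult.assoc Cons flip: sum_distrib_left)
  then show ?case by (simp add: geo_eq_sum sum_distrib_left)
qed

context rational_form_algebra
begin

lemma tsygan_value_eq:
  "tsygan_value qscale q a as = fscale (qscale (1 / fact (q + length as)) 1) (tsy q (elt a * pd as))"
proof -
  have "tsygan_value qscale q a as = fscale (qscale (1 / fact (q + length as)) 1)
     (\<Sum>k\<le>q. ext_elt a * (ext_t ^ k * dprod as unit_seq (q - k)))"
    unfolding tsygan_value_def sum_compositions_Suc
    by (simp add: mult.assoc sum_compositions_dprod flip: free.scale_sum_right sum_distrib_left)
  then show ?thesis by (simp add: tsy_pd geo_eq_sum sum_distrib_left)
qed

text \<open>An explicit linear lift of the Tsygan component; the factorial depends on the de Rham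
  degree and is therefore attached word by word.\<close>

definition tsyE :: "nat \<Rightarrow> ('a, 'k) form_free \<Rightarrow> ('a, 'k) ext_free" where
  "tsyE q = lin_ext (\<lambda>w. fscale (qscale (1 / fact (q + word_deg form_deg w)) 1) (tsy_word w q))"

lemma lin_tsyE [lin_intros]: "lin (tsyE q)"
  unfolding tsyE_def by (rule lin_intros)

lemmas lin_compose_tsyE [lin_intros] = lin_compose[OF lin_tsyE]
lemmas tsyE_lin_simps = module_hom.add[OF lin_tsyE] module_hom.diff[OF lin_tsyE]
  module_hom.neg[OF lin_tsyE] module_hom.zero[OF lin_tsyE] module_hom.scale[OF lin_tsyE]

lemma tsyE_homog:
  assumes "x \<in> homog form_deg n" shows "tsyE q x = fscale (qscale (1 / fact (q + n)) 1) (tsy q x)"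
  by (rule homog_lin_eqI[OF assms lin_tsyE]) (auto intro!: lin_intros simp: tsyE_def tsy_monomial)

lemma tsyE_I0: assumes "x \<in> I0" shows "tsyE q x \<in> I"
  by (rule I0_homog_memI[OF assms lin_tsyE subspaces(1)]) (simp add: tsyE_homog I_scale tsy_I)

lemma tsyE_N0: assumes "x \<in> N0" shows "tsyE q x \<in> CA"
  by (rule lin_span_memI[OF assms[unfolded reduced_form_sub_def] lin_tsyE subspaces(2)])
    (auto simp: tsyE_homog[OF one_in_homog] free.subspace_scale I_sub_CA tsyE_I0 t_power_CA)

lemma tsyE_in_homog: "x \<in> homog form_deg n \<Longrightarrow> tsyE q x \<in> ext_homog n q"
  by (simp add: tsyE_homog free.subspace_scale[OF subspace_ext_homog] tsy_homog)

text \<open>\<open>form_b\<close> lowers the de Rham degree by one while the degree in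
  \<open>t\<close> rises by one, so both terms carry the same factorial.\<close>

lemma tsyE_chain: "ext_i (tsyE q x) - tsyE (Suc q) (form_b x) \<in> CA"
proof (rule lin_memI[where f = "\<lambda>x. ext_i (tsyE q x) - tsyE (Suc q) (form_b x)", OF _ subspaces(2)])
  fix w :: "'a form_gen list"
  let ?w = "monomial w :: ('a, 'k) form_free" and ?n = "word_deg form_deg w"
  have w: "?w \<in> homog form_deg ?n" by (rule monomial_in_homog) simp
  have "tsyE (Suc q) (form_b ?w) = fscale (qscale (1 / fact (q + ?n)) 1) (tsy (Suc q) (form_b ?w))"
  proof (cases ?n)
    case 0
    then show ?thesis using w by (simp add: form_b_homog_0 tsyE_lin_simps)
  next
    case (Suc m)
    then show ?thesis using tsyE_homog[OF form_b_homog, of ?w m "Suc q"] w by simp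
  qed
  then have "ext_i (tsyE q ?w) - tsyE (Suc q) (form_b ?w) =
      fscale (qscale (1 / fact (q + ?n)) 1) (ext_i (tsy q ?w) - tsy (Suc q) (form_b ?w))"
    by (simp add: tsyE_homog[OF w] free.scale_right_diff_distrib)
  then show "ext_i (tsyE q ?w) - tsyE (Suc q) (form_b ?w) \<in> CA"
    by (simp add: free.subspace_scale tsy_chain[OF w])
qed (intro lin_intros)

text \<open>Without \<open>t\<close> the map is the inclusion of forms up to a scalar, and
  \<open>b (\<alpha> da)\<close> is, up to sign, a commutator with \<open>a\<close>.\<close>

lemma tsyE_0_form_b: "tsyE 0 (form_b x) \<in> CA"
proof (rule lin_memI[where f = "\<lambda>x. tsyE 0 (form_b x)", OF _ subspaces(2)])
  fix w :: "'a form_gen list"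
  show "tsyE 0 (form_b (monomial w)) \<in> CA"
  proof (rule form_normal_memI[where f = "\<lambda>x. tsyE 0 (form_b x)", OF monomial_in_homog[OF refl]])
    fix a and as :: "'a list"
    show "tsyE 0 (form_b (elt a * pd as)) \<in> CA"
    proof (cases as rule: rev_cases)
      case Nil
      then show ?thesis by (simp add: form_b_homog_0 elt_homog tsyE_lin_simps free.subspace_0)
    next
      case (snoc bs c)
      let ?f = "sg0 (elt a * pd bs) :: ('a, 'k) form_free"
      have 1: "form_b (elt a * pd as) = ?f * elt c - elt c * ?f"
        using form_b_mult_dif[of "elt a * pd bs" c] by (simp add: snoc mult.assoc)
      have "elt a * pd as \<in> (homog form_deg (Suc (length bs)) :: ('a, 'k) form_free set)"
        using homog_mult[OF elt_homog pd_homog, of a as] snoc by simp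
      from tsyE_homog[OF form_b_homog[OF this], of 0]
      have "tsyE 0 (form_b (elt a * pd as)) =
          fscale (qscale (1 / fact (length bs)) 1) (- (ext_elt c * incl ?f - incl ?f * ext_elt c))"
        unfolding 1 by (simp add: tsy_0)
      then show ?thesis
        by (simp only: free.subspace_scale[OF subspaces(2) free.subspace_neg[OF subspaces(2) comm_CA]])
    qed
  qed (auto intro!: lin_intros I_sub_CA tsyE_I0 form_b_I0)
qed (intro lin_intros)

lemma ext_d_of_nat: "ext_d (of_nat m * x) = of_nat m * ext_d x"
  using module_hom.scale[OF lin_ext_d, of "of_nat m" x] by (simp only: fscale_of_nat)

lemma tsyE_form_B: "tsyE q (form_B x) - ext_d (tsyE q x) \<in> DR"
proof (rule lin_memI[where f = "\<lambda>x. tsyE q (form_B x) - ext_d (tsyE q x)", OF _ subspaces(3)])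
  fix w :: "'a form_gen list"
  let ?w = "monomial w :: ('a, 'k) form_free" and ?n = "word_deg form_deg w"
  have w: "?w \<in> homog form_deg ?n" by (rule monomial_in_homog) simp
  \<comment> \<open>\<open>B\<close> raises the degree, so the left-hand term carries
    \<open>(q + n + 1)!\<close> and the other one \<open>(q + n)!\<close>; their ratio is the factor
    found for \<open>tsy\<close>.\<close>
  have "1 / fact (q + ?n) = 1 / fact (q + Suc ?n) * (of_nat (Suc (q + ?n)) :: rat)"
    by (simp add: divide_simps del: of_nat_Suc)
  then have "qscale (1 / fact (q + ?n)) 1 = qscale (1 / fact (q + Suc ?n)) 1 * (of_nat (Suc (q + ?n)) :: 'k)"
    by (simp only: qscale_mult qscale_of_nat)
  then have "ext_d (tsyE q ?w) = fscale (qscale (1 / fact (q + Suc ?n)) 1) (of_nat (Suc (q + ?n)) * ext_d (tsy q ?w))"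
    by (simp only: tsyE_homog[OF w] ext_d_of_nat module_hom.scale[OF lin_ext_d] free.scale_scale[symmetric] fscale_of_nat)
  then have "tsyE q (form_B ?w) - ext_d (tsyE q ?w) = fscale (qscale (1 / fact (q + Suc ?n)) 1)
      (tsy q (form_B ?w) - of_nat (Suc (q + ?n)) * ext_d (tsy q ?w))"
    by (simp only: tsyE_homog[OF form_B_in_homog[OF w]] free.scale_right_diff_distrib)
  then show "tsyE q (form_B ?w) - ext_d (tsyE q ?w) \<in> DR"
    by (simp only: free.subspace_scale[OF subspaces(3)] tsy_form_B[OF w])
qed (intro lin_intros lin_compose_tsyE)

end

section \<open>Isomorphisms on homology\<close>

lemma residue_class_eq_iff:
  assumes "free.subspace M" shows "residue_class M x = residue_class M y \<longleftrightarrow> x - y \<in> M"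
proof
  assume "residue_class M x = residue_class M y"
  moreover have "x \<in> residue_class M x" by (simp add: residue_class_def free.subspace_0[OF assms])
  ultimately show "x - y \<in> M" by (auto simp: residue_class_def)
next
  assume xy: "x - y \<in> M"
  have "z - y \<in> M" if "z - x \<in> M" for z
    using free.subspace_add[OF assms that xy] by simp
  moreover have "z - x \<in> M" if "z - y \<in> M" for z
    using free.subspace_diff[OF assms that xy] by simp
  ultimately show "residue_class M x = residue_class M y" by (auto simp: residue_class_def)
qed

lemma homology_isoI:
  assumes lin: "lin f" "lin \<delta>" "free.subspace N" "free.subspace G"
    and cycles: "\<And>x. x \<in> cycles N \<delta> G \<Longrightarrow> f x \<in> cycles N' \<delta>' G'"
    and bound: "\<And>x. x \<in> add_image N \<delta> \<Longrightarrow> f x \<in> add_image N' \<delta>'"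
    and inj: "\<And>x. x \<in> cycles N \<delta> G \<Longrightarrow> f x \<in> add_image N' \<delta>' \<Longrightarrow> x \<in> add_image N \<delta>"
    and surj: "\<And>y. y \<in> cycles N' \<delta>' G' \<Longrightarrow> \<exists>x\<in>cycles N \<delta> G. y - f x \<in> add_image N' \<delta>'"
  shows "homology_iso f N \<delta> G N' \<delta>' G'"
proof -
  let ?M = "add_image N \<delta>" and ?M' = "add_image N' \<delta>'"
  let ?C = "cycles N \<delta> G"
  note eq = residue_class_eq_iff[OF subspace_add_image]
  have diff: "x - y \<in> ?C" if "x \<in> ?C" "y \<in> ?C" for x y
    using that by (auto simp: cycles_def module_hom.diff[OF lin(2)] intro: free.subspace_diff lin)
  have iff: "residue_class ?M x = residue_class ?M y \<longleftrightarrow> residue_class ?M' (f x) = residue_class ?M' (f y)"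
    if "x \<in> ?C" "y \<in> ?C" for x y
    unfolding eq using bound[of "x - y"] inj[OF diff[OF that]] by (auto simp: module_hom.diff[OF lin(1)])
  define \<phi> where "\<phi> c = residue_class ?M' (f (SOME x. x \<in> ?C \<and> residue_class ?M x = c))" for c
  have \<phi>: "\<phi> (residue_class ?M x) = residue_class ?M' (f x)" if x: "x \<in> ?C" for x
  proof -
    define y where "y = (SOME y. y \<in> ?C \<and> residue_class ?M y = residue_class ?M x)"
    have "y \<in> ?C \<and> residue_class ?M y = residue_class ?M x"
      unfolding y_def by (rule someI[where x = x]) (simp add: x)
    then have "residue_class ?M' (f y) = residue_class ?M' (f x)" using iff x by blast
    then show ?thesis by (simp add: \<phi>_def y_def)
  qed
  have "bij_betw \<phi> (homology N \<delta> G) (homology N' \<delta>' G')"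
  proof (rule bij_betwI')
    fix c d assume "c \<in> homology N \<delta> G" "d \<in> homology N \<delta> G"
    then obtain x y where xy: "x \<in> ?C" "c = residue_class ?M x" "y \<in> ?C" "d = residue_class ?M y"
      by (auto simp: homology_def)
    show "(\<phi> c = \<phi> d) = (c = d)" unfolding xy \<phi>[OF xy(1)] \<phi>[OF xy(3)] using iff[OF xy(1,3)] by blast
  next
    fix c assume "c \<in> homology N \<delta> G"
    then show "\<phi> c \<in> homology N' \<delta>' G'" using \<phi> cycles by (auto simp: homology_def)
  next
    fix d assume "d \<in> homology N' \<delta>' G'"
    then obtain y where y: "y \<in> cycles N' \<delta>' G'" "d = residue_class ?M' y" by (auto simp: homology_def)
    from surj[OF y(1)] obtain x where x: "x \<in> ?C" "y - f x \<in> ?M'" by blast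
    have "d = \<phi> (residue_class ?M x)" unfolding \<phi>[OF x(1)] y(2) eq by (rule x(2))
    then show "\<exists>c\<in>homology N \<delta> G. d = \<phi> c" using x(1) by (auto simp: homology_def)
  qed
  then show ?thesis unfolding homology_iso_def using lin(1) \<phi> by blast
qed

lemma add_image_cong:
  assumes "\<And>x. \<delta> x - \<delta>' x \<in> N" "free.subspace N" shows "add_image N \<delta> = add_image N \<delta>'"
proof -
  have "add_image N \<delta> \<subseteq> add_image N \<delta>'" if d: "\<And>x. \<delta> x - \<delta>' x \<in> N" for \<delta> \<delta>'
    unfolding add_image_def[of N \<delta>]
  proof (rule free.span_minimal)
    have "\<delta> x \<in> add_image N \<delta>'" for x
      using free.subspace_add[OF subspace_add_image add_image_base[OF d] add_image_range[of \<delta>' x N], of x]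
      by simp
    then show "N \<union> range \<delta> \<subseteq> add_image N \<delta>'" by (auto intro: add_image_base)
  qed simp
  from this[of \<delta> \<delta>'] this[of \<delta>' \<delta>] show ?thesis
    using assms(1) free.subspace_neg[OF assms(2) assms(1)] by (simp add: subset_antisym)
qed

lemma cycles_cong:
  assumes "\<And>x. \<delta> x - \<delta>' x \<in> N" "free.subspace N" shows "cycles N \<delta> G = cycles N \<delta>' G"
proof -
  have "\<delta> x \<in> N \<longleftrightarrow> \<delta>' x \<in> N" for x
    using free.subspace_diff[OF assms(2) _ assms(1)[of x], of "\<delta> x"]
      free.subspace_add[OF assms(2) assms(1)[of x], of "\<delta>' x"] by auto
  then show ?thesis by (simp add: cycles_def)
qed

text \<open>Allows the operators picked by \<open>SOME\<close>, which are determined modulo the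
  submodules only, to be exchanged for explicit lifts.\<close>

lemma homology_iso_cong:
  assumes "\<And>x. \<delta> x - \<delta>' x \<in> N" "free.subspace N" "\<And>x. f x - g x \<in> M" "lin f" "lin g"
  shows "homology_iso f N \<delta> G M \<epsilon> H = homology_iso g N \<delta>' G M \<epsilon> H"
proof -
  have "residue_class (add_image M \<epsilon>) (f x) = residue_class (add_image M \<epsilon>) (g x)" for x
    by (simp add: residue_class_eq_iff add_image_base assms(3))
  then show ?thesis
    unfolding homology_iso_def homology_def cycles_cong[OF assms(1,2)] add_image_cong[OF assms(1,2)]
    using assms(4,5) by simp
qed

lemma ext_d_homog:
  fixes f :: "('a, 'k::comm_ring_1) ext_free"
  assumes "f \<in> ext_homog n q" shows "ext_d f \<in> ext_homog (Suc n) q"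
proof (rule ext_homog_lin_memI[OF assms(1) lin_ext_d subspace_ext_homog])
  fix w :: "'a ext_gen list"
  assume "word_deg ext_form_deg w = n" "word_deg ext_t_deg w = q"
  then show "(ext_d (monomial w) :: ('a, 'k) ext_free) \<in> ext_homog (Suc n) q"
  proof (induction w arbitrary: n q)
    case (Cons x w)
    have w: "(monomial w :: ('a, 'k) ext_free) \<in> ext_homog (word_deg ext_form_deg w) (word_deg ext_t_deg w)"
      by (simp add: ext_homog_def monomial_in_homog)
    have IH: "(ext_d (monomial w) :: ('a, 'k) ext_free) \<in>
        ext_homog (Suc (word_deg ext_form_deg w)) (word_deg ext_t_deg w)"
      using Cons.IH by blast
    show ?case
      using Cons.prems ext_homog_mult[OF ext_gen_homog(1) IH] ext_homog_mult[OF ext_gen_homog(2) IH]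
        ext_homog_mult[OF ext_gen_homog(3) IH] ext_homog_mult[OF ext_gen_homog(2) w]
      by (cases x rule: ext_gen_cases)
        (auto simp: ext_monomial_Cons intro!: free.subspace_add[OF subspace_ext_homog]
          free.subspace_neg[OF subspace_ext_homog])
  qed (simp add: free.subspace_0[OF subspace_ext_homog])
qed

context form_algebra
begin

lemma DR_graded:
  assumes "y \<in> DR" "\<And>a. deg (Form (Elt a)) = 0" "\<And>a. deg (Form (Dif a)) = m"
  shows "hpart deg n y \<in> DR"
proof (rule lin_span_memI[OF assms(1)[unfolded reduced_DR_sub_def] lin_hpart subspaces(3)])
  fix s :: "('a, 'k) ext_free" assume "s \<in> I \<union> supercommutators ext_form_deg \<union> range ((^) ext_t)"
  then consider "s \<in> I" | "s \<in> supercommutators ext_form_deg" | k where "s = ext_t ^ k" by blast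
  then show "hpart deg n s \<in> DR"
  proof cases
    case 1
    then show ?thesis using I_graded[OF 1, of deg m n] assms(2,3) by (auto intro: I_sub_DR)
  next
    case 2
    show ?thesis
    proof (rule lin_span_memI[OF supercommutators_span[OF 2] lin_hpart subspaces(3)])
      fix s :: "('a, 'k) ext_free" assume "s \<in> {letter_comm ext_form_deg x w | x w. True}"
      then obtain x w where s: "s = letter_comm ext_form_deg x w" by blast
      have "monomial [x] * monomial w - (-1) ^ (ext_form_deg x * word_deg ext_form_deg w) *
          (monomial w * monomial [x]) \<in> DR"
        by (rule super_DR) (auto intro: monomial_in_homog)
      then show "hpart deg n s \<in> DR"
        unfolding s hpart_letter_comm by (simp add: letter_comm_def free.subspace_0)
    qed
  next
    case 3
    have "monomial (replicate k T) = (ext_t ^ k :: ('a, 'k) ext_free)"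
      by (induction k) (auto simp: ext_monomial_Cons)
    then have "hpart deg n (ext_t ^ k :: ('a, 'k) ext_free) = ext_t ^ k \<or>
        hpart deg n (ext_t ^ k :: ('a, 'k) ext_free) = 0"
      by (metis hpart_monomial)
    then show ?thesis using t_power_DR[of k] by (auto simp: 3 free.subspace_0)
  qed
qed

lemma ext_i_DR: assumes "y \<in> DR" shows "ext_i y \<in> DR"
proof (rule lin_span_memI[OF assms[unfolded reduced_DR_sub_def] lin_ext_i subspaces(3)])
  fix s :: "('a, 'k) ext_free" assume "s \<in> I \<union> supercommutators ext_form_deg \<union> range ((^) ext_t)"
  then consider "s \<in> I" | "s \<in> supercommutators ext_form_deg" | k where "s = ext_t ^ k" by blast
  then show "ext_i s \<in> DR"
  proof cases
    case 2
    then obtain f g m n where s: "s = f * g - (-1) ^ (m * n) * (g * f)"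
      and f: "f \<in> homog ext_form_deg m" and g: "g \<in> homog ext_form_deg n"
      by (auto simp: supercommutators_def)
    have h: "(\<exists>k. x \<in> homog ext_form_deg k \<and> ext_i x \<in> homog ext_form_deg (k - 1) \<and> k = j \<and>
        (k = 0 \<longrightarrow> ext_i x = 0))" if x: "x \<in> homog ext_form_deg j" for x :: "('a, 'k) ext_free" and j
    proof (cases j)
      case 0
      then show ?thesis using x by (simp add: ext_i_homog_0 free.subspace_0[OF subspace_homog])
    next
      case (Suc i)
      have "ext_i x \<in> homog ext_form_deg i"
      proof (rule homog_lin_memI[OF x lin_ext_i subspace_homog])
        fix w :: "'a ext_gen list" assume "word_deg ext_form_deg w = j"
        then have "(monomial w :: ('a, 'k) ext_free) \<in> ext_homog (Suc i) (word_deg ext_t_deg w)"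
          by (simp add: ext_homog_def monomial_in_homog Suc)
        from ext_i_homog[OF this] show "(ext_i (monomial w) :: ('a, 'k) ext_free) \<in> homog ext_form_deg i"
          by (simp add: ext_homog_def)
      qed
      then show ?thesis using x Suc by simp
    qed
    \<comment> \<open>For \<open>m = 0\<close> the truncated \<open>m - 1\<close> is
      \<open>0\<close>, which is harmless because \<open>ext_i f\<close> then vanishes; likewise for
      \<open>n\<close>.\<close>
    have f': "ext_i f \<in> homog ext_form_deg (m - 1)" "m = 0 \<longrightarrow> ext_i f = 0"
      and g': "ext_i g \<in> homog ext_form_deg (n - 1)" "n = 0 \<longrightarrow> ext_i g = 0"
      using h[OF f] h[OF g] by auto
    have "ext_i s = (ext_i f * g - (-1) ^ ((m - 1) * n) * (g * ext_i f))
        + (-1) ^ m * (f * ext_i g - (-1) ^ (m * (n - 1)) * (ext_i g * f))"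
    proof (cases m)
      case 0
      then show ?thesis using f' par_homog[OF g] par_homog[OF f]
        by (simp add: s ext_i_mult)
    next
      case (Suc i)
      note m = this
      have e: "ext_i s = ext_i f * g + (-1) ^ m * (f * ext_i g)
          - (-1) ^ (m * n) * (ext_i g * f + (-1) ^ n * (g * ext_i f))"
        using par_homog[OF g] par_homog[OF f]
        by (cases "even (m * n)") (simp_all add: s ext_i_mult mult.assoc)
      show ?thesis
      proof (cases n)
        case 0
        then show ?thesis using g' by (simp add: e)
      next
        case (Suc j)
        then show ?thesis unfolding e m
          by (cases "even i"; cases "even j") (simp_all add: algebra_simps)
      qed
    qed
    moreover have "(-1) ^ m * (f * ext_i g - (-1) ^ (m * (n - 1)) * (ext_i g * f)) \<in> DR"
      using super_DR[OF f g'(1)] free.subspace_neg[OF subspaces(3) super_DR[OF f g'(1)]]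
      by (cases "even m") simp_all
    ultimately show ?thesis
      using free.subspace_add[OF subspaces(3) super_DR[OF f'(1) g]] by simp
  qed (auto simp: free.subspace_0 intro: I_sub_DR ext_i_I)
qed

lemma ext_d_DR: assumes "y \<in> DR" shows "ext_d y \<in> DR"
proof (rule lin_span_memI[OF assms[unfolded reduced_DR_sub_def] lin_ext_d subspaces(3)])
  fix s :: "('a, 'k) ext_free" assume "s \<in> I \<union> supercommutators ext_form_deg \<union> range ((^) ext_t)"
  then consider "s \<in> I" | "s \<in> supercommutators ext_form_deg" | k where "s = ext_t ^ k" by blast
  then show "ext_d s \<in> DR"
  proof cases
    case 2
    then obtain f g m n where s: "s = f * g - (-1) ^ (m * n) * (g * f)"
      and f: "f \<in> homog ext_form_deg m" and g: "g \<in> homog ext_form_deg n"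
      by (auto simp: supercommutators_def)
    have h: "ext_d x \<in> homog ext_form_deg (Suc j)" if "x \<in> homog ext_form_deg j"
      for x :: "('a, 'k) ext_free" and j
    proof (rule homog_lin_memI[OF that lin_ext_d subspace_homog])
      fix w :: "'a ext_gen list" assume "word_deg ext_form_deg w = j"
      then have "(monomial w :: ('a, 'k) ext_free) \<in> ext_homog j (word_deg ext_t_deg w)"
        by (simp add: ext_homog_def monomial_in_homog)
      from ext_d_homog[OF this] show "(ext_d (monomial w) :: ('a, 'k) ext_free) \<in> homog ext_form_deg (Suc j)"
        by (simp add: ext_homog_def)
    qed
    have "ext_d s = (ext_d f * g - (-1) ^ (Suc m * n) * (g * ext_d f))
        + (-1) ^ m * (f * ext_d g - (-1) ^ (m * Suc n) * (ext_d g * f))"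
      using par_homog[OF g] par_homog[OF f]
      by (cases "even m"; cases "even n") (simp_all add: s ext_d_mult)
    moreover have "(-1) ^ m * (f * ext_d g - (-1) ^ (m * Suc n) * (ext_d g * f)) \<in> DR"
      using super_DR[OF f h[OF g]] free.subspace_neg[OF subspaces(3) super_DR[OF f h[OF g]]]
      by (cases "even m") simp_all
    ultimately show ?thesis
      using free.subspace_add[OF subspaces(3) super_DR[OF h[OF f] g]] by simp
  qed (auto simp: free.subspace_0 intro: I_sub_DR ext_d_I)
qed

end

section \<open>Components of a given bidegree\<close>

definition bipart :: "nat \<Rightarrow> nat \<Rightarrow> ('a, 'k::comm_ring_1) ext_free \<Rightarrow> ('a, 'k) ext_free" where
  "bipart p q f = hpart ext_t_deg q (hpart ext_form_deg p f)"

lemma lin_bipart: "lin (bipart p q)"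
  unfolding bipart_def[abs_def] by (intro lin_intros)

lemma bipart_monomial:
  "bipart p q (monomial w) = (if word_deg ext_form_deg w = p \<and> word_deg ext_t_deg w = q then monomial w else 0)"
  by (simp add: bipart_def hpart_monomial module_hom.zero[OF lin_hpart])

lemma bipart_in_homog: "bipart p q f \<in> ext_homog p q"
  by (rule lin_memI[OF lin_bipart subspace_ext_homog])
    (auto simp: bipart_monomial ext_homog_def monomial_in_homog free.subspace_0[OF subspace_homog])

lemma bipart_homog: "f \<in> ext_homog p q \<Longrightarrow> bipart p q f = f"
  by (simp add: bipart_def ext_homog_def hpart_homog)

lemma bipart_homog_other:
  assumes "f \<in> ext_homog p' q'" "p \<noteq> p' \<or> q \<noteq> q'" shows "bipart p q f = 0"
proof -
  have "bipart p q f \<in> {0}"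
    by (rule ext_homog_lin_memI[OF assms(1) lin_bipart free.subspace_single_0])
      (use assms(2) in \<open>auto simp: bipart_monomial\<close>)
  then show ?thesis by simp
qed

lemma bipart_ext_d: "bipart (Suc p) q (ext_d f) = ext_d (bipart p q f)" "bipart 0 q (ext_d f) = 0"
proof -
  have h: "monomial w \<in> ext_homog (word_deg ext_form_deg w) (word_deg ext_t_deg w)" for w
    by (simp add: ext_homog_def monomial_in_homog)
  show "bipart (Suc p) q (ext_d f) = ext_d (bipart p q f)"
  proof (rule lin_eqI[where f = "\<lambda>f. bipart (Suc p) q (ext_d f)"])
    show "bipart (Suc p) q (ext_d (monomial w)) = ext_d (bipart p q (monomial w))" for w
      using bipart_homog[OF ext_d_homog[OF h[of w]]] bipart_homog_other[OF ext_d_homog[OF h[of w]], of "Suc p" q]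
      by (auto simp: bipart_monomial)
  qed (auto intro!: lin_compose[OF lin_bipart] lin_compose[OF lin_ext_d] lin_bipart lin_ext_d)
  show "bipart 0 q (ext_d f) = 0"
    by (rule lin_eqI[where f = "\<lambda>f. bipart 0 q (ext_d f)" and g = "\<lambda>_. 0"])
      (auto intro!: lin_compose[OF lin_bipart] lin_ext_d lin_zero bipart_homog_other[OF ext_d_homog[OF h]])
qed

lemma bipart_ext_i:
  fixes f :: "('a, 'k::comm_ring_1) ext_free"
  shows "bipart p (Suc q) (ext_i f) = ext_i (bipart (Suc p) q f)"
proof (rule lin_eqI[where f = "\<lambda>f. bipart p (Suc q) (ext_i f)"])
  fix w :: "'a ext_gen list"
  let ?w = "monomial w :: ('a, 'k) ext_free"
  show "bipart p (Suc q) (ext_i ?w) = ext_i (bipart (Suc p) q ?w)"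
  proof (cases "word_deg ext_form_deg w")
    case 0
    then have "ext_i ?w = 0" by (intro ext_i_homog_0 monomial_in_homog)
    then show ?thesis using 0 by (simp add: bipart_monomial module_hom.zero[OF lin_bipart])
  next
    case (Suc m)
    then have "?w \<in> ext_homog (Suc m) (word_deg ext_t_deg w)"
      by (simp add: ext_homog_def monomial_in_homog)
    note h = ext_i_homog[OF this]
    show ?thesis
      using bipart_homog[OF h] bipart_homog_other[OF h, of p "Suc q"] Suc
      by (auto simp: bipart_monomial)
  qed
qed (auto intro!: lin_compose[OF lin_bipart] lin_compose[OF lin_ext_i] lin_bipart lin_ext_i)

context split_form_algebra
begin

lemma bipart_DR: "y \<in> DR \<Longrightarrow> bipart p q y \<in> DR"
  unfolding bipart_def by (intro DR_graded[where m = 0] DR_graded[where m = 1]) auto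

lemma tsyE_unscale: "tsy q x = fscale (of_nat (fact (q + n))) (tsyE q x)" if "x \<in> homog form_deg n"
proof -
  have "of_nat (fact (q + n)) * qscale (1 / fact (q + n)) 1 = (1 :: 'k)"
    using qscale_mult[of "of_nat (fact (q + n))" "1 / fact (q + n)"] qscale_of_nat[of 1]
      qscale_of_nat[of "fact (q + n)"] by (simp add: of_nat_fact)
  then show ?thesis by (simp add: tsyE_homog[OF that])
qed

text \<open>The image of \<open>b y\<close> in degree \<open>q\<close> is the boundary of the
  component of \<open>y\<close> in degree \<open>q - 1\<close>. For \<open>q = 0\<close> there is no
  such component, and \<open>b y\<close> has to be recognised as a sum of commutators
  instead.\<close>

lemma tsyE_add_image_form_b:
  assumes x: "x \<in> add_image N form_b" and N: "\<And>y. y \<in> N \<Longrightarrow> tsyE q y \<in> M" and CA: "\<And>y. y \<in> CA \<Longrightarrow> y \<in> M"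
  shows "tsyE q x \<in> add_image M ext_i"
  using x
proof (rule lin_add_image[OF _ lin_tsyE subspace_add_image])
  show "tsyE q y \<in> add_image M ext_i" if "y \<in> N" for y using that by (intro add_image_base N)
  show "tsyE q (form_b y) \<in> add_image M ext_i" for y
  proof (cases q)
    case 0
    then show ?thesis by (simp add: add_image_base CA tsyE_0_form_b)
  next
    case (Suc m)
    from free.subspace_diff[OF subspace_add_image add_image_range[of ext_i "tsyE m y" M] add_image_base[OF CA[OF tsyE_chain[of m y]]]]
    show ?thesis by (simp add: Suc)
  qed
qed

lemma tsyE_NB: assumes "x \<in> NB" shows "tsyE q x \<in> DRd"
  using assms unfolding NB_def
proof (rule lin_add_image[OF _ lin_tsyE])
  show "tsyE q (form_B y) \<in> DRd" for y
    using free.subspace_add[OF subspace_add_image add_image_base[OF tsyE_form_B[of q y]] add_image_range[of ext_d "tsyE q y" DR]]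
    by (simp add: DRd_def)
qed (auto simp: DRd_def intro: add_image_base CA_sub_DR tsyE_N0)

lemma tsyE_surj:
  assumes f: "f \<in> ext_homog p q" "ext_i f \<in> DR"
  shows "\<exists>x\<in>homog form_deg p. form_b x \<in> N0 \<and> f - tsyE q x \<in> DRi"
proof -
  from DR_cycles_surj[OF f] obtain x where x: "x \<in> homog form_deg p" "form_b x \<in> N0"
    "of_nat (max 1 (p + q)) * f - tsy q x \<in> DRi" by blast
  let ?M = "max 1 (p + q)"
  \<comment> \<open>Undoes the factor from summing over rotations and the factorial between
    \<open>tsy\<close> and \<open>tsyE\<close>.\<close>
  let ?c = "qscale (1 / of_nat ?M) 1 * of_nat (fact (q + p))"
  have M: "?M > 0" by simp
  have "fscale (qscale (1 / of_nat ?M) 1) (of_nat ?M * f - tsy q x) = f - tsyE q (fscale ?c x)"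
    by (simp only: free.scale_right_diff_distrib fscale_inverse[OF M] tsyE_unscale[OF x(1)]
        tsyE_lin_simps free.scale_scale)
  with free.subspace_scale[OF subspace_DRi x(3)] have "f - tsyE q (fscale ?c x) \<in> DRi" by metis
  moreover have "fscale ?c x \<in> homog form_deg p" by (rule free.subspace_scale[OF subspace_homog x(1)])
  moreover have "form_b (fscale ?c x) \<in> N0" using x(2) by (simp add: free.subspace_scale)
  ultimately show ?thesis by blast
qed

lemma tsyE_inj:
  assumes x: "x \<in> homog form_deg n" "form_b x \<in> N0" and "tsyE q x \<in> DRi" shows "x \<in> add_image N0 form_b"
  using tsy_inj[OF x, of q] free.subspace_scale[OF subspace_DRi assms(3)] by (simp add: tsyE_unscale[OF x(1)])

lemma form_B_NB: assumes "x \<in> NB" shows "form_B x \<in> I0"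
  using assms unfolding NB_def
proof (rule lin_add_image[OF _ lin_form_B subspaces0(1)])
  show "form_B (form_B y) \<in> I0" for y
    by (rule lin_memI[where f = "\<lambda>y. form_B (form_B y)", OF lin_compose[OF lin_form_B lin_form_B] subspaces0(1)])
      (simp add: form_B_form_B[OF monomial_in_homog[OF refl]] I0_zero)
qed (rule form_B_N0)

lemma N0_sub_NB: "x \<in> N0 \<Longrightarrow> x \<in> NB"
  unfolding NB_def by (rule add_image_base)

lemma DRi_sub: "x \<in> DRi \<Longrightarrow> x \<in> add_image DRd ext_i"
  unfolding DRi_def
  by (erule lin_add_image[where f = "\<lambda>x. x"])
    (auto intro: lin_id add_image_base add_image_range simp: DRd_def)

text \<open>If \<open>i f = d g\<close>, then \<open>i g\<close> is closed, hence exact under \<open>d\<close>; so \<open>g\<close> is a cycle modulo exact forms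
  of lower degree, and \<open>d g\<close> comes from \<open>B y\<close> if \<open>g\<close> comes from \<open>y\<close>.\<close>

lemma tsyE_surj_cyclic:
  assumes "f \<in> ext_homog p q" "ext_i f \<in> DRd"
  shows "\<exists>x\<in>homog form_deg p. form_b x \<in> NB \<and> f - tsyE q x \<in> add_image DRd ext_i"
  using assms
proof (induction p arbitrary: f q rule: less_induct)
  case (less p)
  have part1: ?case if "ext_i f \<in> DR"
    using tsyE_surj[OF less.prems(1) that] N0_sub_NB DRi_sub by blast
  from less.prems(2) obtain \<delta> g where g: "\<delta> \<in> DR" "ext_i f = \<delta> + ext_d g"
    unfolding DRd_def by (rule add_imageD) (auto intro: lin_ext_d)
  consider "p = 0" | "p = 1" | m where "p = Suc (Suc m)"
    by (metis One_nat_def not0_implies_Suc)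
  then show ?case
  proof cases
    case 1
    then have "ext_i f = 0" using less.prems(1) by (simp add: ext_i_homog_0 ext_homog_def)
    then show ?thesis by (intro part1) (simp add: free.subspace_0)
  next
    case 2
    \<comment> \<open>An exact form has no component of de Rham degree \<open>0\<close>, so
      \<open>f\<close> is already a cycle modulo \<open>DR\<close>.\<close>
    then have "ext_i f \<in> ext_homog 0 (Suc q)" using ext_i_homog[of f 0 q] less.prems(1) by simp
    then have "ext_i f = bipart 0 (Suc q) (ext_i f)" by (simp add: bipart_homog)
    also have "\<dots> = bipart 0 (Suc q) \<delta>"
      by (simp add: g(2) module_hom.add[OF lin_bipart] bipart_ext_d)
    finally show ?thesis using bipart_DR[OF g(1), of 0 "Suc q"] by (intro part1) simp
  next
    case 3
    let ?g = "bipart m (Suc q) g"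
    have "ext_i f \<in> ext_homog (Suc m) (Suc q)" using ext_i_homog[of f "Suc m" q] less.prems(1) 3 by simp
    then have "ext_i f = bipart (Suc m) (Suc q) (ext_i f)" by (simp add: bipart_homog)
    also have "\<dots> = bipart (Suc m) (Suc q) \<delta> + ext_d ?g"
      by (simp add: g(2) module_hom.add[OF lin_bipart] bipart_ext_d)
    finally have if_dg: "ext_i f - ext_d ?g \<in> DR" using bipart_DR[OF g(1), of "Suc m" "Suc q"] by simp
    have "(ext_t :: ('a, 'k) ext_free) \<in> ext_homog 0 1" by (rule ext_gen_homog)
    then have comm_t: "x * ext_t - ext_t * x \<in> DR" for x
      using free.subspace_neg[OF subspaces(3) comm_DR[of ext_t x]] by (simp add: ext_homog_def)
    \<comment> \<open>\<open>ext_i\<close> and \<open>ext_d\<close> anticommute up to a commutator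
      with \<open>t\<close>, which lies in \<open>DR\<close>.\<close>
    have "ext_i (ext_d ?g) \<in> DR"
      using free.subspace_neg[OF subspaces(3) ext_i_DR[OF if_dg]] by simp
    from free.subspace_diff[OF subspaces(3) comm_t[of ?g] this]
    have closed: "ext_d (ext_i ?g) \<in> DR" by (simp add: ext_i_d)
    have "ext_i ?g \<in> homog ext_t_deg (Suc (Suc q))"
    proof (cases m)
      case 0
      then show ?thesis
        using bipart_in_homog[of m "Suc q" g]
        by (simp add: ext_homog_def ext_i_homog_0 free.subspace_0[OF subspace_homog])
    next
      case (Suc m')
      then show ?thesis
        using ext_i_homog[of ?g m' "Suc q"] bipart_in_homog[of m "Suc q" g] by (simp add: ext_homog_def)
    qed
    \<comment> \<open>The degree of \<open>ext_i ?g\<close> in \<open>t\<close> is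
      \<open>q + 2\<close>, hence positive as the Poincare lemma requires.\<close>
    from Poincare_DR[OF this closed] have "ext_i ?g \<in> DRd" .
    from less.IH[OF _ bipart_in_homog this] 3 obtain y
      where y: "y \<in> homog form_deg m" "form_b y \<in> NB" "?g - tsyE (Suc q) y \<in> add_image DRd ext_i"
      by auto
    from y(3) obtain \<eta> c where c: "\<eta> \<in> DRd" "?g - tsyE (Suc q) y = \<eta> + ext_i c"
      by (rule add_imageD) (auto intro: lin_ext_i simp: DRd_def)
    from c(1) obtain \<theta> e where e: "\<theta> \<in> DR" "\<eta> = \<theta> + ext_d e"
      unfolding DRd_def by (rule add_imageD) (auto intro: lin_ext_d)
    let ?c = "bipart (Suc m) q c" and ?\<theta> = "bipart m (Suc q) \<theta>" and ?e = "bipart m (Suc q) (ext_d e)"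
    have "bipart m (Suc q) (?g - tsyE (Suc q) y) = ?g - tsyE (Suc q) y"
      by (intro bipart_homog free.subspace_diff[OF subspace_ext_homog] bipart_in_homog tsyE_in_homog y)
    then have "?g - tsyE (Suc q) y = bipart m (Suc q) (\<eta> + ext_i c)"
      by (simp only: c(2)[symmetric])
    then have gy: "?g = tsyE (Suc q) y + ?\<theta> + ?e + ext_i ?c"
      by (simp add: e module_hom.add[OF lin_bipart] bipart_ext_i algebra_simps)
    have de: "ext_d ?e = 0" by (cases m) (simp_all add: bipart_ext_d)
    have By: "form_B y \<in> homog form_deg (Suc m)" by (rule form_B_in_homog[OF y(1)])
    \<comment> \<open>\<open>b B y\<close> is \<open>- B b y\<close> modulo relations, and
      \<open>B\<close> annihilates \<open>NB\<close> because its square is zero.\<close>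
    have bBy: "form_b (form_B y) \<in> N0"
      using I0_diff[OF form_b_form_B[OF y(1)] form_B_NB[OF y(2)]] by (simp add: I0_sub_N0)
    note DR_add = free.subspace_add[OF subspaces(3)] and DR_diff = free.subspace_diff[OF subspaces(3)]
    have dg: "ext_d ?g = ext_d (tsyE (Suc q) y) + ext_d ?\<theta> + (?c * ext_t - ext_t * ?c) - ext_i (ext_d ?c)"
      by (subst gy) (simp add: module_hom.add[OF lin_ext_d] de ext_i_d)
    have "(ext_i f - ext_d ?g) + (ext_d ?\<theta> + (?c * ext_t - ext_t * ?c))
        - (tsyE (Suc q) (form_B y) - ext_d (tsyE (Suc q) y)) \<in> DR"
      by (intro DR_add DR_diff if_dg comm_t tsyE_form_B ext_d_DR bipart_DR e)
    \<comment> \<open>Adding the exact form \<open>ext_d ?c\<close> does not change the class of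
      \<open>f\<close> modulo \<open>DRd\<close>, and it makes \<open>ext_i\<close> of the sum equal
      to the image of \<open>B y\<close> modulo \<open>DR\<close>.\<close>
    then have iB: "ext_i (f + ext_d ?c) - tsyE (Suc q) (form_B y) \<in> DR"
      by (rule memI) (simp add: dg module_hom.add[OF lin_ext_i] algebra_simps)
    have "ext_i (f + ext_d ?c) - (ext_i (f + ext_d ?c) - tsyE (Suc q) (form_B y)) \<in> DRi"
      by (rule free.subspace_diff[OF subspace_DRi ext_i_DRi DR_sub_DRi[OF iB]])
    then have "tsyE (Suc q) (form_B y) \<in> DRi" by simp
    \<comment> \<open>The image of \<open>B y\<close> is thus a boundary, so injectivity on
      Hochschild homology makes \<open>B y\<close> itself a boundary \<open>b z\<close> up to
      constants.\<close>
    from tsyE_inj[OF By bBy this] obtain \<nu> z where z: "\<nu> \<in> N0" "form_B y = \<nu> + form_b z"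
      by (rule add_imageD) (auto intro: lin_form_b)
    let ?z = "hpart form_deg p z" and ?\<nu> = "hpart form_deg (Suc m) \<nu>"
    have zp: "?z \<in> homog form_deg p" by (rule hpart_in_homog)
    have "hpart form_deg (Suc m) (form_B y) = form_B y" by (rule hpart_homog[OF By])
    then have Byz: "form_B y = ?\<nu> + form_b ?z"
      by (simp add: z(2) module_hom.add[OF lin_hpart] hpart_form_b 3)
    have \<nu>: "?\<nu> \<in> N0" by (rule hpart_N0[OF z(1)])
    \<comment> \<open>Subtracting the image of \<open>z\<close> removes the last obstruction:
      \<open>?f\<close> is a cycle modulo \<open>DR\<close>, to which surjectivity for Hochschild
      homology applies.\<close>
    let ?f = "f + ext_d ?c - tsyE q ?z"
    have "ext_d ?c \<in> ext_homog p q" using ext_d_homog[OF bipart_in_homog[of "Suc m" q c]] 3 by simp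
    then have f2: "?f \<in> ext_homog p q"
      by (intro free.subspace_diff[OF subspace_ext_homog] free.subspace_add[OF subspace_ext_homog]
          less.prems tsyE_in_homog[OF zp])
    have "(ext_i (f + ext_d ?c) - tsyE (Suc q) (form_B y)) + tsyE (Suc q) ?\<nu>
        - (ext_i (tsyE q ?z) - tsyE (Suc q) (form_b ?z)) \<in> DR"
      by (intro DR_add DR_diff iB CA_sub_DR[OF tsyE_N0] CA_sub_DR[OF tsyE_chain] \<nu>)
    then have "ext_i ?f \<in> DR"
      by (rule memI) (simp add: Byz module_hom.diff[OF lin_ext_i] tsyE_lin_simps algebra_simps)
    from tsyE_surj[OF f2 this] obtain x
      where x: "x \<in> homog form_deg p" "form_b x \<in> N0" "?f - tsyE q x \<in> DRi" by blast
    have "form_b x - ?\<nu> + form_B y \<in> NB"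
      unfolding NB_def
      by (intro free.subspace_add free.subspace_diff subspace_add_image add_image_base x \<nu> add_image_range)
    then have 1: "form_b (x + ?z) \<in> NB"
      by (rule memI) (simp add: Byz)
    have "(?f - tsyE q x) - ext_d ?c \<in> add_image DRd ext_i"
      by (intro free.subspace_diff subspace_add_image DRi_sub x add_image_base)
        (simp add: DRd_def add_image_range)
    then have 2: "f - tsyE q (x + ?z) \<in> add_image DRd ext_i"
      by (rule memI) (simp add: tsyE_lin_simps algebra_simps)
    show ?thesis using free.subspace_add[OF subspace_homog x(1) zp] 1 2 by blast
  qed
qed

end

context form_algebra
begin

section \<open>Comparison of the chosen operators with the explicit lifts\<close>

lemma snoc_normal:
  assumes "length as = Suc m"
  obtains bs c where "(elt a * pd as :: ('a, 'k) form_free) = elt a * pd bs * dif c"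
    "(elt a * pd bs :: ('a, 'k) form_free) \<in> homog form_deg m"
proof -
  from assms obtain bs c where as: "as = bs @ [c]" by (cases as rule: rev_cases) auto
  have "(elt a * pd bs :: ('a, 'k) form_free) \<in> homog form_deg m"
    using homog_mult[OF elt_homog pd_homog, of a bs] assms as by simp
  then show ?thesis using that as by (simp add: mult.assoc)
qed

lemma hochschild_b_spec:
  "quot_linear N0 N0 (hochschild_b scale) \<and> (\<forall>\<alpha>\<in>homog form_deg 0. hochschild_b scale \<alpha> \<in> N0) \<and>
   (\<forall>m a. \<forall>\<alpha>\<in>homog form_deg m.
      hochschild_b scale (\<alpha> * dif a) - (-1) ^ m * (\<alpha> * elt a - elt a * \<alpha>) \<in> N0)"
proof -
  let ?P = "\<lambda>b. quot_linear N0 N0 b \<and> (\<forall>\<alpha>\<in>homog form_deg 0. b \<alpha> \<in> N0) \<and>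
     (\<forall>m a. \<forall>\<alpha>\<in>homog form_deg m. b (\<alpha> * dif a) - (-1) ^ m * (\<alpha> * elt a - elt a * \<alpha>) \<in> N0)"
  have "?P form_b"
  proof (intro conjI allI ballI)
    fix m a and \<alpha> :: "('a, 'k) form_free" assume "\<alpha> \<in> homog form_deg m"
    then show "form_b (\<alpha> * dif a) - (-1) ^ m * (\<alpha> * elt a - elt a * \<alpha>) \<in> N0"
      by (cases "even m") (simp_all add: form_b_mult_dif par_homog free.subspace_0)
  qed (auto simp: quot_linear_def lin_form_b form_b_N0 form_b_homog_0 free.subspace_0)
  from someI[of ?P, OF this] show ?thesis unfolding hochschild_b_def .
qed

lemma lin_hochschild_b: "lin (hochschild_b scale)"
  using hochschild_b_spec by (simp add: quot_linear_def)

text \<open>The prescribed values cover degree \<open>0\<close> and all forms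
  \<open>\<alpha> da\<close>, hence a spanning set; so every admissible choice agrees with
  \<open>form_b\<close> modulo \<open>N0\<close>.\<close>

lemma hochschild_b_eq: "hochschild_b scale x - form_b x \<in> N0"
proof (rule lin_memI[where f = "\<lambda>x. hochschild_b scale x - form_b x"])
  show "lin (\<lambda>x. hochschild_b scale x - form_b x)" by (rule lin_minus[OF lin_hochschild_b lin_form_b])
  fix w :: "'a form_gen list"
  show "hochschild_b scale (monomial w) - form_b (monomial w) \<in> N0"
  proof (cases "word_deg form_deg w")
    case 0
    then have "(monomial w :: ('a, 'k) form_free) \<in> homog form_deg 0" by (rule monomial_in_homog)
    then show ?thesis using hochschild_b_spec by (simp add: form_b_homog_0)
  next
    case (Suc m)
    show ?thesis
    proof (rule form_normal_cong[OF monomial_in_homog[OF refl] lin_hochschild_b lin_form_b])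
      show "hochschild_b scale y \<in> N0" if "y \<in> I0" for y
        using hochschild_b_spec I0_sub_N0[OF that] by (auto simp: quot_linear_def)
      show "form_b y \<in> N0" if "y \<in> I0" for y by (intro form_b_N0 I0_sub_N0 that)
      fix a :: 'a and as :: "'a list" assume "length as = word_deg form_deg w"
      with Suc have "length as = Suc m" by simp
      then obtain bs c where as: "(elt a * pd as :: ('a, 'k) form_free) = elt a * pd bs * dif c"
        and h: "(elt a * pd bs :: ('a, 'k) form_free) \<in> homog form_deg m"
        by (rule snoc_normal)
      have "form_b (elt a * pd bs * dif c :: ('a, 'k) form_free) = (-1) ^ m * (elt a * pd bs * elt c - elt c * (elt a * pd bs))"
        unfolding form_b_mult_dif par_homog[OF h] by (cases "even m") simp_all
      then show "hochschild_b scale (elt a * pd as) - form_b (elt a * pd as) \<in> N0"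
        using hochschild_b_spec h unfolding as by simp
    qed simp
  qed
qed simp

lemma karoubi_spec:
  "quot_linear I0 I0 (karoubi scale) \<and>
   (\<forall>m a. \<forall>\<alpha>\<in>homog form_deg m. karoubi scale (\<alpha> * dif a) - (-1) ^ m * (dif a * \<alpha>) \<in> I0)"
proof -
  let ?P = "\<lambda>\<kappa>. quot_linear I0 I0 \<kappa> \<and>
     (\<forall>m a. \<forall>\<alpha>\<in>homog form_deg m. \<kappa> (\<alpha> * dif a) - (-1) ^ m * (dif a * \<alpha>) \<in> I0)"
  have "?P kap"
  proof (intro conjI allI ballI)
    fix m a and \<alpha> :: "('a, 'k) form_free" assume "\<alpha> \<in> homog form_deg m"
    then show "kap (\<alpha> * dif a) - (-1) ^ m * (dif a * \<alpha>) \<in> I0"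
      by (cases "even m") (simp_all add: par_homog I0_zero)
  qed (auto simp: quot_linear_def lin_kap kap_I0)
  from someI[of ?P, OF this] show ?thesis unfolding karoubi_def .
qed

lemma karoubi_eq:
  assumes "x \<in> homog form_deg (Suc m)" shows "karoubi scale x - kap x \<in> I0"
proof (rule form_normal_cong[OF assms])
  show "lin (karoubi scale)" "\<And>y. y \<in> I0 \<Longrightarrow> karoubi scale y \<in> I0"
    using karoubi_spec by (auto simp: quot_linear_def)
  fix a :: 'a and as :: "'a list" assume "length as = Suc m"
  then obtain bs c where as: "(elt a * pd as :: ('a, 'k) form_free) = elt a * pd bs * dif c"
    and h: "(elt a * pd bs :: ('a, 'k) form_free) \<in> homog form_deg m"
    by (rule snoc_normal)
  have "kap (elt a * pd bs * dif c :: ('a, 'k) form_free) = (-1) ^ m * (dif c * (elt a * pd bs))"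
    by (cases "even m") (simp_all only: kap_mult_dif par_homog[OF h], simp_all)
  then show "karoubi scale (elt a * pd as) - kap (elt a * pd as) \<in> I0"
    using karoubi_spec h unfolding as by simp
qed (auto intro: lin_kap kap_I0)

lemma connes_B_eq: "connes_B scale x - form_B x \<in> I0"
proof (rule lin_memI[where f = "\<lambda>x. connes_B scale x - form_B x"])
  show "lin (\<lambda>x. connes_B scale x - form_B x)"
    unfolding connes_B_def by (rule lin_minus[OF lin_lin_ext lin_form_B])
  fix w :: "'a form_gen list"
  let ?x = "form_d (monomial w) :: ('a, 'k) form_free"
  have x: "?x \<in> homog form_deg (Suc (word_deg form_deg w))" by (intro form_d_homog monomial_in_homog refl)
  \<comment> \<open>As \<open>form_d\<close> raises the degree, the iteration stays in positive
    degree, where the values of \<open>karoubi\<close> are prescribed.\<close>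
  have "(karoubi scale ^^ i) ?x - (kap ^^ i) ?x \<in> I0" for i
  proof (induction i)
    case (Suc i)
    have "karoubi scale ((karoubi scale ^^ i) ?x - (kap ^^ i) ?x) +
        (karoubi scale ((kap ^^ i) ?x) - kap ((kap ^^ i) ?x)) \<in> I0"
      using karoubi_spec Suc by (intro I0_add karoubi_eq[OF kap_power_homog[OF x]]) (auto simp: quot_linear_def)
    then show ?case
      using karoubi_spec by (auto simp: quot_linear_def module_hom.diff)
  qed (simp add: I0_zero)
  then show "connes_B scale (monomial w) - form_B (monomial w) \<in> I0"
    unfolding form_B_homog[OF monomial_in_homog[OF refl]]
    by (simp add: connes_B_def free.subspace_sum flip: sum_subtractf)
qed simp

end

context rational_form_algebra
begin

lemma tsygan_spec:
  "quot_linear N0 DR (tsygan qscale scale q) \<and>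
   (\<forall>a as. tsygan qscale scale q (elt a * pd as) - tsygan_value qscale q a as \<in> DR)"
proof -
  let ?P = "\<lambda>E. quot_linear N0 DR E \<and>
      (\<forall>a as. E (elt a * pd as) - tsygan_value qscale q a as \<in> DR)"
  have "tsyE q (elt a * pd as) = tsygan_value qscale q a as" for a as
    using tsyE_homog[OF homog_mult[OF elt_homog pd_homog], of q a as] by (simp add: tsygan_value_eq)
  then have "?P (tsyE q)"
    by (auto simp: quot_linear_def lin_tsyE free.subspace_0 intro: CA_sub_DR tsyE_N0)
  from someI[of ?P, OF this] show ?thesis unfolding tsygan_def .
qed

lemma lin_tsygan: "lin (tsygan qscale scale q)"
  using tsygan_spec by (simp add: quot_linear_def)

lemma tsygan_eq: "tsygan qscale scale q x - tsyE q x \<in> DR"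
proof (rule lin_memI[where f = "\<lambda>x. tsygan qscale scale q x - tsyE q x"])
  show "lin (\<lambda>x. tsygan qscale scale q x - tsyE q x)" by (rule lin_minus[OF lin_tsygan lin_tsyE])
  fix w :: "'a form_gen list"
  show "tsygan qscale scale q (monomial w) - tsyE q (monomial w) \<in> DR"
  proof (rule form_normal_cong[OF monomial_in_homog[OF refl] lin_tsygan lin_tsyE])
    show "tsygan qscale scale q y \<in> DR" if "y \<in> I0" for y
      using tsygan_spec I0_sub_N0[OF that] by (auto simp: quot_linear_def)
    show "tsyE q y \<in> DR" if "y \<in> I0" for y by (intro I_sub_DR tsyE_I0 that)
    fix a :: 'a and as :: "'a list"
    have "tsyE q (elt a * pd as) = tsygan_value qscale q a as"
      using tsyE_homog[OF homog_mult[OF elt_homog pd_homog], of q a as] by (simp add: tsygan_value_eq)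
    then show "tsygan qscale scale q (elt a * pd as) - tsyE q (elt a * pd as) \<in> DR"
      using tsygan_spec by simp
  qed simp
qed simp

end

context split_form_algebra
begin

lemma homology_iso_tsygan:
  "homology_iso (tsygan qscale scale q) N0 (hochschild_b scale) (homog form_deg n) DR ext_i (ext_homog n q)"
proof -
  have "homology_iso (tsyE q) N0 form_b (homog form_deg n) DR ext_i (ext_homog n q)"
  proof (rule homology_isoI[OF lin_tsyE lin_form_b subspaces0(2) subspace_homog])
    fix x :: "('a, 'k) form_free" assume "x \<in> cycles N0 form_b (homog form_deg n)"
    then have x: "x \<in> homog form_deg n" "form_b x \<in> N0" by (auto simp: cycles_def)
    show "tsyE q x \<in> cycles DR ext_i (ext_homog n q)"
      using free.subspace_add[OF subspaces(3) CA_sub_DR[OF tsyE_chain[of q x]] CA_sub_DR[OF tsyE_N0[OF x(2), of "Suc q"]]]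
      by (simp add: cycles_def tsyE_in_homog x(1))
    show "x \<in> add_image N0 form_b" if "tsyE q x \<in> add_image DR ext_i"
      using tsyE_inj[OF x] that by (simp add: DRi_def)
  next
    show "tsyE q x \<in> add_image DR ext_i" if "x \<in> add_image N0 form_b" for x
      using that by (rule tsyE_add_image_form_b) (auto intro: CA_sub_DR tsyE_N0)
    show "\<exists>x\<in>cycles N0 form_b (homog form_deg n). y - tsyE q x \<in> add_image DR ext_i"
      if "y \<in> cycles DR ext_i (ext_homog n q)" for y
      using tsyE_surj[of y n q] that by (auto simp: cycles_def DRi_def)
  qed
  then show ?thesis
    by (subst homology_iso_cong[where \<delta>' = form_b and g = "tsyE q"])
      (simp_all add: hochschild_b_eq tsygan_eq lin_tsygan lin_tsyE)
qed

lemma homology_iso_tsygan_cyclic: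
  "homology_iso (tsygan qscale scale q) (add_image N0 (connes_B scale)) (hochschild_b scale) (homog form_deg n)
     (add_image DR ext_d) ext_i (ext_homog n q)"
proof -
  have "homology_iso (tsyE q) NB form_b (homog form_deg n) DRd ext_i (ext_homog n q)"
  proof (rule homology_isoI[OF lin_tsyE lin_form_b _ subspace_homog])
    fix x :: "('a, 'k) form_free" assume "x \<in> cycles NB form_b (homog form_deg n)"
    then have x: "x \<in> homog form_deg n" "form_b x \<in> NB" by (auto simp: cycles_def)
    have "free.subspace DRd" by (simp add: DRd_def)
    note free.subspace_add[OF this _ tsyE_NB[OF x(2), of "Suc q"]]
    from this[of "ext_i (tsyE q x) - tsyE (Suc q) (form_b x)"]
    show "tsyE q x \<in> cycles DRd ext_i (ext_homog n q)"
      using CA_sub_DR[OF tsyE_chain[of q x]]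
      by (simp add: cycles_def tsyE_in_homog x(1) DRd_def add_image_base)
    show "x \<in> add_image NB form_b" if "tsyE q x \<in> add_image DRd ext_i"
      using tsy_inj_cyclic[OF x, of q] free.subspace_scale[OF subspace_add_image that]
      by (simp add: tsyE_unscale[OF x(1)])
  next
    show "tsyE q x \<in> add_image DRd ext_i" if "x \<in> add_image NB form_b" for x
      using that by (rule tsyE_add_image_form_b[OF _ tsyE_NB]) (auto simp: DRd_def intro: add_image_base CA_sub_DR)
    show "\<exists>x\<in>cycles NB form_b (homog form_deg n). y - tsyE q x \<in> add_image DRd ext_i"
      if "y \<in> cycles DRd ext_i (ext_homog n q)" for y
      using tsyE_surj_cyclic[of y n q] that by (auto simp: cycles_def)
  qed (simp add: NB_def)
  moreover have "add_image N0 (connes_B scale) = NB"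
    unfolding NB_def by (rule add_image_cong) (auto intro: I0_sub_N0 connes_B_eq)
  moreover have "hochschild_b scale x - form_b x \<in> NB" for x by (rule N0_sub_NB[OF hochschild_b_eq])
  moreover have "tsygan qscale scale q x - tsyE q x \<in> DRd" for x
    unfolding DRd_def by (rule add_image_base[OF tsygan_eq])
  moreover have "free.subspace NB" by (simp add: NB_def)
  ultimately show ?thesis
    using homology_iso_cong[of "hochschild_b scale" form_b NB "tsygan qscale scale q" "tsyE q" DRd,
        OF _ _ _ lin_tsygan lin_tsyE]
    by (simp flip: DRd_def)
qed

end

theorem theorem5p3p10:
  fixes qscale :: "rat \<Rightarrow> 'k::comm_ring_1 \<Rightarrow> 'k"
    and scale :: "'k \<Rightarrow> 'a::ring_1 \<Rightarrow> 'a"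
  assumes "unital_algebra qscale"
    and "unital_algebra scale"
    and "split_unit scale"
  shows "\<forall>q n.
     homology_iso (tsygan qscale scale q)
       (reduced_form_sub scale) (hochschild_b scale) (homog form_deg n)
       (reduced_DR_sub scale) ext_i (ext_homog n q) \<and>
     homology_iso (tsygan qscale scale q)
       (add_image (reduced_form_sub scale) (connes_B scale)) (hochschild_b scale) (homog form_deg n)
       (add_image (reduced_DR_sub scale) ext_d) ext_i (ext_homog n q)"
proof -
  from assms(3) obtain r where r: "module_hom scale (*) r" "\<And>c. r (scale c 1) = c"
    unfolding split_unit_def by blast
  interpret split_form_algebra scale qscale r
    by (intro split_form_algebra.intro rational_form_algebra.intro form_algebra.intro
        split_form_algebra_axioms.intro assms r)
  show ?thesis by (intro allI conjI homology_iso_tsygan homology_iso_tsygan_cyclic)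
qed

end
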